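(* Let $d\in\{2,3\}$, and let $\phi$ be the global weak solution on $\mathbb{T}^d$ of the penalized Allen-Cahn-Ohta-Kawasaki (pACOK) equation $$\frac{\partial}{\partial t}\phi=\epsilon\Delta\phi-\frac1\epsilon W'(\phi)-\gamma\big[(-\Delta)^{-1}(f(\phi)-\omega)\big]f'(\phi)-M\Big(\int_{\mathbb{T}^d}(f(\phi)-\omega)\,dx\Big)f'(\phi),\qquad \phi(0,\cdot)=\phi_0,$$ where $f$ is the extended nonlinearity $f(s)=0$ for $s<0$, $f(s)=3s^2-2s^3$ for $0\le s\le1$, $f(s)=1$ for $s>1$. Suppose $\phi_0\in H^1(\mathbb{T}^d)$ and $$\frac{\epsilon\tilde\omega}{6}\Big[\gamma\|(-\Delta)^{-1}\|+M|\mathbb{T}^d|\Big]\le 1 .$$ If $0\le\phi_0\le1$, then $0\le\phi(t)\le1$ for every $t>0$.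
   Context: $\mathbb{T}^d=\prod_{i=1}^d[-X_i,X_i]\subset\mathbb{R}^d$ is a periodic box, and all function spaces on it are periodic. The parameters are $\epsilon>0$, $\gamma>0$, $M>0$, $\omega\in(0,1)$, with $\tilde\omega=\max\{\omega,1-\omega\}$. $W(\phi)=18(\phi^2-\phi)^2$. For $g$ on $\mathbb{T}^d$, $(-\Delta)^{-1}g$ is the periodic mean-zero function $u$ with $-\Delta u=g-\frac{1}{|\mathbb{T}^d|}\int_{\mathbb{T}^d}g\,dx$. $\|(-\Delta)^{-1}\|$ is the norm of $(-\Delta)^{-1}$ as an operator from $L^\infty(\mathbb{T}^d)$ to itself, i.e. the optimal constant $C$ in $\|(-\Delta)^{-1}g\|_{L^\infty}\le C\|g\|_{L^\infty}$. Global weak solution: for every $T>0$, $\phi\in C([0,T];L^p(\mathbb{T}^d))\cap L^\infty(0,T;H^1(\mathbb{T}^d))\cap L^2(0,T;H^2(\mathbb{T}^d))$ for $p\in[2,6)$, $\phi(0,x)=\phi_0(x)$, and for every test function $w\in L^2(\mathbb{T}^d)$, $$\frac{d}{dt}\int_{\mathbb{T}^d}\phi(t,x)w(x)\,dx=\int_{\mathbb{T}^d}\Big[\epsilon\Delta\phi-\tfrac1\epsilon W'(\phi)-\gamma(-\Delta)^{-1}(f(\phi)-\omega)f'(\phi)-M\Big(\int_{\mathbb{T}^d}(f(\phi)-\omega)\,dx\Big)f'(\phi)\Big]w\,dx$$ in the distributional sense in $(0,T)$. *)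

theory Defs
  imports "HOL-Analysis.Analysis" "HOL-Probability.Essential_Supremum"
begin

text \<open>
  The torus with half-periods \<open>X \<bullet> b\<close> (\<open>b \<in> Basis\<close>) is represented by its fundamental box
  \<open>cbox (-X) X\<close>; the overlap of opposite faces is a null set. A function on the torus is a
  function on the whole space of which only the values on the box matter, up to null sets.
  Periodicity of Sobolev functions is expressed by testing the weak derivatives against all
  smooth periodic functions, not only against those supported inside the box.
\<close>

abbreviation torus :: "'a::euclidean_space \<Rightarrow> 'a measure" where
  "torus X \<equiv> lebesgue_on (cbox (-X) X)"

definition torus_vol :: "'a::euclidean_space \<Rightarrow> real" where
  "torus_vol X = measure lebesgue (cbox (-X) X)"


section \<open>Lebesgue spaces\<close>

definition in_Lp :: "real \<Rightarrow> 'a measure \<Rightarrow> ('a \<Rightarrow> real) \<Rightarrow> bool" where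
  "in_Lp p M u \<longleftrightarrow> u \<in> borel_measurable M \<and> integrable M (\<lambda>x. \<bar>u x\<bar> powr p)"

definition Lp_norm :: "real \<Rightarrow> 'a measure \<Rightarrow> ('a \<Rightarrow> real) \<Rightarrow> real" where
  "Lp_norm p M u = (\<integral>x. \<bar>u x\<bar> powr p \<partial>M) powr (1 / p)"

definition Linf_norm :: "'a measure \<Rightarrow> ('a \<Rightarrow> real) \<Rightarrow> ereal" where
  "Linf_norm M u = esssup M (\<lambda>x. ereal \<bar>u x\<bar>)"

definition in_Linf :: "'a measure \<Rightarrow> ('a \<Rightarrow> real) \<Rightarrow> bool" where
  "in_Linf M u \<longleftrightarrow> u \<in> borel_measurable M \<and> Linf_norm M u < \<infinity>"


section \<open>Smooth functions\<close>

definition partial_deriv :: "'a::euclidean_space \<Rightarrow> ('a \<Rightarrow> real) \<Rightarrow> 'a \<Rightarrow> real" where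
  "partial_deriv b g x = frechet_derivative g (at x) b"

fun C_k :: "nat \<Rightarrow> ('a::euclidean_space \<Rightarrow> real) \<Rightarrow> bool" where
  "C_k 0 g \<longleftrightarrow> continuous_on UNIV g"
| "C_k (Suc k) g \<longleftrightarrow> (\<forall>x. g differentiable (at x)) \<and> (\<forall>b\<in>Basis. C_k k (partial_deriv b g))"

definition smooth :: "('a::euclidean_space \<Rightarrow> real) \<Rightarrow> bool" where
  "smooth g \<longleftrightarrow> (\<forall>k. C_k k g)"

definition periodic :: "'a::euclidean_space \<Rightarrow> ('a \<Rightarrow> real) \<Rightarrow> bool" where
  "periodic X g \<longleftrightarrow> (\<forall>b\<in>Basis. \<forall>x. g (x + (2 * (X \<bullet> b)) *\<^sub>R b) = g x)"


section \<open>Periodic Sobolev spaces\<close>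

definition is_weak_partial ::
  "'a::euclidean_space \<Rightarrow> 'a \<Rightarrow> ('a \<Rightarrow> real) \<Rightarrow> ('a \<Rightarrow> real) \<Rightarrow> bool" where
  "is_weak_partial X b u v \<longleftrightarrow>
     (\<forall>\<eta>. smooth \<eta> \<and> periodic X \<eta> \<longrightarrow>
        (\<integral>x. u x * partial_deriv b \<eta> x \<partial>torus X) = - (\<integral>x. v x * \<eta> x \<partial>torus X))"

text \<open>The weak derivative is determined up to a null set; \<open>SOME\<close> picks a representative.\<close>

definition weak_partial :: "'a::euclidean_space \<Rightarrow> 'a \<Rightarrow> ('a \<Rightarrow> real) \<Rightarrow> 'a \<Rightarrow> real" where
  "weak_partial X b u = (SOME v. in_Lp 2 (torus X) v \<and> is_weak_partial X b u v)"

definition in_H1 :: "'a::euclidean_space \<Rightarrow> ('a \<Rightarrow> real) \<Rightarrow> bool" where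
  "in_H1 X u \<longleftrightarrow> in_Lp 2 (torus X) u \<and>
     (\<forall>b\<in>Basis. \<exists>v. in_Lp 2 (torus X) v \<and> is_weak_partial X b u v)"

definition in_H2 :: "'a::euclidean_space \<Rightarrow> ('a \<Rightarrow> real) \<Rightarrow> bool" where
  "in_H2 X u \<longleftrightarrow> in_H1 X u \<and> (\<forall>b\<in>Basis. in_H1 X (weak_partial X b u))"

definition H1_norm :: "'a::euclidean_space \<Rightarrow> ('a \<Rightarrow> real) \<Rightarrow> real" where
  "H1_norm X u = sqrt ((Lp_norm 2 (torus X) u)\<^sup>2 +
     (\<Sum>b\<in>Basis. (Lp_norm 2 (torus X) (weak_partial X b u))\<^sup>2))"

definition H2_norm :: "'a::euclidean_space \<Rightarrow> ('a \<Rightarrow> real) \<Rightarrow> real" where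
  "H2_norm X u = sqrt ((H1_norm X u)\<^sup>2 +
     (\<Sum>b\<in>Basis. \<Sum>c\<in>Basis. (Lp_norm 2 (torus X) (weak_partial X c (weak_partial X b u)))\<^sup>2))"

definition laplacian :: "'a::euclidean_space \<Rightarrow> ('a \<Rightarrow> real) \<Rightarrow> 'a \<Rightarrow> real" where
  "laplacian X u x = (\<Sum>b\<in>Basis. weak_partial X b (weak_partial X b u) x)"


section \<open>The inverse Laplacian\<close>

definition inv_laplacian :: "'a::euclidean_space \<Rightarrow> ('a \<Rightarrow> real) \<Rightarrow> 'a \<Rightarrow> real" where
  "inv_laplacian X g = (SOME u. in_H2 X u \<and> (\<integral>x. u x \<partial>torus X) = 0 \<and>
     (AE x in torus X. - laplacian X u x = g x - (\<integral>y. g y \<partial>torus X) / torus_vol X))"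

text \<open>Valued in \<open>[0, \<infinity>]\<close>, so that the infimum is over a nonempty set without appeal to elliptic
  regularity.\<close>

definition inv_laplacian_norm :: "'a::euclidean_space \<Rightarrow> ereal" where
  "inv_laplacian_norm X = Inf {C::ereal. 0 \<le> C \<and>
     (\<forall>g. in_Linf (torus X) g \<longrightarrow>
        Linf_norm (torus X) (inv_laplacian X g) \<le> C * Linf_norm (torus X) g)}"


section \<open>The pACOK equation\<close>

definition W :: "real \<Rightarrow> real" where
  "W s = 18 * (s\<^sup>2 - s)\<^sup>2"

definition f :: "real \<Rightarrow> real" where
  "f s = (if s < 0 then 0 else if s \<le> 1 then 3 * s\<^sup>2 - 2 * s ^ 3 else 1)"

definition pACOK_rhs ::
  "'a::euclidean_space \<Rightarrow> real \<Rightarrow> real \<Rightarrow> real \<Rightarrow> real \<Rightarrow> ('a \<Rightarrow> real) \<Rightarrow> 'a \<Rightarrow> real" where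
  "pACOK_rhs X \<epsilon> \<gamma> M \<omega> u x =
     \<epsilon> * laplacian X u x - 1 / \<epsilon> * deriv W (u x)
     - \<gamma> * inv_laplacian X (\<lambda>y. f (u y) - \<omega>) x * deriv f (u x)
     - M * (\<integral>y. (f (u y) - \<omega>) \<partial>torus X) * deriv f (u x)"

definition in_C_Lp :: "real \<Rightarrow> real \<Rightarrow> 'a::euclidean_space \<Rightarrow> (real \<Rightarrow> 'a \<Rightarrow> real) \<Rightarrow> bool" where
  "in_C_Lp p T X \<phi> \<longleftrightarrow>
     (\<forall>t\<in>{0..T}. in_Lp p (torus X) (\<phi> t)) \<and>
     (\<forall>s\<in>{0..T}. ((\<lambda>t. Lp_norm p (torus X) (\<lambda>x. \<phi> t x - \<phi> s x)) \<longlongrightarrow> 0) (at s within {0..T}))"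

text \<open>The next two definitions are used only together with \<open>in_C_Lp 2 T X \<phi>\<close>. Since the Sobolev
  spaces are separable and embed continuously into \<open>L\<^sup>2\<close>, strong measurability in time is then
  automatic, so only the norm has to be controlled.\<close>

definition in_Linf_H1 :: "real \<Rightarrow> 'a::euclidean_space \<Rightarrow> (real \<Rightarrow> 'a \<Rightarrow> real) \<Rightarrow> bool" where
  "in_Linf_H1 T X \<phi> \<longleftrightarrow>
     (AE t in lebesgue_on {0<..<T}. in_H1 X (\<phi> t)) \<and>
     in_Linf (lebesgue_on {0<..<T}) (\<lambda>t. H1_norm X (\<phi> t))"

definition in_L2_H2 :: "real \<Rightarrow> 'a::euclidean_space \<Rightarrow> (real \<Rightarrow> 'a \<Rightarrow> real) \<Rightarrow> bool" where
  "in_L2_H2 T X \<phi> \<longleftrightarrow>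
     (AE t in lebesgue_on {0<..<T}. in_H2 X (\<phi> t)) \<and>
     in_Lp 2 (lebesgue_on {0<..<T}) (\<lambda>t. H2_norm X (\<phi> t))"

text \<open>\<open>a' = r\<close> in the sense of distributions on \<open>(0, T)\<close>, both sides being locally integrable.\<close>

definition distr_deriv :: "real \<Rightarrow> (real \<Rightarrow> real) \<Rightarrow> (real \<Rightarrow> real) \<Rightarrow> bool" where
  "distr_deriv T a r \<longleftrightarrow>
     (\<forall>s t. 0 < s \<and> s < t \<and> t < T \<longrightarrow>
        integrable (lebesgue_on {s..t}) a \<and> integrable (lebesgue_on {s..t}) r) \<and>
     (\<forall>\<eta>. smooth \<eta> \<and> closure {t. \<eta> t \<noteq> 0} \<subseteq> {0<..<T} \<longrightarrow>
        (\<integral>t. a t * deriv \<eta> t \<partial>lebesgue_on {0<..<T}) =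
        - (\<integral>t. r t * \<eta> t \<partial>lebesgue_on {0<..<T}))"

text \<open>The integrability clause for the right-hand side says that the integral in the weak
  formulation is meaningful; the Bochner integral of a non-integrable function would be 0. For
  \<open>d \<le> 3\<close> it follows from the regularity class, since \<open>H\<^sup>1\<close> embeds into \<open>L\<^sup>6\<close>.\<close>

definition global_weak_solution ::
  "'a::euclidean_space \<Rightarrow> real \<Rightarrow> real \<Rightarrow> real \<Rightarrow> real \<Rightarrow> ('a \<Rightarrow> real) \<Rightarrow> (real \<Rightarrow> 'a \<Rightarrow> real) \<Rightarrow> bool" where
  "global_weak_solution X \<epsilon> \<gamma> M \<omega> \<phi>0 \<phi> \<longleftrightarrow>
     (AE x in torus X. \<phi> 0 x = \<phi>0 x) \<and>
     (\<forall>T>0.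
        (\<forall>p\<in>{2..<6}. in_C_Lp p T X \<phi>) \<and> in_Linf_H1 T X \<phi> \<and> in_L2_H2 T X \<phi> \<and>
        (\<forall>w. in_Lp 2 (torus X) w \<longrightarrow>
           (AE t in lebesgue_on {0<..<T}.
              integrable (torus X) (\<lambda>x. pACOK_rhs X \<epsilon> \<gamma> M \<omega> (\<phi> t) x * w x)) \<and>
           distr_deriv T
             (\<lambda>t. \<integral>x. \<phi> t x * w x \<partial>torus X)
             (\<lambda>t. \<integral>x. pACOK_rhs X \<epsilon> \<gamma> M \<omega> (\<phi> t) x * w x \<partial>torus X)))"

end

theory Submission
  imports Defs
begin

text \<open>
  The nonlinearity \<open>f\<close> is constant outside \<open>[0, 1]\<close>, so there the nonlocal and the penalty terms
  disappear from the equation, and \<open>W'\<close> points away from \<open>[0, 1]\<close>. Testing the equation formally with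
  \<open>g(\<phi>)\<close>, where \<open>g(s) = min s 0\<close> or \<open>g(s) = max (s - 1) 0\<close>, therefore gives

  \<open>d/dt \<integral> g(\<phi>)\<^sup>2 / 2 = \<epsilon> \<integral> \<Delta>\<phi> g(\<phi>) - 1/\<epsilon> \<integral> W'(\<phi>) g(\<phi>) \<le> 0\<close>,

  and \<open>\<integral> g(\<phi>)\<^sup>2 / 2\<close> vanishes at time zero. Two points need care, since the test functions in
  the weak formulation do not depend on time and the weak derivatives are only tested against smooth
  periodic functions.

  The inequality \<open>\<integral> \<Delta>u g(u) \<le> 0\<close> for \<open>u\<close> in \<open>H\<^sup>2\<close> and monotone 1-Lipschitz \<open>g\<close> with
  \<open>g(0) = 0\<close> is proved without a chain rule, one direction at a time (\<open>weak_dissipation\<close>). For a mollification \<open>u\<^sub>n\<close> of \<open>u\<close> by trigonometric kernels, the second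
  difference quotients satisfy it by translation invariance and monotonicity, and they converge
  boundedly to the mollification of the weak second derivative. Mollification converges strongly in
  \<open>L\<^sup>2\<close> (\<open>conv_peak_kernel_L2\<close>), which gives the inequality for \<open>u\<close>.

  In time, convexity of \<open>g\<^sup>2 / 2\<close> bounds the increment of \<open>\<integral> g(\<phi>)\<^sup>2 / 2\<close> over \<open>[s, t]\<close> by the increment of
  \<open>\<integral> \<phi> w\<close> with the fixed test function \<open>w = g(\<phi>(t))\<close>. The latter is the integral over \<open>[s, t]\<close> of the
  right-hand side tested with \<open>w\<close> (\<open>distr_deriv_integral\<close>). Replacing \<open>w\<close> by \<open>g(\<phi>(\<tau>))\<close> at time \<open>\<tau>\<close>
  costs \<open>\<parallel>\<Delta>\<phi>(\<tau>)\<parallel> \<parallel>\<phi>(\<tau>) - \<phi>(t)\<parallel>\<close> in the diffusion term. For the reaction terms the pointwise bounds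
  \<open>- W'(a) g(b) \<le> C (|a - b|\<^sup>2 + |a - b|\<^sup>4)\<close> and \<open>|f'(a) g(b)| \<le> C |a - b|\<^sup>2\<close> reduce the cost to the
  distance of \<open>\<phi>(\<tau>)\<close> and \<open>\<phi>(t)\<close> in \<open>L\<^sup>2\<close> and \<open>L\<^sup>4\<close>, so that no Sobolev embedding is needed. Continuity
  of \<open>\<phi>\<close> with values in \<open>L\<^sup>2\<close> and \<open>L\<^sup>4\<close> makes these errors negligible on fine partitions
  (\<open>cutoff_of_solution_eq_0\<close>).
\<close>

section \<open>Smooth functions\<close>

lemma partial_deriv_eq:
  assumes "(g has_derivative D) (at x)"
  shows "partial_deriv b g x = D b"
  using frechet_derivative_at[OF assms] by (simp add: partial_deriv_def)

lemma differentiable_frechet: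
  "g differentiable (at x) \<Longrightarrow> (g has_derivative frechet_derivative g (at x)) (at x)"
  by (simp add: frechet_derivative_works)

lemma C_k_continuous: "C_k k g \<Longrightarrow> continuous_on UNIV g"
proof (cases k)
  case (Suc n)
  assume "C_k k g"
  then have "g differentiable (at x)" for x
    by (simp add: Suc)
  then show ?thesis
    by (simp add: continuous_on_eq_continuous_within differentiable_imp_continuous_within)
qed simp

lemma C_k_Suc_D: "C_k (Suc k) g \<Longrightarrow> C_k k g"
proof (induction k arbitrary: g)
  case 0
  then show ?case using C_k_continuous by fastforce
next
  case (Suc k)
  have "C_k k (partial_deriv b g)" if "b \<in> Basis" for b
    using Suc.IH Suc.prems that by (subst (asm) C_k.simps) blast
  moreover have "\<forall>x. g differentiable (at x)"
    using Suc.prems by simp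
  ultimately show ?case
    by simp
qed

lemma C_k_add:
  assumes "C_k k g" "C_k k h"
  shows "C_k k (\<lambda>x. g x + h x)"
  using assms
proof (induction k arbitrary: g h)
  case 0
  then show ?case by (auto intro: continuous_intros)
next
  case (Suc k)
  then have "(g has_derivative frechet_derivative g (at x)) (at x)"
    "(h has_derivative frechet_derivative h (at x)) (at x)" for x
    by (simp_all add: differentiable_frechet)
  then have D: "((\<lambda>x. g x + h x) has_derivative
      (\<lambda>v. frechet_derivative g (at x) v + frechet_derivative h (at x) v)) (at x)" for x
    by (intro derivative_intros)
  have "partial_deriv b (\<lambda>x. g x + h x) = (\<lambda>x. partial_deriv b g x + partial_deriv b h x)" for b
    using partial_deriv_eq[OF D] by (simp add: partial_deriv_def fun_eq_iff)
  then show ?case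
    using Suc differentiableI[OF D] by auto
qed

lemma C_k_mult:
  assumes "C_k k g" "C_k k h"
  shows "C_k k (\<lambda>x. g x * h x)"
  using assms
proof (induction k arbitrary: g h)
  case 0
  then show ?case by (auto intro: continuous_intros)
next
  case (Suc k)
  then have "(g has_derivative frechet_derivative g (at x)) (at x)"
    "(h has_derivative frechet_derivative h (at x)) (at x)" for x
    by (simp_all add: differentiable_frechet)
  then have D: "((\<lambda>x. g x * h x) has_derivative
      (\<lambda>v. g x * frechet_derivative h (at x) v + frechet_derivative g (at x) v * h x)) (at x)" for x
    by (intro derivative_intros)
  have "partial_deriv b (\<lambda>x. g x * h x) =
      (\<lambda>x. g x * partial_deriv b h x + partial_deriv b g x * h x)" for b
    using partial_deriv_eq[OF D] by (simp add: partial_deriv_def fun_eq_iff)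
  moreover have "C_k k g" "C_k k h"
    using Suc.prems C_k_Suc_D by blast+
  ultimately show ?case
    using Suc differentiableI[OF D] by (auto intro!: C_k_add Suc.IH)
qed

lemma C_k_const: "C_k k (\<lambda>x. c)"
proof (induction k arbitrary: c)
  case (Suc k)
  have "partial_deriv b (\<lambda>x::'a. c) = (\<lambda>x. 0)" for b
    by (simp add: partial_deriv_def fun_eq_iff)
  then show ?case
    using Suc by simp
qed simp

text \<open>The family is closed under differentiation because \<open>cos' = cos(\<cdot> + \<pi>/2)\<close>.\<close>

lemma C_k_cos_affine: "C_k k (\<lambda>x. cos (a + x \<bullet> v))"
proof (induction k arbitrary: a)
  case 0
  show ?case by (auto intro!: continuous_intros)
next
  case (Suc k)
  have D: "((\<lambda>x. cos (a + x \<bullet> v)) has_derivative (\<lambda>h. (h \<bullet> v) * - sin (a + x \<bullet> v))) (at x)" for x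
    by (auto intro!: derivative_eq_intros)
  have "partial_deriv b (\<lambda>x. cos (a + x \<bullet> v)) = (\<lambda>x. (b \<bullet> v) * cos ((a + pi / 2) + x \<bullet> v))" for b
    using partial_deriv_eq[OF D] by (simp add: fun_eq_iff minus_sin_cos_eq algebra_simps)
  then show ?case
    using Suc differentiableI[OF D] by (auto intro!: C_k_mult C_k_const)
qed

lemma partial_deriv_affine:
  fixes g :: "'a::euclidean_space \<Rightarrow> real"
  assumes "\<And>z. g differentiable (at z)"
  shows "(\<lambda>y. g (x + c *\<^sub>R y)) differentiable (at y)"
    and "partial_deriv b (\<lambda>y. g (x + c *\<^sub>R y)) = (\<lambda>y. c * partial_deriv b g (x + c *\<^sub>R y))"
proof -
  have G: "(g has_derivative frechet_derivative g (at z)) (at z)" for z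
    using assms by (rule differentiable_frechet)
  have D: "((\<lambda>y. g (x + c *\<^sub>R y)) has_derivative
      (\<lambda>v. frechet_derivative g (at (x + c *\<^sub>R y)) (c *\<^sub>R v))) (at y)" for y
    by (rule has_derivative_compose[where g = g, OF _ G]) (auto intro!: derivative_eq_intros)
  then show "(\<lambda>y. g (x + c *\<^sub>R y)) differentiable (at y)"
    by (rule differentiableI)
  have "frechet_derivative g (at z) (c *\<^sub>R v) = c * frechet_derivative g (at z) v" for z v
    using linear_scale[OF has_derivative_linear[OF G]] by simp
  then show "partial_deriv b (\<lambda>y. g (x + c *\<^sub>R y)) = (\<lambda>y. c * partial_deriv b g (x + c *\<^sub>R y))"
    using partial_deriv_eq[OF D] by (simp add: fun_eq_iff partial_deriv_def)
qed

lemma C_k_affine: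
  fixes g :: "'a::euclidean_space \<Rightarrow> real"
  assumes "C_k k g"
  shows "C_k k (\<lambda>y. g (x + c *\<^sub>R y))"
  using assms
proof (induction k arbitrary: g)
  case 0
  then show ?case
    by (auto intro!: continuous_on_compose2[of UNIV g] continuous_intros)
next
  case (Suc k)
  then have d: "g differentiable (at z)" for z
    by simp
  have "C_k k (\<lambda>y. c * partial_deriv b g (x + c *\<^sub>R y))" if "b \<in> Basis" for b
    using Suc that by (intro C_k_mult C_k_const) auto
  then show ?case
    by (simp add: partial_deriv_affine[OF d])
qed

lemma C_k_uminus: "C_k k g \<Longrightarrow> C_k k (\<lambda>x. - g x)"
  using C_k_mult[OF C_k_const, of k g "-1"] by simp

lemma C_k_divide:
  assumes "C_k k g" "C_k k h" "\<And>x. h x \<noteq> 0"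
  shows "C_k k (\<lambda>x. g x / h x)"
proof -
  have "C_k k (\<lambda>x. inverse (h x))"
    using assms(2)
  proof (induction k)
    case 0
    then show ?case using assms(3) by (auto intro: continuous_intros)
  next
    case (Suc k)
    then have "(h has_derivative frechet_derivative h (at x)) (at x)" for x
      by (simp add: differentiable_frechet)
    then have D: "((\<lambda>x. inverse (h x)) has_derivative
        (\<lambda>v. - (inverse (h x) * frechet_derivative h (at x) v * inverse (h x)))) (at x)" for x
      using assms(3) by (intro derivative_intros)
    have "partial_deriv b (\<lambda>x. inverse (h x)) =
        (\<lambda>x. - (inverse (h x) * partial_deriv b h x * inverse (h x)))" for b
      using partial_deriv_eq[OF D] by (simp add: partial_deriv_def fun_eq_iff)
    moreover have "C_k k (\<lambda>x. inverse (h x))"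
      using Suc C_k_Suc_D by blast
    ultimately show ?case
      using Suc.prems differentiableI[OF D] by (auto intro!: C_k_mult C_k_uminus)
  qed
  from C_k_mult[OF assms(1) this] show ?thesis
    by (simp add: divide_inverse)
qed

lemma partial_deriv_reflect_shift:
  fixes g :: "'a::euclidean_space \<Rightarrow> real"
  assumes "\<And>z. g differentiable (at z)"
  shows "partial_deriv b (\<lambda>y. g (x - y)) = (\<lambda>y. - partial_deriv b g (x - y))"
  using partial_deriv_affine(2)[OF assms, of b x "-1"] by simp

lemma smooth_mult: "smooth g \<Longrightarrow> smooth h \<Longrightarrow> smooth (\<lambda>x. g x * h x)"
  and smooth_add: "smooth g \<Longrightarrow> smooth h \<Longrightarrow> smooth (\<lambda>x. g x + h x)"
  and smooth_const: "smooth (\<lambda>x. c)"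
  and smooth_cos_affine: "smooth (\<lambda>x. cos (a + x \<bullet> v))"
  and smooth_affine: "smooth g \<Longrightarrow> smooth (\<lambda>y. g (x + c *\<^sub>R y))"
  and smooth_divide: "smooth g \<Longrightarrow> smooth h \<Longrightarrow> (\<And>x. h x \<noteq> 0) \<Longrightarrow> smooth (\<lambda>x. g x / h x)"
  by (simp_all add: smooth_def C_k_mult C_k_add C_k_const C_k_cos_affine C_k_affine C_k_divide)

lemma smooth_reflect_shift: "smooth g \<Longrightarrow> smooth (\<lambda>y. g (x - y))"
  using smooth_affine[of g x "-1"] by simp

lemma smooth_diff: "smooth g \<Longrightarrow> smooth h \<Longrightarrow> smooth (\<lambda>x. g x - h x)"
  using smooth_add[of g "\<lambda>x. (-1) * h x"] smooth_mult[OF smooth_const, of h "-1"] by simp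

lemma smooth_power: "smooth g \<Longrightarrow> smooth (\<lambda>x. g x ^ n)"
  by (induction n) (simp_all add: smooth_const smooth_mult)

lemma smooth_prod:
  "(\<And>i. i \<in> I \<Longrightarrow> smooth (g i)) \<Longrightarrow> smooth (\<lambda>x. \<Prod>i\<in>I. g i x)"
  by (induction I rule: infinite_finite_induct) (simp_all add: smooth_const smooth_mult)

lemma smooth_continuous: "smooth g \<Longrightarrow> continuous_on UNIV g"
  using C_k_continuous smooth_def by blast

lemma smooth_differentiable: "smooth g \<Longrightarrow> g differentiable (at x)"
  unfolding smooth_def by (metis C_k.simps(2))

lemma smooth_partial_deriv: "smooth g \<Longrightarrow> b \<in> Basis \<Longrightarrow> smooth (partial_deriv b g)"
  unfolding smooth_def by (metis C_k.simps(2))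

lemma periodic_partial_deriv:
  fixes g :: "'a::euclidean_space \<Rightarrow> real"
  assumes "periodic X g" "\<And>x. g differentiable (at x)"
  shows "periodic X (partial_deriv b g)"
  unfolding periodic_def
proof (intro ballI allI)
  fix c x :: 'a assume c: "c \<in> Basis"
  define p where "p = (2 * (X \<bullet> c)) *\<^sub>R c"
  have "(g has_derivative frechet_derivative g (at (x + p))) (at (x + p))"
    using assms(2) by (simp add: differentiable_frechet)
  then have "((\<lambda>y. g (y + p)) has_derivative frechet_derivative g (at (x + p))) (at x)"
    by (intro has_derivative_compose[where g = g and f = "\<lambda>y. y + p" and f' = "\<lambda>h. h", simplified])
       (auto intro!: derivative_eq_intros)
  moreover have "(\<lambda>y. g (y + p)) = g"
    using assms(1) c by (auto simp: periodic_def p_def)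
  ultimately have "partial_deriv b g x = frechet_derivative g (at (x + p)) b"
    using partial_deriv_eq by metis
  then show "partial_deriv b g (x + p) = partial_deriv b g x"
    by (simp add: partial_deriv_def)
qed

lemma periodic_reflect_shift:
  assumes "periodic X g" shows "periodic X (\<lambda>y. g (x - y))"
  unfolding periodic_def
proof (intro ballI allI)
  fix b y :: 'a assume b: "b \<in> Basis"
  have "g ((x - (y + (2 * (X \<bullet> b)) *\<^sub>R b)) + (2 * (X \<bullet> b)) *\<^sub>R b) = g (x - (y + (2 * (X \<bullet> b)) *\<^sub>R b))"
    using assms b unfolding periodic_def by blast
  then show "g (x - (y + (2 * (X \<bullet> b)) *\<^sub>R b)) = g (x - y)"
    by (simp add: algebra_simps)
qed

section \<open>Integration of periodic functions over the box\<close>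

lemma periodicD:
  "periodic X F \<Longrightarrow> b \<in> Basis \<Longrightarrow> F (x + (2 * (X \<bullet> b)) *\<^sub>R b) = F x"
  by (simp add: periodic_def)

lemma periodic_shift:
  assumes "periodic X F" shows "periodic X (\<lambda>x. F (x + v))"
  unfolding periodic_def
proof (intro ballI allI)
  fix b x :: 'a assume "b \<in> Basis"
  then show "F (x + (2 * (X \<bullet> b)) *\<^sub>R b + v) = F (x + v)"
    using periodicD[OF assms, of b "x + v"] by (simp add: add_ac)
qed

text \<open>Cut the smallest box containing the given box and its translate at a face of either: the two
  slabs left over differ by one period.\<close>

lemma integral_periodic_shift_basis:
  fixes F :: "'a::euclidean_space \<Rightarrow> real"
  assumes X: "\<And>b. b \<in> Basis \<Longrightarrow> 0 < X \<bullet> b"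
    and F: "continuous_on UNIV F" "periodic X F" and b: "b \<in> Basis" and h: "0 \<le> h"
  shows "integral (cbox (-X) X) (\<lambda>x. F (x + h *\<^sub>R b)) = integral (cbox (-X) X) F"
proof -
  define e where "e = h *\<^sub>R b"
  define p where "p = (2 * (X \<bullet> b)) *\<^sub>R b"
  define Q where "Q = cbox (-X) (X + e)"
  have int: "F integrable_on cbox u v" for u v
    using F(1) continuous_on_subset integrable_continuous by blast
  have inn: "e \<bullet> i = (if i = b then h else 0)" "p \<bullet> i = (if i = b then 2 * (X \<bullet> b) else 0)"
    if "i \<in> Basis" for i
    using b that by (auto simp: e_def p_def inner_Basis)
  have 1: "Q \<inter> {x. x \<bullet> b \<le> X \<bullet> b} = cbox (-X) X"
    unfolding Q_def interval_split(1)[OF b]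
    by (rule arg_cong[where f = "cbox (- X)"], rule euclidean_eqI)
      (simp add: inn b h X less_imp_le inner_add_left)
  have 2: "Q \<inter> {x. x \<bullet> b \<ge> X \<bullet> b} = cbox (-X + p) (X - p + e + p)"
    unfolding Q_def interval_split(2)[OF b]
    by (rule arg_cong2[where f = cbox]; rule euclidean_eqI)
      (simp_all add: inn b h X less_imp_le inner_add_left inner_diff_left)
  have 3: "Q \<inter> {x. x \<bullet> b \<ge> - (X \<bullet> b) + h} = cbox (-X + e) (X + e)"
    unfolding Q_def interval_split(2)[OF b]
    by (rule arg_cong2[where f = cbox]; rule euclidean_eqI)
      (simp_all add: inn b h X less_imp_le inner_add_left inner_diff_left)
  have 4: "Q \<inter> {x. x \<bullet> b \<le> - (X \<bullet> b) + h} = cbox (-X) (X - p + e)"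
    unfolding Q_def interval_split(1)[OF b]
    by (rule arg_cong2[where f = cbox]; rule euclidean_eqI)
      (simp_all add: inn b h X less_imp_le inner_add_left inner_diff_left)
  have "integral (cbox (-X) X) (\<lambda>x. F (x + e)) = integral (cbox (-X + e) (X + e)) F"
    using integral_shift_cbox[of "-X + e" e "X + e" F] by simp
  moreover have "integral (cbox (-X + p) (X - p + e + p)) F = integral (cbox (-X) (X - p + e)) F"
    using integral_shift_cbox[of "-X + p" p "X - p + e + p" F] periodicD[OF F(2) b]
    by (simp add: p_def algebra_simps)
  moreover have "integral Q F = integral (cbox (-X) X) F + integral (cbox (-X + p) (X - p + e + p)) F"
    using integral_split[OF int b, of "-X" "X + e" "X \<bullet> b"] 1 2 by (simp add: Q_def)
  moreover have "integral Q F = integral (cbox (-X) (X - p + e)) F + integral (cbox (-X + e) (X + e)) F"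
    using integral_split[OF int b, of "-X" "X + e" "- (X \<bullet> b) + h"] 3 4 by (simp add: Q_def)
  ultimately show ?thesis
    by (simp add: e_def)
qed

lemma integral_periodic_shift:
  fixes F :: "'a::euclidean_space \<Rightarrow> real"
  assumes X: "\<And>b. b \<in> Basis \<Longrightarrow> 0 < X \<bullet> b"
    and F: "continuous_on UNIV F" "periodic X F"
  shows "integral (cbox (-X) X) (\<lambda>x. F (x + v)) = integral (cbox (-X) X) F"
proof -
  have cont: "continuous_on UNIV (\<lambda>x. F (x + w))" for w
    by (auto intro!: continuous_on_compose2[OF F(1)] continuous_intros)
  have one: "integral (cbox (-X) X) (\<lambda>x. F (x + w + h *\<^sub>R b)) = integral (cbox (-X) X) (\<lambda>x. F (x + w))"
    if b: "b \<in> Basis" for b w h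
  proof (cases "0 \<le> h")
    case True
    then show ?thesis
      using integral_periodic_shift_basis[OF X cont[of w] periodic_shift[OF F(2)] b True]
      by (simp add: add_ac)
  next
    case False
    then show ?thesis
      using integral_periodic_shift_basis[OF X cont[of "w + h *\<^sub>R b"] periodic_shift[OF F(2)] b, of "-h"]
      by (simp add: add_ac)
  qed
  have "integral (cbox (-X) X) (\<lambda>x. F (x + (\<Sum>b\<in>S. (v \<bullet> b) *\<^sub>R b))) = integral (cbox (-X) X) F"
    if "finite S" "S \<subseteq> Basis" for S
    using that
  proof (induction S rule: finite_induct)
    case (insert b S)
    then show ?case
      using one[of b "\<Sum>b\<in>S. (v \<bullet> b) *\<^sub>R b" "v \<bullet> b"] by (simp add: add_ac)
  qed simp
  from this[of Basis] show ?thesis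
    by (simp add: euclidean_representation)
qed

lemma torus_integral_continuous:
  fixes F :: "'a::euclidean_space \<Rightarrow> real"
  assumes "continuous_on UNIV F"
  shows "integrable (torus X) F" "(\<integral>x. F x \<partial>torus X) = integral (cbox (-X) X) F"
proof -
  show "integrable (torus X) F"
    using assms continuous_on_subset by (intro continuous_imp_integrable) blast
  then show "(\<integral>x. F x \<partial>torus X) = integral (cbox (-X) X) F"
    by (intro lebesgue_integral_eq_integral) auto
qed

lemma torus_integral_shift:
  fixes F :: "'a::euclidean_space \<Rightarrow> real"
  assumes X: "\<And>b. b \<in> Basis \<Longrightarrow> 0 < X \<bullet> b"
    and F: "continuous_on UNIV F" "periodic X F"
  shows "(\<integral>x. F (x + v) \<partial>torus X) = (\<integral>x. F x \<partial>torus X)"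
proof -
  have "continuous_on UNIV (\<lambda>x. F (x + v))"
    by (auto intro!: continuous_on_compose2[OF F(1)] continuous_intros)
  then show ?thesis
    using integral_periodic_shift[OF X F] by (simp add: torus_integral_continuous F(1))
qed

lemma torus_integral_reflect_shift:
  fixes F :: "'a::euclidean_space \<Rightarrow> real"
  assumes X: "\<And>b. b \<in> Basis \<Longrightarrow> 0 < X \<bullet> b"
    and F: "continuous_on UNIV F" "periodic X F"
  shows "(\<integral>y. F (x - y) \<partial>torus X) = (\<integral>y. F y \<partial>torus X)"
proof -
  have c: "continuous_on UNIV (\<lambda>y. F (x - y))" "continuous_on UNIV (\<lambda>y. F (y + x))"
    by (auto intro!: continuous_on_compose2[OF F(1)] continuous_intros)
  have "integral (cbox (-X) X) (\<lambda>y. F (x - y)) = integral (cbox (-X) X) (\<lambda>y. F (y + x))"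
    using integral_reflect[of X "-X" "\<lambda>y. F (y + x)"] by (simp add: add.commute)
  then show ?thesis
    using c by (simp add: torus_integral_continuous F(1) integral_periodic_shift[OF X F])
qed

lemma finite_measure_torus: "finite_measure (torus X)"
  by (intro finite_measure_lebesgue_on) simp

lemma measurable_torus_continuous:
  fixes F :: "'a::euclidean_space \<Rightarrow> real"
  assumes "continuous_on UNIV F"
  shows "F \<in> borel_measurable (torus X)"
  using torus_integral_continuous(1)[OF assms] by auto

section \<open>Square integrable functions\<close>

text \<open>Square integrability, with the natural number power in place of \<open>powr\<close>.\<close>

definition sq_integrable :: "'a measure \<Rightarrow> ('a \<Rightarrow> real) \<Rightarrow> bool" where
  "sq_integrable M u \<longleftrightarrow> u \<in> borel_measurable M \<and> integrable M (\<lambda>x. (u x)\<^sup>2)"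

lemma in_Lp_2_iff: "in_Lp 2 M u \<longleftrightarrow> sq_integrable M u"
  by (simp add: in_Lp_def sq_integrable_def)

lemma sq_integrable_measurable: "sq_integrable M u \<Longrightarrow> u \<in> borel_measurable M"
  by (simp add: sq_integrable_def)

lemma sq_integrable_mult:
  assumes "sq_integrable M u" "sq_integrable M v"
  shows "integrable M (\<lambda>x. u x * v x)"
proof (rule Bochner_Integration.integrable_bound[where f = "\<lambda>x. (u x)\<^sup>2 + (v x)\<^sup>2"])
  show "AE x in M. norm (u x * v x) \<le> norm ((u x)\<^sup>2 + (v x)\<^sup>2)"
  proof (rule AE_I2)
    fix x
    have "2 * (\<bar>u x\<bar> * \<bar>v x\<bar>) \<le> (u x)\<^sup>2 + (v x)\<^sup>2"
      using sum_squares_bound[of "\<bar>u x\<bar>" "\<bar>v x\<bar>"] by simp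
    then show "norm (u x * v x) \<le> norm ((u x)\<^sup>2 + (v x)\<^sup>2)"
      by (simp add: abs_mult) (smt (verit) mult_nonneg_nonneg abs_ge_zero)
  qed
qed (use assms in \<open>auto simp: sq_integrable_def\<close>)

lemma sq_integrable_dominated:
  assumes "sq_integrable M u" "v \<in> borel_measurable M" "AE x in M. \<bar>v x\<bar> \<le> \<bar>u x\<bar>"
  shows "sq_integrable M v"
  unfolding sq_integrable_def
proof (intro conjI Bochner_Integration.integrable_bound[where f = "\<lambda>x. (u x)\<^sup>2" and g = "\<lambda>x. (v x)\<^sup>2"])
  show "AE x in M. norm ((v x)\<^sup>2) \<le> norm ((u x)\<^sup>2)"
    using assms(3) by eventually_elim (simp add: abs_le_square_iff)
qed (use assms in \<open>auto simp: sq_integrable_def\<close>)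

lemma sq_integrable_add:
  assumes "sq_integrable M u" "sq_integrable M v"
  shows "sq_integrable M (\<lambda>x. u x + v x)"
proof -
  have "integrable M (\<lambda>x. (u x)\<^sup>2 + (v x)\<^sup>2 + 2 * (u x * v x))"
    using assms sq_integrable_mult[OF assms] by (auto simp: sq_integrable_def)
  moreover have "(\<lambda>x. (u x)\<^sup>2 + (v x)\<^sup>2 + 2 * (u x * v x)) = (\<lambda>x. (u x + v x)\<^sup>2)"
    by (simp add: power2_sum algebra_simps)
  ultimately show ?thesis
    using assms by (auto simp: sq_integrable_def)
qed

lemma sq_integrable_cmult: "sq_integrable M u \<Longrightarrow> sq_integrable M (\<lambda>x. c * u x)"
  by (auto simp: sq_integrable_def power_mult_distrib)

lemma sq_integrable_diff:
  assumes "sq_integrable M u" "sq_integrable M v"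
  shows "sq_integrable M (\<lambda>x. u x - v x)"
  using sq_integrable_add[OF assms(1) sq_integrable_cmult[OF assms(2), of "-1"]] by simp

lemma sq_integrable_sum:
  "(\<And>i. i \<in> I \<Longrightarrow> sq_integrable M (u i)) \<Longrightarrow> sq_integrable M (\<lambda>x. \<Sum>i\<in>I. u i x)"
  by (induction I rule: infinite_finite_induct) (auto intro: sq_integrable_add, auto simp: sq_integrable_def)

lemma sq_integrable_bounded:
  assumes "finite_measure M" "u \<in> borel_measurable M" "AE x in M. \<bar>u x\<bar> \<le> B"
  shows "sq_integrable M u"
proof -
  interpret finite_measure M by fact
  have "sq_integrable M (\<lambda>x. B)"
    by (simp add: sq_integrable_def)
  then show ?thesis
    by (rule sq_integrable_dominated) (use assms in auto)
qed

lemma sq_integrable_imp_integrable: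
  assumes "finite_measure M" "sq_integrable M u"
  shows "integrable M u"
proof -
  have "sq_integrable M (\<lambda>x. 1)"
    by (rule sq_integrable_bounded[OF assms(1), where B = 1]) auto
  from sq_integrable_mult[OF assms(2) this] show ?thesis
    by simp
qed

lemma Cauchy_Schwarz_integral:
  assumes u: "sq_integrable M u" and v: "sq_integrable M v"
  shows "\<bar>\<integral>x. u x * v x \<partial>M\<bar> \<le> sqrt (\<integral>x. (u x)\<^sup>2 \<partial>M) * sqrt (\<integral>x. (v x)\<^sup>2 \<partial>M)"
proof -
  define A B C where "A = (\<integral>x. (u x)\<^sup>2 \<partial>M)" and "B = (\<integral>x. (v x)\<^sup>2 \<partial>M)"
    and "C = (\<integral>x. u x * v x \<partial>M)"
  have [simp]: "integrable M (\<lambda>x. (u x)\<^sup>2)" "integrable M (\<lambda>x. (v x)\<^sup>2)" "integrable M (\<lambda>x. u x * v x)"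
    using u v sq_integrable_mult[OF u v] by (auto simp: sq_integrable_def)
  \<comment> \<open>a quadratic in \<open>t\<close> without sign change has nonpositive discriminant\<close>
  have q: "0 \<le> A - 2 * t * C + t\<^sup>2 * B" for t
  proof -
    have "0 \<le> (\<integral>x. (u x - t * v x)\<^sup>2 \<partial>M)"
      by simp
    also have "(\<lambda>x. (u x - t * v x)\<^sup>2) = (\<lambda>x. (u x)\<^sup>2 - (2 * t) * (u x * v x) + t\<^sup>2 * (v x)\<^sup>2)"
      by (simp add: power2_diff power_mult_distrib algebra_simps)
    finally show ?thesis
      by (simp add: A_def B_def C_def)
  qed
  have B0: "0 \<le> B" and A0: "0 \<le> A"
    by (simp_all add: A_def B_def)
  have "C\<^sup>2 \<le> A * B"
  proof (cases "B = 0")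
    case True
    have "C = 0"
    proof (rule ccontr)
      assume "C \<noteq> 0"
      then show False
        using q[of "(A + 1) / (2 * C)"] True by simp
    qed
    then show ?thesis using True by simp
  next
    case False
    then have "B > 0" using B0 by simp
    have "0 \<le> (A - 2 * (C / B) * C + (C / B)\<^sup>2 * B) * B"
      using q[of "C / B"] B0 by simp
    also have "\<dots> = A * B - C\<^sup>2"
      using \<open>B > 0\<close> by (simp add: field_simps power2_eq_square)
    finally show ?thesis by simp
  qed
  then have "sqrt (C\<^sup>2) \<le> sqrt (A * B)"
    by (rule real_sqrt_le_mono)
  then show ?thesis
    by (simp add: A_def B_def C_def real_sqrt_mult)
qed

lemma integral_sq_add_le:
  assumes u: "sq_integrable M u" and v: "sq_integrable M v"
  shows "(\<integral>x. (u x + v x)\<^sup>2 \<partial>M) \<le> 2 * (\<integral>x. (u x)\<^sup>2 \<partial>M) + 2 * (\<integral>x. (v x)\<^sup>2 \<partial>M)"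
proof -
  have "(\<integral>x. (u x + v x)\<^sup>2 \<partial>M) \<le> (\<integral>x. 2 * (u x)\<^sup>2 + 2 * (v x)\<^sup>2 \<partial>M)"
  proof (rule integral_mono)
    show "(u x + v x)\<^sup>2 \<le> 2 * (u x)\<^sup>2 + 2 * (v x)\<^sup>2" for x
      using sum_squares_bound[of "u x" "v x"] by (simp add: power2_sum)
  qed (use u v sq_integrable_add[OF u v] in \<open>auto simp: sq_integrable_def\<close>)
  also have "\<dots> = 2 * (\<integral>x. (u x)\<^sup>2 \<partial>M) + 2 * (\<integral>x. (v x)\<^sup>2 \<partial>M)"
    using u v by (simp add: sq_integrable_def)
  finally show ?thesis .
qed

section \<open>Convolution on the torus\<close>

text \<open>The integral runs over the fundamental box, which amounts to the convolution on the torus when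
  the kernel \<open>k\<close> is periodic; \<open>v\<close> is only evaluated on the box.\<close>

definition conv :: "'a::euclidean_space \<Rightarrow> ('a \<Rightarrow> real) \<Rightarrow> ('a \<Rightarrow> real) \<Rightarrow> 'a \<Rightarrow> real" where
  "conv X k v x = (\<integral>y. k (x - y) * v y \<partial>torus X)"

lemma continuous_bounded_differences:
  fixes k :: "'a::euclidean_space \<Rightarrow> real"
  assumes "continuous_on UNIV k"
  obtains B where "0 \<le> B" "\<And>x y. norm x \<le> r \<Longrightarrow> y \<in> cbox (-X) X \<Longrightarrow> \<bar>k (x - y)\<bar> \<le> B"
proof -
  have "compact ((\<lambda>(x, y). x - y) ` (cball 0 r \<times> cbox (-X) X))"
    by (intro compact_continuous_image compact_Times compact_cball compact_cbox)
      (auto simp: case_prod_beta intro!: continuous_intros)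
  then have "compact (k ` ((\<lambda>(x, y). x - y) ` (cball 0 r \<times> cbox (-X) X)))"
    using continuous_on_subset[OF assms] by (rule compact_continuous_image[rotated]) simp
  then have "bounded (k ` ((\<lambda>(x, y). x - y) ` (cball 0 r \<times> cbox (-X) X)))"
    by (rule compact_imp_bounded)
  then obtain B where B: "\<And>z. z \<in> k ` ((\<lambda>(x, y). x - y) ` (cball 0 r \<times> cbox (-X) X)) \<Longrightarrow> norm z \<le> B"
    unfolding bounded_iff by blast
  show ?thesis
  proof (rule that[of "max B 0"])
    fix x y :: 'a assume "norm x \<le> r" "y \<in> cbox (-X) X"
    then have "k (x - y) \<in> k ` ((\<lambda>(x, y). x - y) ` (cball 0 r \<times> cbox (-X) X))"
      by force
    from B[OF this] show "\<bar>k (x - y)\<bar> \<le> max B 0" by simp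
  qed simp
qed

lemma continuous_reflect_shift:
  fixes k :: "'a::euclidean_space \<Rightarrow> real"
  assumes "continuous_on UNIV k"
  shows "continuous_on UNIV (\<lambda>y. k (x - y))" "continuous_on UNIV (\<lambda>x. k (x - y))"
  by (auto intro!: continuous_on_compose2[OF assms] continuous_intros)

lemma conv_integrable:
  fixes k v :: "'a::euclidean_space \<Rightarrow> real"
  assumes k: "continuous_on UNIV k" and v: "integrable (torus X) v"
  shows "integrable (torus X) (\<lambda>y. k (x - y) * v y)"
proof -
  obtain B where B: "0 \<le> B" "\<And>x' y. norm x' \<le> norm x \<Longrightarrow> y \<in> cbox (-X) X \<Longrightarrow> \<bar>k (x' - y)\<bar> \<le> B"
    using continuous_bounded_differences[OF k] by blast
  have "integrable (torus X) (\<lambda>y. B * v y)"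
    using v by simp
  then show ?thesis
  proof (rule Bochner_Integration.integrable_bound)
    have "(\<lambda>y. k (x - y)) \<in> borel_measurable (torus X)"
      using measurable_torus_continuous continuous_reflect_shift[OF k] by blast
    then show "(\<lambda>y. k (x - y) * v y) \<in> borel_measurable (torus X)"
      using v by auto
    show "AE y in torus X. norm (k (x - y) * v y) \<le> norm (B * v y)"
      using B by (intro AE_I2) (auto simp: abs_mult intro!: mult_right_mono)
  qed
qed

lemma conv_continuous:
  fixes k :: "'a::euclidean_space \<Rightarrow> real"
  assumes k: "continuous_on UNIV k" and v: "integrable (torus X) v"
  shows "continuous_on UNIV (conv X k v)"
  unfolding continuous_on_eq_continuous_within
proof
  fix x
  show "continuous (at x) (conv X k v)"
  proof (rule continuous_at_sequentiallyI)
    fix u assume u: "u \<longlonglongrightarrow> x"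
    then obtain r where r: "\<And>n. norm (u n) \<le> r"
      using convergent_imp_Bseq[of u] unfolding Bseq_def convergent_def by blast
    obtain B where B: "0 \<le> B" "\<And>x' y. norm x' \<le> r \<Longrightarrow> y \<in> cbox (-X) X \<Longrightarrow> \<bar>k (x' - y)\<bar> \<le> B"
      using continuous_bounded_differences[OF k] by blast
    show "(\<lambda>n. conv X k v (u n)) \<longlonglongrightarrow> conv X k v x"
      unfolding conv_def
    proof (rule integral_dominated_convergence[where w = "\<lambda>y. B * \<bar>v y\<bar>"])
      show "AE y in torus X. (\<lambda>n. k (u n - y) * v y) \<longlonglongrightarrow> k (x - y) * v y"
      proof (intro AE_I2 tendsto_intros)
        fix y
        have "continuous (at (x - y)) k"
          using k by (simp add: continuous_on_eq_continuous_within)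
        moreover have "(\<lambda>n. u n - y) \<longlonglongrightarrow> x - y"
          using u by (intro tendsto_intros)
        ultimately show "(\<lambda>n. k (u n - y)) \<longlonglongrightarrow> k (x - y)"
          by (rule isCont_tendsto_compose)
      qed
      show "AE y in torus X. norm (k (u n - y) * v y) \<le> B * \<bar>v y\<bar>" for n
        using B r by (intro AE_I2) (auto simp: abs_mult intro!: mult_right_mono)
      show "integrable (torus X) (\<lambda>y. B * \<bar>v y\<bar>)"
        using v by simp
    qed (use conv_integrable[OF k v] in auto)
  qed
qed

lemma conv_periodic:
  assumes "periodic X k" shows "periodic X (conv X k v)"
proof -
  have "k (x + p - y) = k (x - y + p)" for x y p
    by (simp add: algebra_simps)
  then show ?thesis
    using periodicD[OF assms] by (simp add: periodic_def conv_def)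
qed

lemma conv_diff:
  assumes "continuous_on UNIV k" "integrable (torus X) v" "integrable (torus X) w"
  shows "conv X k (\<lambda>x. v x - w x) x = conv X k v x - conv X k w x"
  using conv_integrable[OF assms(1,2)] conv_integrable[OF assms(1,3)]
  by (simp add: conv_def right_diff_distrib)

text \<open>Averaging against a probability kernel is a contraction of \<open>L\<^sup>2\<close>: Jensen's inequality
  for the square, followed by an exchange of the integrals.\<close>

lemma conv_contraction:
  fixes k :: "'a::euclidean_space \<Rightarrow> real"
  assumes X: "\<And>b. b \<in> Basis \<Longrightarrow> 0 < X \<bullet> b"
    and k: "continuous_on UNIV k" "periodic X k" "\<And>z. 0 \<le> k z" "(\<integral>z. k z \<partial>torus X) = 1"
    and v: "sq_integrable (torus X) v"
  shows "sq_integrable (torus X) (conv X k v)"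
    and "(\<integral>x. (conv X k v x)\<^sup>2 \<partial>torus X) \<le> (\<integral>x. (v x)\<^sup>2 \<partial>torus X)"
proof -
  interpret finite_measure "torus X" by (rule finite_measure_torus)
  interpret P: pair_sigma_finite "torus X" "torus X" ..
  have vi: "integrable (torus X) v" and v2: "integrable (torus X) (\<lambda>y. (v y)\<^sup>2)"
    and vm: "v \<in> borel_measurable (torus X)"
    using v sq_integrable_imp_integrable[OF finite_measure_torus v] by (auto simp: sq_integrable_def)
  have cont: "continuous_on UNIV (conv X k v)"
    by (rule conv_continuous[OF k(1) vi])
  then have "continuous_on UNIV (\<lambda>x. (conv X k v x)\<^sup>2)"
    by (intro continuous_intros)
  then have i2: "integrable (torus X) (\<lambda>x. (conv X k v x)\<^sup>2)"
    by (rule torus_integral_continuous)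
  then show "sq_integrable (torus X) (conv X k v)"
    using measurable_torus_continuous[OF cont] by (simp add: sq_integrable_def)
  have k1: "(\<integral>y. k (x - y) \<partial>torus X) = 1" for x
    using torus_integral_reflect_shift[OF X k(1,2)] k(4) by simp
  have k2: "(\<integral>x. k (x - y) \<partial>torus X) = 1" for y
    using torus_integral_shift[OF X k(1,2), of "-y"] k(4) by simp
  have jensen: "(conv X k v x)\<^sup>2 \<le> conv X k (\<lambda>y. (v y)\<^sup>2) x" for x
  proof -
    define m where "m = conv X k v x"
    have i: "integrable (torus X) (\<lambda>y. k (x - y))" "integrable (torus X) (\<lambda>y. k (x - y) * v y)"
      "integrable (torus X) (\<lambda>y. k (x - y) * (v y)\<^sup>2)"
      using torus_integral_continuous(1)[OF continuous_reflect_shift(1)[OF k(1)]]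
        conv_integrable[OF k(1) vi] conv_integrable[OF k(1) v2] by auto
    have "0 \<le> (\<integral>y. k (x - y) * (v y - m)\<^sup>2 \<partial>torus X)"
      using k(3) by (intro integral_nonneg_AE) simp
    also have "(\<lambda>y. k (x - y) * (v y - m)\<^sup>2) =
      (\<lambda>y. k (x - y) * (v y)\<^sup>2 - (2 * m) * (k (x - y) * v y) + m\<^sup>2 * k (x - y))"
      by (simp add: power2_diff algebra_simps)
    also have "(\<integral>y. k (x - y) * (v y)\<^sup>2 - (2 * m) * (k (x - y) * v y) + m\<^sup>2 * k (x - y) \<partial>torus X) =
      conv X k (\<lambda>y. (v y)\<^sup>2) x - 2 * m * m + m\<^sup>2"
      using i by (simp add: k1 conv_def m_def)
    finally show ?thesis
      by (simp add: m_def power2_eq_square)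
  qed
  have [measurable]: "(\<lambda>x. x) \<in> borel_measurable (torus X)"
    using id_borel_measurable_lebesgue_on[of "cbox (-X) X"] by (simp add: id_def)
  have [measurable]: "k \<in> borel_measurable borel"
    using k(1) by (rule borel_measurable_continuous_onI)
  note vm[measurable]
  have "integrable (torus X \<Otimes>\<^sub>M torus X) (\<lambda>(y, x). k (x - y) * (v y)\<^sup>2)"
  proof (rule P.Fubini_integrable)
    show "(\<lambda>(y, x). k (x - y) * (v y)\<^sup>2) \<in> borel_measurable (torus X \<Otimes>\<^sub>M torus X)"
      by measurable
    have "(\<integral>x. norm (k (x - y) * (v y)\<^sup>2) \<partial>torus X) = (v y)\<^sup>2" for y
      using k2[of y] k(3) by (simp add: abs_mult)
    then show "integrable (torus X) (\<lambda>y. \<integral>x. norm (case (y, x) of (y, x) \<Rightarrow> k (x - y) * (v y)\<^sup>2) \<partial>torus X)"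
      using v2 by simp
    show "AE y in torus X. integrable (torus X) (\<lambda>x. case (y, x) of (y, x) \<Rightarrow> k (x - y) * (v y)\<^sup>2)"
      using torus_integral_continuous(1)[OF continuous_reflect_shift(2)[OF k(1)]] by auto
  qed
  from P.Fubini_integral[OF this]
  have "(\<integral>x. conv X k (\<lambda>y. (v y)\<^sup>2) x \<partial>torus X) = (\<integral>y. (v y)\<^sup>2 \<partial>torus X)"
    by (simp add: conv_def k2)
  moreover have "(\<integral>x. (conv X k v x)\<^sup>2 \<partial>torus X) \<le> (\<integral>x. conv X k (\<lambda>y. (v y)\<^sup>2) x \<partial>torus X)"
    using jensen i2 torus_integral_continuous(1)[OF conv_continuous[OF k(1) v2]]
    by (intro integral_mono) auto
  ultimately show "(\<integral>x. (conv X k v x)\<^sup>2 \<partial>torus X) \<le> (\<integral>x. (v x)\<^sup>2 \<partial>torus X)"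
    by simp
qed

section \<open>A smooth approximate identity\<close>

text \<open>A trigonometric polynomial with values in \<open>[0, 1]\<close> that attains 1 only at the points of the
  period lattice.\<close>

definition peak :: "'a::euclidean_space \<Rightarrow> 'a \<Rightarrow> real" where
  "peak X z = (\<Prod>b\<in>Basis. (1 + cos (z \<bullet> ((pi / (X \<bullet> b)) *\<^sub>R b))) / 2)"

text \<open>The mollifiers are the powers of \<open>peak\<close>, normalised to have unit mass over the box.\<close>

definition peak_kernel :: "'a::euclidean_space \<Rightarrow> nat \<Rightarrow> 'a \<Rightarrow> real" where
  "peak_kernel X n z = peak X z ^ n / (\<integral>y. peak X y ^ n \<partial>torus X)"

lemma peak_factor:
  fixes t :: real
  shows "0 \<le> (1 + cos t) / 2 \<and> (1 + cos t) / 2 \<le> 1"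
proof -
  have "0 \<le> 1 + cos t"
    using cos_ge_minus_one[of t] by linarith
  then show ?thesis by simp
qed

lemma peak_nonneg: "0 \<le> peak X z"
  unfolding peak_def using peak_factor by (intro prod_nonneg) blast

lemma peak_0: "peak X 0 = 1"
  by (simp add: peak_def)

lemma smooth_peak: "smooth (peak X)"
  unfolding peak_def
proof (rule smooth_prod)
  fix b
  have "smooth (\<lambda>z. (1 / 2) * (1 + cos (0 + z \<bullet> ((pi / (X \<bullet> b)) *\<^sub>R b))))"
    by (intro smooth_mult smooth_add smooth_const smooth_cos_affine)
  then show "smooth (\<lambda>z. (1 + cos (z \<bullet> ((pi / (X \<bullet> b)) *\<^sub>R b))) / 2)"
    by simp
qed

lemma periodic_peak:
  fixes X :: "'a::euclidean_space"
  assumes X: "\<And>b. b \<in> Basis \<Longrightarrow> 0 < X \<bullet> b"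
  shows "periodic X (peak X)"
  unfolding periodic_def peak_def
proof (intro ballI allI prod.cong refl)
  fix b x i :: 'a assume b: "b \<in> Basis" "i \<in> Basis"
  show "(1 + cos ((x + (2 * (X \<bullet> b)) *\<^sub>R b) \<bullet> (pi / (X \<bullet> i)) *\<^sub>R i)) / 2 =
        (1 + cos (x \<bullet> (pi / (X \<bullet> i)) *\<^sub>R i)) / 2"
  proof (cases "i = b")
    case True
    have "(x + (2 * (X \<bullet> b)) *\<^sub>R b) \<bullet> (pi / (X \<bullet> b)) *\<^sub>R b = x \<bullet> (pi / (X \<bullet> b)) *\<^sub>R b + 2 * pi"
      using X[OF b(1)] b by (simp add: inner_add_left distrib_left)
    then show ?thesis
      using True by simp
  qed (use b in \<open>simp add: inner_add_left inner_Basis\<close>)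
qed

lemma peak_less_1:
  fixes X :: "'a::euclidean_space"
  assumes X: "\<And>b. b \<in> Basis \<Longrightarrow> 0 < X \<bullet> b"
    and x: "x \<in> box (-X) X" and y: "y \<in> cbox (-X) X" and "x \<noteq> y"
  shows "peak X (x - y) < 1"
proof -
  obtain b where b: "b \<in> Basis" "x \<bullet> b \<noteq> y \<bullet> b"
    using \<open>x \<noteq> y\<close> by (meson euclidean_eqI)
  define t where "t = (x - y) \<bullet> b"
  have t: "t \<noteq> 0" "\<bar>t\<bar> < 2 * (X \<bullet> b)"
    using b x y by (auto simp: t_def inner_diff_left mem_box) (smt (verit))
  have "cos (t * (pi / (X \<bullet> b))) \<noteq> 1"
  proof
    assume "cos (t * (pi / (X \<bullet> b))) = 1"
    then obtain j :: int where "t * (pi / (X \<bullet> b)) = real_of_int j * 2 * pi"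
      using cos_one_2pi_int by blast
    then have j: "t = j * (2 * (X \<bullet> b))"
      using X[OF b(1)] by (simp add: field_simps)
    then have "\<bar>real_of_int j\<bar> * (2 * (X \<bullet> b)) < 1 * (2 * (X \<bullet> b))"
      using t(2) X[OF b(1)] by (simp add: abs_mult)
    then have "\<bar>real_of_int j\<bar> < 1"
      using X[OF b(1)] by simp
    then have "j = 0"
      by linarith
    then show False
      using j t(1) by simp
  qed
  then have lt: "(1 + cos ((x - y) \<bullet> (pi / (X \<bullet> b)) *\<^sub>R b)) / 2 < 1"
    using cos_le_one[of "t * (pi / (X \<bullet> b))"]
    by (simp add: t_def mult.commute less_le del: cos_le_one)
  have "peak X (x - y) = (1 + cos ((x - y) \<bullet> (pi / (X \<bullet> b)) *\<^sub>R b)) / 2 *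
      (\<Prod>i\<in>Basis - {b}. (1 + cos ((x - y) \<bullet> (pi / (X \<bullet> i)) *\<^sub>R i)) / 2)"
    unfolding peak_def using b by (intro prod.remove) auto
  also have "\<dots> \<le> (1 + cos ((x - y) \<bullet> (pi / (X \<bullet> b)) *\<^sub>R b)) / 2 * 1"
    using peak_factor by (intro mult_left_mono prod_le_1) blast+
  finally show ?thesis
    using lt by simp
qed

lemma continuous_peak_power: "continuous_on UNIV (\<lambda>z. peak X z ^ n)"
  by (intro continuous_intros smooth_continuous smooth_peak)

text \<open>The normalising integrals decay more slowly than any geometric sequence of ratio below 1.\<close>

lemma peak_mass_lower_bound:
  fixes X :: "'a::euclidean_space"
  assumes X: "\<And>b. b \<in> Basis \<Longrightarrow> 0 < X \<bullet> b" and q: "0 \<le> q" "q < 1"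
  obtains m where "0 < m" "\<And>n. m * q ^ n \<le> (\<integral>z. peak X z ^ n \<partial>torus X)"
proof -
  have "open ({z. q < peak X z} \<inter> box (-X) X)"
    using smooth_continuous[OF smooth_peak[of X]]
    by (intro open_Int open_Collect_less) (auto intro!: continuous_intros)
  moreover have "0 \<in> {z. q < peak X z} \<inter> box (-X) X"
    using q X by (auto simp: peak_0 mem_box)
  ultimately obtain r where r: "0 < r" "ball 0 r \<subseteq> {z. q < peak X z} \<inter> box (-X) X"
    unfolding open_contains_ball by blast
  have sub: "ball 0 r \<subseteq> cbox (-X) X"
    using r(2) box_subset_cbox by blast
  have m: "measure (torus X) (ball 0 r) = measure lebesgue (ball (0::'a) r)"
    using sub by (intro measure_restrict_space) auto
  have S: "ball 0 r \<in> sets (torus X)"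
    using sub by (simp add: sets_restrict_space_iff)
  interpret finite_measure "torus X" by (rule finite_measure_torus)
  show ?thesis
  proof (rule that)
    show "0 < measure (torus X) (ball 0 r)"
      using m content_ball_pos[OF r(1), of "0::'a"] by simp
    show "measure (torus X) (ball 0 r) * q ^ n \<le> (\<integral>z. peak X z ^ n \<partial>torus X)" for n
    proof -
      have "(\<integral>z. q ^ n * indicator (ball 0 r) z \<partial>torus X) \<le> (\<integral>z. peak X z ^ n \<partial>torus X)"
      proof (rule integral_mono)
        show "integrable (torus X) (\<lambda>z. q ^ n * indicator (ball 0 r) z)"
          using S by (intro integrable_mult_right) (simp add: less_top[symmetric])
        show "q ^ n * indicator (ball 0 r) z \<le> peak X z ^ n" for z
        proof (cases "z \<in> ball 0 r")
          case True
          then have "q \<le> peak X z"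
            using r(2) by auto
          then show ?thesis
            using True q by (simp add: power_mono)
        qed (simp add: peak_nonneg)
      qed (intro torus_integral_continuous continuous_peak_power)
      then show ?thesis
        using S sub by (simp add: mult.commute inf.absorb1)
    qed
  qed
qed

lemma peak_mass_pos:
  fixes X :: "'a::euclidean_space"
  assumes X: "\<And>b. b \<in> Basis \<Longrightarrow> 0 < X \<bullet> b"
  shows "0 < (\<integral>z. peak X z ^ n \<partial>torus X)"
proof -
  have "0 \<le> (1 / 2 :: real)" "(1 / 2 :: real) < 1"
    by simp_all
  from peak_mass_lower_bound[OF X this] obtain m
    where m: "0 < m" "\<And>n. m * (1 / 2) ^ n \<le> (\<integral>z. peak X z ^ n \<partial>torus X)"
    by blast
  have "0 < m * (1 / 2) ^ n"
    using m(1) by simp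
  with m(2)[of n] show ?thesis by linarith
qed

lemma
  fixes X :: "'a::euclidean_space"
  assumes X: "\<And>b. b \<in> Basis \<Longrightarrow> 0 < X \<bullet> b"
  shows smooth_peak_kernel: "smooth (peak_kernel X n)"
    and periodic_peak_kernel: "periodic X (peak_kernel X n)"
    and peak_kernel_nonneg: "0 \<le> peak_kernel X n z"
    and peak_kernel_mass: "(\<integral>z. peak_kernel X n z \<partial>torus X) = 1"
proof -
  have eq: "peak_kernel X n = (\<lambda>z. (1 / (\<integral>y. peak X y ^ n \<partial>torus X)) * peak X z ^ n)"
    by (simp add: peak_kernel_def fun_eq_iff)
  show "smooth (peak_kernel X n)"
    unfolding eq by (intro smooth_mult smooth_const smooth_power smooth_peak)
  show "periodic X (peak_kernel X n)"
    using periodic_peak[OF X] by (simp add: periodic_def eq)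
  show "0 \<le> peak_kernel X n z"
    using peak_mass_pos[OF X, of n] peak_nonneg[of X z] by (simp add: eq)
  show "(\<integral>z. peak_kernel X n z \<partial>torus X) = 1"
    using peak_mass_pos[OF X, of n] by (simp add: eq)
qed

text \<open>Here \<open>c\<close> need not be periodic: its values on the box are extended periodically with jumps at
  the faces, so convergence is claimed only in the interior.\<close>

lemma conv_peak_kernel_pointwise:
  fixes X :: "'a::euclidean_space"
  assumes X: "\<And>b. b \<in> Basis \<Longrightarrow> 0 < X \<bullet> b"
    and c: "continuous_on UNIV c" "\<And>x. \<bar>c x\<bar> \<le> B" and x: "x \<in> box (-X) X"
  shows "(\<lambda>n. conv X (peak_kernel X n) c x) \<longlonglongrightarrow> c x"
proof (rule LIMSEQ_I)
  fix e :: real assume "0 < e"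
  interpret finite_measure "torus X" by (rule finite_measure_torus)
  note K = smooth_continuous[OF smooth_peak_kernel[OF X]] periodic_peak_kernel[OF X]
  have K1: "(\<integral>y. peak_kernel X n (x - y) \<partial>torus X) = 1" for n
    using torus_integral_reflect_shift[OF X K, of n x] peak_kernel_mass[OF X] by simp
  have B: "0 \<le> B"
    using c(2)[of x] by linarith
  obtain \<delta> where \<delta>: "0 < \<delta>" "\<And>y. dist y x < \<delta> \<Longrightarrow> dist (c y) (c x) < e / 2"
    using c(1) \<open>0 < e\<close> unfolding continuous_on_iff by (metis UNIV_I half_gt_zero)
  define S where "S = cbox (-X) X - ball x \<delta>"
  have "compact S"
    unfolding S_def by (intro compact_diff) auto
  obtain q where q: "0 \<le> q" "q < 1" "\<And>y. y \<in> S \<Longrightarrow> peak X (x - y) \<le> q"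
  proof (cases "S = {}")
    case False
    have "continuous_on S (\<lambda>y. peak X (x - y))"
      using continuous_reflect_shift(1)[OF smooth_continuous[OF smooth_peak[of X]]]
        continuous_on_subset by blast
    from continuous_attains_sup[OF \<open>compact S\<close> False this]
    obtain y where y: "y \<in> S" "\<And>z. z \<in> S \<Longrightarrow> peak X (x - z) \<le> peak X (x - y)"
      by blast
    have "peak X (x - y) < 1"
      using y(1) \<delta>(1) by (intro peak_less_1[OF X x]) (auto simp: S_def)
    with y show ?thesis
      using that[of "peak X (x - y)"] peak_nonneg by blast
  qed (use that[of 0] in simp)
  \<comment> \<open>away from \<open>x\<close> the kernel is at most \<open>q\<^sup>n\<close>, up to normalisation; the mass bound with any
    ratio \<open>q'\<close> strictly between \<open>q\<close> and 1 makes this negligible\<close>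
  define q' where "q' = (1 + q) / 2"
  have q': "0 < q'" "q < q'" "q' < 1"
    using q by (auto simp: q'_def)
  from peak_mass_lower_bound[OF X less_imp_le[OF q'(1)] q'(3)] obtain m
    where m: "0 < m" "\<And>n. m * q' ^ n \<le> (\<integral>z. peak X z ^ n \<partial>torus X)"
    by blast
  define V where "V = measure (torus X) (cbox (-X) X)"
  define R where "R n = 2 * B * ((q / q') ^ n / m)" for n
  have bound: "\<bar>conv X (peak_kernel X n) c x - c x\<bar> \<le> e / 2 + R n * V" for n
  proof -
    have i: "integrable (torus X) (\<lambda>y. peak_kernel X n (x - y))"
      "integrable (torus X) (\<lambda>y. peak_kernel X n (x - y) * c y)"
      using torus_integral_continuous(1)[OF continuous_reflect_shift(1)[OF K(1)]]
        conv_integrable[OF K(1) torus_integral_continuous(1)[OF c(1)]] by auto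
    have "conv X (peak_kernel X n) c x - c x =
        (\<integral>y. peak_kernel X n (x - y) * c y - c x * peak_kernel X n (x - y) \<partial>torus X)"
      using i by (simp add: conv_def K1)
    then have "\<bar>conv X (peak_kernel X n) c x - c x\<bar> \<le>
        (\<integral>y. \<bar>peak_kernel X n (x - y) * c y - c x * peak_kernel X n (x - y)\<bar> \<partial>torus X)"
      by simp
    also have "\<dots> \<le> (\<integral>y. e / 2 * peak_kernel X n (x - y) + R n \<partial>torus X)"
    proof (rule integral_mono)
      fix y assume "y \<in> space (torus X)"
      then have y: "y \<in> cbox (-X) X" by simp
      have K0: "0 \<le> peak_kernel X n (x - y)"
        by (rule peak_kernel_nonneg[OF X])
      have R0: "0 \<le> R n"
        using B q q' m by (simp add: R_def)
      have "\<bar>peak_kernel X n (x - y) * c y - c x * peak_kernel X n (x - y)\<bar> =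
          peak_kernel X n (x - y) * \<bar>c y - c x\<bar>"
        using K0 by (metis abs_mult abs_of_nonneg mult.commute right_diff_distrib)
      also have "\<dots> \<le> e / 2 * peak_kernel X n (x - y) + R n"
      proof (cases "dist y x < \<delta>")
        case True
        have "peak_kernel X n (x - y) * \<bar>c y - c x\<bar> \<le> peak_kernel X n (x - y) * (e / 2)"
          using \<delta>(2)[OF True] K0 by (intro mult_left_mono) (auto simp: dist_real_def)
        then show ?thesis using R0 by (simp add: mult.commute)
      next
        case False
        then have "y \<in> S" using y by (simp add: S_def dist_commute)
        have "peak_kernel X n (x - y) \<le> q ^ n / (m * q' ^ n)"
          unfolding peak_kernel_def using q(1) q(3)[OF \<open>y \<in> S\<close>] m q' peak_nonneg[of X]
          by (intro frac_le power_mono) auto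
        moreover have "\<bar>c y - c x\<bar> \<le> 2 * B"
          using c(2)[of x] c(2)[of y] by linarith
        ultimately have "peak_kernel X n (x - y) * \<bar>c y - c x\<bar> \<le> q ^ n / (m * q' ^ n) * (2 * B)"
          using K0 by (intro mult_mono) auto
        also have "\<dots> = R n"
          by (simp add: R_def power_divide mult_ac)
        finally show ?thesis
          using K0 \<open>0 < e\<close> by (simp add: add_increasing)
      qed
      finally show "\<bar>peak_kernel X n (x - y) * c y - c x * peak_kernel X n (x - y)\<bar>
          \<le> e / 2 * peak_kernel X n (x - y) + R n" .
    qed (use i in auto)
    also have "\<dots> = e / 2 + R n * V"
      using i by (simp add: K1 V_def mult.commute)
    finally show ?thesis .
  qed
  have "(\<lambda>n. R n * V) \<longlonglongrightarrow> (2 * B * (0 / m)) * V"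
    unfolding R_def using q q' m(1) by (intro tendsto_intros LIMSEQ_power_zero) auto
  then have "\<forall>\<^sub>F n in sequentially. R n * V < e / 2"
    using \<open>0 < e\<close> by (intro order_tendstoD) auto
  then obtain N where N: "\<And>n. N \<le> n \<Longrightarrow> R n * V < e / 2"
    by (auto simp: eventually_sequentially)
  have "norm (conv X (peak_kernel X n) c x - c x) < e" if "N \<le> n" for n
    using bound[of n] N[OF that] by simp
  then show "\<exists>N. \<forall>n\<ge>N. norm (conv X (peak_kernel X n) c x - c x) < e"
    by blast
qed

lemma AE_torus_interior: "AE x in torus X. x \<in> box (-X) X"
proof (rule AE_I')
  have "cbox (-X) X - box (-X) X \<in> null_sets lebesgue"
    using negligible_frontier_interval negligible_iff_null_sets by blast
  then show "cbox (-X) X - box (-X) X \<in> null_sets (torus X)"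
    by (simp add: null_sets_restrict_space)
qed auto

lemma conv_peak_kernel_bounded:
  fixes X :: "'a::euclidean_space"
  assumes X: "\<And>b. b \<in> Basis \<Longrightarrow> 0 < X \<bullet> b"
    and c: "continuous_on UNIV c" "\<And>x. \<bar>c x\<bar> \<le> B"
  shows "\<bar>conv X (peak_kernel X n) c x\<bar> \<le> B"
proof -
  note K = smooth_continuous[OF smooth_peak_kernel[OF X]] periodic_peak_kernel[OF X]
  have i: "integrable (torus X) (\<lambda>y. peak_kernel X n (x - y))"
    "integrable (torus X) (\<lambda>y. peak_kernel X n (x - y) * c y)"
    using torus_integral_continuous(1)[OF continuous_reflect_shift(1)[OF K(1)]]
      conv_integrable[OF K(1) torus_integral_continuous(1)[OF c(1)]] by auto
  have "\<bar>conv X (peak_kernel X n) c x\<bar> \<le> (\<integral>y. \<bar>peak_kernel X n (x - y) * c y\<bar> \<partial>torus X)"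
    by (simp add: conv_def)
  also have "\<dots> \<le> (\<integral>y. B * peak_kernel X n (x - y) \<partial>torus X)"
    using i(1) integrable_abs[OF i(2)] c(2) peak_kernel_nonneg[OF X]
    by (intro integral_mono) (auto simp: abs_mult mult.commute[of B] intro!: mult_left_mono)
  also have "\<dots> = B"
    using torus_integral_reflect_shift[OF X K, of n x] peak_kernel_mass[OF X] by simp
  finally show ?thesis .
qed

lemma conv_peak_kernel_L2_continuous:
  fixes X :: "'a::euclidean_space"
  assumes X: "\<And>b. b \<in> Basis \<Longrightarrow> 0 < X \<bullet> b"
    and c: "continuous_on UNIV c" "\<And>x. \<bar>c x\<bar> \<le> B"
  shows "(\<lambda>n. \<integral>x. (conv X (peak_kernel X n) c x - c x)\<^sup>2 \<partial>torus X) \<longlonglongrightarrow> 0"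
proof -
  interpret finite_measure "torus X" by (rule finite_measure_torus)
  note K = smooth_continuous[OF smooth_peak_kernel[OF X]]
  have meas: "conv X (peak_kernel X n) c \<in> borel_measurable (torus X)" for n
    by (intro measurable_torus_continuous conv_continuous K torus_integral_continuous c)
  note meas = this measurable_torus_continuous[OF c(1), of X]
  have "(\<lambda>n. \<integral>x. (conv X (peak_kernel X n) c x - c x)\<^sup>2 \<partial>torus X) \<longlonglongrightarrow> (\<integral>x. 0 \<partial>torus X)"
  proof (rule integral_dominated_convergence[where w = "\<lambda>x. (2 * B)\<^sup>2"])
    show "AE x in torus X. (\<lambda>n. (conv X (peak_kernel X n) c x - c x)\<^sup>2) \<longlonglongrightarrow> 0"
      using AE_torus_interior
    proof eventually_elim
      case (elim x)
      have "(\<lambda>n. (conv X (peak_kernel X n) c x - c x)\<^sup>2) \<longlonglongrightarrow> (c x - c x)\<^sup>2"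
        by (intro tendsto_intros conv_peak_kernel_pointwise[OF X c elim])
      then show ?case by simp
    qed
    show "AE x in torus X. norm ((conv X (peak_kernel X n) c x - c x)\<^sup>2) \<le> (2 * B)\<^sup>2" for n
    proof (rule AE_I2)
      fix x
      have "\<bar>conv X (peak_kernel X n) c x - c x\<bar> \<le> \<bar>2 * B\<bar>"
        using conv_peak_kernel_bounded[OF X c, of n x] c(2)[of x] by linarith
      then show "norm ((conv X (peak_kernel X n) c x - c x)\<^sup>2) \<le> (2 * B)\<^sup>2"
        by (simp add: abs_le_square_iff)
    qed
  qed (use meas in auto)
  then show ?thesis by simp
qed

text \<open>Truncate \<open>v\<close>, then truncate continuous functions converging to \<open>v\<close> almost everywhere.\<close>

lemma continuous_dense_L2:
  fixes X :: "'a::euclidean_space"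
  assumes v: "sq_integrable (torus X) v" and e: "0 < e"
  obtains c B where "continuous_on UNIV c" "\<And>x. \<bar>c x\<bar> \<le> B"
    "(\<integral>x. (v x - c x)\<^sup>2 \<partial>torus X) < e"
proof -
  interpret finite_measure "torus X" by (rule finite_measure_torus)
  define T where "T m s = max (- real m) (min (real m) s)" for m s
  have T_le: "\<bar>T m s\<bar> \<le> real m" "\<bar>T m s\<bar> \<le> \<bar>s\<bar>" "\<bar>s - T m s\<bar> \<le> \<bar>s\<bar>" for m s
    by (auto simp: T_def)
  have T_cont: "continuous_on UNIV (T m)" for m
    unfolding T_def by (intro continuous_intros)
  then have [measurable]: "T m \<in> borel_measurable borel" for m
    by (rule borel_measurable_continuous_onI)
  have [measurable]: "v \<in> borel_measurable (torus X)" and v2: "integrable (torus X) (\<lambda>x. (v x)\<^sup>2)"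
    using v by (auto simp: sq_integrable_def)
  have "(\<lambda>m. \<integral>x. (v x - T m (v x))\<^sup>2 \<partial>torus X) \<longlonglongrightarrow> (\<integral>x. 0 \<partial>torus X)"
  proof (rule integral_dominated_convergence[where w = "\<lambda>x. (v x)\<^sup>2"])
    show "AE x in torus X. (\<lambda>m. (v x - T m (v x))\<^sup>2) \<longlonglongrightarrow> 0"
    proof (intro AE_I2 tendsto_eventually)
      fix x
      obtain N where N: "\<bar>v x\<bar> \<le> real N"
        using real_arch_simple by blast
      show "\<forall>\<^sub>F m in sequentially. (v x - T m (v x))\<^sup>2 = 0"
        using eventually_ge_at_top[of N]
        by eventually_elim (use N in \<open>auto simp: T_def\<close>)
    qed
    show "AE x in torus X. norm ((v x - T m (v x))\<^sup>2) \<le> (v x)\<^sup>2" for m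
      using T_le(3) by (auto simp: abs_le_square_iff[symmetric])
  qed (use v2 in measurable)
  then have "\<forall>\<^sub>F m in sequentially. (\<integral>x. (v x - T m (v x))\<^sup>2 \<partial>torus X) < e / 4"
    using e by (intro order_tendstoD) auto
  then obtain m where m: "(\<integral>x. (v x - T m (v x))\<^sup>2 \<partial>torus X) < e / 4"
    by (auto simp: eventually_sequentially)
  have "v measurable_on cbox (-X) X"
    using measurable_on_iff_borel_measurable[of "cbox (-X) X" v] by simp
  then obtain N g where N: "negligible N" and g: "\<And>n. continuous_on UNIV (g n)"
    "\<And>x. x \<notin> N \<Longrightarrow> (\<lambda>n. g n x) \<longlonglongrightarrow> (if x \<in> cbox (-X) X then v x else 0)"
    unfolding measurable_on_def by blast
  have Tg: "continuous_on UNIV (\<lambda>x. T m (g n x))" for n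
    by (auto intro!: continuous_on_compose2[OF T_cont] g(1))
  note [measurable] = measurable_torus_continuous[OF Tg]
  have "(\<lambda>n. \<integral>x. (T m (v x) - T m (g n x))\<^sup>2 \<partial>torus X) \<longlonglongrightarrow> (\<integral>x. 0 \<partial>torus X)"
  proof (rule integral_dominated_convergence[where w = "\<lambda>x. (2 * real m)\<^sup>2"])
    have "N \<inter> cbox (-X) X \<in> null_sets lebesgue"
      using N negligible_Int negligible_iff_null_sets by blast
    then have "N \<inter> cbox (-X) X \<in> null_sets (torus X)"
      by (simp add: null_sets_restrict_space)
    then have "AE x in torus X. x \<notin> N"
      by (rule AE_I') auto
    then show "AE x in torus X. (\<lambda>n. (T m (v x) - T m (g n x))\<^sup>2) \<longlonglongrightarrow> 0"
      using AE_torus_interior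
    proof eventually_elim
      case (elim x)
      then have "(\<lambda>n. g n x) \<longlonglongrightarrow> v x"
        using g(2)[of x] box_subset_cbox[of "-X" X] by auto
      then have "(\<lambda>n. T m (g n x)) \<longlonglongrightarrow> T m (v x)"
        unfolding T_def by (intro tendsto_intros)
      then have "(\<lambda>n. (T m (v x) - T m (g n x))\<^sup>2) \<longlonglongrightarrow> (T m (v x) - T m (v x))\<^sup>2"
        by (intro tendsto_intros)
      then show ?case by simp
    qed
    show "AE x in torus X. norm ((T m (v x) - T m (g n x))\<^sup>2) \<le> (2 * real m)\<^sup>2" for n
    proof (rule AE_I2)
      fix x
      have "\<bar>T m (v x) - T m (g n x)\<bar> \<le> \<bar>2 * real m\<bar>"
        using T_le(1)[of m "v x"] T_le(1)[of m "g n x"] by linarith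
      then show "norm ((T m (v x) - T m (g n x))\<^sup>2) \<le> (2 * real m)\<^sup>2"
        unfolding abs_le_square_iff by simp
    qed
  qed measurable
  then have "\<forall>\<^sub>F n in sequentially. (\<integral>x. (T m (v x) - T m (g n x))\<^sup>2 \<partial>torus X) < e / 4"
    using e by (intro order_tendstoD) auto
  then obtain n where n: "(\<integral>x. (T m (v x) - T m (g n x))\<^sup>2 \<partial>torus X) < e / 4"
    by (auto simp: eventually_sequentially)
  have sq: "sq_integrable (torus X) (\<lambda>x. v x - T m (v x))"
    "sq_integrable (torus X) (\<lambda>x. T m (v x) - T m (g n x))"
  proof -
    show "sq_integrable (torus X) (\<lambda>x. v x - T m (v x))"
      by (rule sq_integrable_dominated[OF v]) (use T_le(3) in auto)
    have "sq_integrable (torus X) (\<lambda>x. T m (v x))"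
      by (rule sq_integrable_dominated[OF v]) (use T_le(2) in auto)
    moreover have "sq_integrable (torus X) (\<lambda>x. T m (g n x))"
      by (rule sq_integrable_bounded[OF finite_measure_torus, where B = "real m"]) (use T_le(1) in auto)
    ultimately show "sq_integrable (torus X) (\<lambda>x. T m (v x) - T m (g n x))"
      by (rule sq_integrable_diff)
  qed
  have "(\<integral>x. (v x - T m (g n x))\<^sup>2 \<partial>torus X) < e"
    using integral_sq_add_le[OF sq] m n by simp
  then show ?thesis
    using that[OF Tg[of n], of "real m"] T_le(1) by blast
qed

text \<open>The mollifiers converge strongly to the identity on \<open>L\<^sup>2\<close>.\<close>

proposition conv_peak_kernel_L2:
  fixes X :: "'a::euclidean_space"
  assumes X: "\<And>b. b \<in> Basis \<Longrightarrow> 0 < X \<bullet> b" and v: "sq_integrable (torus X) v"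
  shows "(\<lambda>n. \<integral>x. (conv X (peak_kernel X n) v x - v x)\<^sup>2 \<partial>torus X) \<longlonglongrightarrow> 0"
proof (rule LIMSEQ_I)
  fix e :: real assume "0 < e"
  note K = smooth_continuous[OF smooth_peak_kernel[OF X]] periodic_peak_kernel[OF X]
    peak_kernel_nonneg[OF X] peak_kernel_mass[OF X]
  obtain c B where c: "continuous_on UNIV c" "\<And>x. \<bar>c x\<bar> \<le> B"
    and vc: "(\<integral>x. (v x - c x)\<^sup>2 \<partial>torus X) < e / 12"
    using continuous_dense_L2[OF v, of "e / 12"] \<open>0 < e\<close> by auto
  have "\<forall>\<^sub>F n in sequentially. (\<integral>x. (conv X (peak_kernel X n) c x - c x)\<^sup>2 \<partial>torus X) < e / 12"
    using conv_peak_kernel_L2_continuous[OF X c] \<open>0 < e\<close> by (intro order_tendstoD) auto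
  then obtain N where N:
    "\<And>n. N \<le> n \<Longrightarrow> (\<integral>x. (conv X (peak_kernel X n) c x - c x)\<^sup>2 \<partial>torus X) < e / 12"
    by (auto simp: eventually_sequentially)
  have sc: "sq_integrable (torus X) c"
    using sq_integrable_bounded[OF finite_measure_torus measurable_torus_continuous[OF c(1)]] c(2)
    by blast
  have svc: "sq_integrable (torus X) (\<lambda>x. v x - c x)" and scv: "sq_integrable (torus X) (\<lambda>x. c x - v x)"
    using sq_integrable_diff v sc by blast+
  have "(\<integral>x. (conv X (peak_kernel X n) v x - v x)\<^sup>2 \<partial>torus X) < e" if "N \<le> n" for n
  proof -
    let ?C = "conv X (peak_kernel X n)"
    have s1: "sq_integrable (torus X) (?C (\<lambda>x. v x - c x))"
      and b1: "(\<integral>x. (?C (\<lambda>x. v x - c x) x)\<^sup>2 \<partial>torus X) \<le> (\<integral>x. (v x - c x)\<^sup>2 \<partial>torus X)"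
      using conv_contraction[OF X K svc] by auto
    have s2: "sq_integrable (torus X) (\<lambda>x. ?C c x - c x)"
      using conv_contraction(1)[OF X K sc] sc by (rule sq_integrable_diff)
    have s3: "sq_integrable (torus X) (\<lambda>x. (?C c x - c x) + (c x - v x))"
      using s2 scv by (rule sq_integrable_add)
    have eq: "?C v x - v x = ?C (\<lambda>x. v x - c x) x + ((?C c x - c x) + (c x - v x))" for x
      using conv_diff[OF K(1) sq_integrable_imp_integrable[OF finite_measure_torus v]
          sq_integrable_imp_integrable[OF finite_measure_torus sc]] by simp
    have "(\<integral>x. (?C v x - v x)\<^sup>2 \<partial>torus X) \<le>
        2 * (\<integral>x. (?C (\<lambda>x. v x - c x) x)\<^sup>2 \<partial>torus X) +
        2 * (2 * (\<integral>x. (?C c x - c x)\<^sup>2 \<partial>torus X) + 2 * (\<integral>x. (c x - v x)\<^sup>2 \<partial>torus X))"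
      unfolding eq using integral_sq_add_le[OF s1 s3] integral_sq_add_le[OF s2 scv]
      by (auto intro: order_trans)
    also have "\<dots> < e"
      using b1 vc N[OF that] \<open>0 < e\<close> by (simp add: power2_commute[of "c _"])
    finally show ?thesis .
  qed
  then show "\<exists>N. \<forall>n\<ge>N. norm ((\<integral>x. (conv X (peak_kernel X n) v x - v x)\<^sup>2 \<partial>torus X) - 0) < e"
    by (auto intro!: exI[of _ N])
qed

section \<open>Dissipation: the Laplacian tested against a monotone function\<close>

lemma partial_deriv_uminus:
  assumes "\<And>x. g differentiable (at x)"
  shows "partial_deriv b (\<lambda>x. - g x) = (\<lambda>x. - partial_deriv b g x)"
proof -
  have "((\<lambda>x. - g x) has_derivative (\<lambda>h. - frechet_derivative g (at x) h)) (at x)" for x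
    by (intro has_derivative_minus differentiable_frechet assms)
  from partial_deriv_eq[OF this] show ?thesis
    by (simp add: fun_eq_iff partial_deriv_def)
qed

lemma DERIV_along_direction:
  fixes k :: "'a::euclidean_space \<Rightarrow> real"
  assumes "k differentiable (at (z + s *\<^sub>R b))"
  shows "((\<lambda>s. k (z + s *\<^sub>R b)) has_real_derivative partial_deriv b k (z + s *\<^sub>R b)) (at s)"
proof -
  let ?D = "frechet_derivative k (at (z + s *\<^sub>R b))"
  have k: "(k has_derivative ?D) (at (z + s *\<^sub>R b))"
    using assms by (rule differentiable_frechet)
  have "((\<lambda>s. k (z + s *\<^sub>R b)) has_derivative (\<lambda>t. ?D (t *\<^sub>R b))) (at s)"
    by (rule has_derivative_compose[where g = k and f = "\<lambda>s. z + s *\<^sub>R b", OF _ k]) (auto intro!: derivative_eq_intros)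
  moreover have "?D (t *\<^sub>R b) = partial_deriv b k (z + s *\<^sub>R b) * t" for t
    using linear_scale[OF has_derivative_linear[OF k], of t b]
    by (simp add: partial_deriv_def mult.commute)
  ultimately show ?thesis
    by (simp add: has_field_derivative_def)
qed

lemma second_difference:
  fixes k :: "'a::euclidean_space \<Rightarrow> real"
  assumes k: "smooth k" and b: "b \<in> Basis"
  obtains r s where "\<bar>r\<bar> \<le> \<bar>h\<bar>" "\<bar>s\<bar> \<le> \<bar>h\<bar>"
    "k (z + h *\<^sub>R b) - 2 * k z + k (z - h *\<^sub>R b) =
     h\<^sup>2 * ((partial_deriv b (partial_deriv b k) (z + r *\<^sub>R b) +
           partial_deriv b (partial_deriv b k) (z + s *\<^sub>R b)) / 2)"
proof -
  define \<Delta> where "\<Delta> m t = (partial_deriv b ^^ m) k (z + t *\<^sub>R b)" for m t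
  have sm: "smooth ((partial_deriv b ^^ m) k)" for m
    by (induction m) (simp_all add: k smooth_partial_deriv b)
  have D: "\<forall>m t. DERIV (\<Delta> m) t :> \<Delta> (Suc m) t"
    using DERIV_along_direction[OF smooth_differentiable[OF sm]] by (simp add: \<Delta>_def[abs_def])
  have two: "{..<2} = {0, Suc 0}" by auto
  obtain r where r: "\<bar>r\<bar> \<le> \<bar>h\<bar>"
    "\<Delta> 0 h = (\<Sum>m<2. \<Delta> m 0 / fact m * h ^ m) + \<Delta> 2 r / fact 2 * h\<^sup>2"
    using Maclaurin_all_le[OF refl D, of h 2] by blast
  obtain s where s: "\<bar>s\<bar> \<le> \<bar>-h\<bar>"
    "\<Delta> 0 (-h) = (\<Sum>m<2. \<Delta> m 0 / fact m * (-h) ^ m) + \<Delta> 2 s / fact 2 * (-h)\<^sup>2"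
    using Maclaurin_all_le[OF refl D, of "-h" 2] by blast
  have "\<Delta> 0 h - 2 * \<Delta> 0 0 + \<Delta> 0 (-h) = h\<^sup>2 * ((\<Delta> 2 r + \<Delta> 2 s) / 2)"
    unfolding r(2) s(2) two by (simp add: algebra_simps)
  then show ?thesis
    using that[OF r(1)] s(1) by (simp add: \<Delta>_def numeral_2_eq_2)
qed

text \<open>The second difference quotients of a mollification of \<open>u\<close> converge pointwise, and boundedly
  on the box, to the mollification of the weak second derivative \<open>v\<close> of \<open>u\<close>, since translates of the kernel are
  admissible test functions.\<close>

lemma conv_second_difference:
  fixes X :: "'a::euclidean_space"
  assumes k: "smooth k" "periodic X k" and b: "b \<in> Basis"
    and u: "integrable (torus X) u"
    and weak: "\<And>\<eta>. smooth \<eta> \<Longrightarrow> periodic X \<eta> \<Longrightarrow>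
      (\<integral>x. u x * partial_deriv b (partial_deriv b \<eta>) x \<partial>torus X) = (\<integral>x. v x * \<eta> x \<partial>torus X)"
    and h: "h \<longlonglongrightarrow> 0" "\<And>m. 0 < h m" "\<And>m. h m \<le> 1"
  defines "D \<equiv> \<lambda>m x. (conv X k u (x + h m *\<^sub>R b) - 2 * conv X k u x + conv X k u (x - h m *\<^sub>R b)) / (h m)\<^sup>2"
  shows "(\<lambda>m. D m x) \<longlonglongrightarrow> conv X k v x"
    and "\<exists>C. \<forall>m. \<forall>x\<in>cbox (-X) X. \<bar>D m x\<bar> \<le> C"
proof -
  define k2 where "k2 = partial_deriv b (partial_deriv b k)"
  have k2: "continuous_on UNIV k2"
    unfolding k2_def by (intro smooth_continuous smooth_partial_deriv k b)
  define d where "d m z = (k (z + h m *\<^sub>R b) - 2 * k z + k (z - h m *\<^sub>R b)) / (h m)\<^sup>2" for m z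
  have "\<exists>r s. \<bar>r\<bar> \<le> h m \<and> \<bar>s\<bar> \<le> h m \<and> d m z = (k2 (z + r *\<^sub>R b) + k2 (z + s *\<^sub>R b)) / 2" for m z
  proof -
    obtain r s where "\<bar>r\<bar> \<le> \<bar>h m\<bar>" "\<bar>s\<bar> \<le> \<bar>h m\<bar>"
      and "k (z + h m *\<^sub>R b) - 2 * k z + k (z - h m *\<^sub>R b) =
        (h m)\<^sup>2 * ((k2 (z + r *\<^sub>R b) + k2 (z + s *\<^sub>R b)) / 2)"
      unfolding k2_def by (rule second_difference[OF k(1) b])
    then have "\<bar>r\<bar> \<le> h m \<and> \<bar>s\<bar> \<le> h m \<and> d m z = (k2 (z + r *\<^sub>R b) + k2 (z + s *\<^sub>R b)) / 2"
      using h(2)[of m] unfolding d_def by simp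
    then show ?thesis by blast
  qed
  then obtain r s where rs: "\<And>m z. \<bar>r m z\<bar> \<le> h m" "\<And>m z. \<bar>s m z\<bar> \<le> h m"
    "\<And>m z. d m z = (k2 (z + r m z *\<^sub>R b) + k2 (z + s m z *\<^sub>R b)) / 2"
    by metis
  have cont_d: "continuous_on UNIV (d m)" for m
    unfolding d_def using h(2)[of m]
    by (auto intro!: continuous_intros continuous_on_compose2[OF smooth_continuous[OF k(1)]])
  have D_eq: "D m x = (\<integral>y. d m (x - y) * u y \<partial>torus X)" for m x
  proof -
    have i: "integrable (torus X) (\<lambda>y. k (x' - y) * u y)" for x'
      by (rule conv_integrable[OF smooth_continuous[OF k(1)] u])
    have "conv X k u (x + h m *\<^sub>R b) - 2 * conv X k u x + conv X k u (x - h m *\<^sub>R b) =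
      (\<integral>y. k (x + h m *\<^sub>R b - y) * u y - 2 * (k (x - y) * u y) + k (x - h m *\<^sub>R b - y) * u y \<partial>torus X)"
      using i by (simp add: conv_def)
    also have "\<dots> = (\<integral>y. (h m)\<^sup>2 * (d m (x - y) * u y) \<partial>torus X)"
    proof (intro Bochner_Integration.integral_cong refl)
      fix y
      have "(h m)\<^sup>2 * d m z = k (z + h m *\<^sub>R b) - 2 * k z + k (z - h m *\<^sub>R b)" for z
        using h(2)[of m] by (simp add: d_def)
      moreover have "x + w - y = x - y + w" "x - w - y = x - y - w" for w
        by simp_all
      ultimately show "k (x + h m *\<^sub>R b - y) * u y - 2 * (k (x - y) * u y) + k (x - h m *\<^sub>R b - y) * u y =
          (h m)\<^sup>2 * (d m (x - y) * u y)"
        by (simp only: mult.assoc[symmetric]) (simp add: left_diff_distrib distrib_right)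
    qed
    finally show ?thesis
      using h(2)[of m] by (simp add: D_def)
  qed
  have d_bound: "\<exists>B. \<forall>m x y. norm x \<le> R \<longrightarrow> y \<in> cbox (-X) X \<longrightarrow> \<bar>d m (x - y)\<bar> \<le> B" for R
  proof -
    obtain B where B: "0 \<le> B" "\<And>x y. norm x \<le> R + 1 \<Longrightarrow> y \<in> cbox (-X) X \<Longrightarrow> \<bar>k2 (x - y)\<bar> \<le> B"
      using continuous_bounded_differences[OF k2] by blast
    have "\<bar>d m (x - y)\<bar> \<le> B" if "norm x \<le> R" "y \<in> cbox (-X) X" for m x y
    proof -
      have "\<bar>k2 (x - y + t *\<^sub>R b)\<bar> \<le> B" if t: "\<bar>t\<bar> \<le> h m" for t
      proof -
        have "norm (x + t *\<^sub>R b) \<le> R + 1"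
          using \<open>norm x \<le> R\<close> t h(3)[of m] norm_triangle_ineq[of x "t *\<^sub>R b"] b by simp
        from B(2)[OF this \<open>y \<in> cbox (-X) X\<close>] show ?thesis
          by (simp add: algebra_simps)
      qed
      from this[OF rs(1)[of m "x - y"]] this[OF rs(2)[of m "x - y"]] show ?thesis
        unfolding rs(3)[of m "x - y"] by (simp add: abs_le_iff)
    qed
    then show ?thesis by blast
  qed
  show "\<exists>C. \<forall>m. \<forall>x\<in>cbox (-X) X. \<bar>D m x\<bar> \<le> C"
  proof -
    obtain R where R: "\<And>x. x \<in> cbox (-X) X \<Longrightarrow> norm x \<le> R"
      using bounded_cbox[of "-X" X] unfolding bounded_iff by blast
    obtain B where B: "\<And>m x y. norm x \<le> R \<Longrightarrow> y \<in> cbox (-X) X \<Longrightarrow> \<bar>d m (x - y)\<bar> \<le> B"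
      using d_bound by blast
    have "\<bar>D m x\<bar> \<le> (\<integral>y. B * \<bar>u y\<bar> \<partial>torus X)" if x: "x \<in> cbox (-X) X" for m x
    proof -
      have "\<bar>D m x\<bar> \<le> (\<integral>y. \<bar>d m (x - y) * u y\<bar> \<partial>torus X)"
        unfolding D_eq by simp
      also have "\<dots> \<le> (\<integral>y. B * \<bar>u y\<bar> \<partial>torus X)"
      proof (rule integral_mono)
        fix y assume "y \<in> space (torus X)"
        then show "\<bar>d m (x - y) * u y\<bar> \<le> B * \<bar>u y\<bar>"
          using B[OF R[OF x]] by (simp add: abs_mult mult_right_mono)
      qed (use u conv_integrable[OF cont_d u] in auto)
      finally show ?thesis .
    qed
    then show ?thesis by blast
  qed
  show "(\<lambda>m. D m x) \<longlonglongrightarrow> conv X k v x"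
  proof -
    obtain B where B: "\<And>m x' y. norm x' \<le> norm x \<Longrightarrow> y \<in> cbox (-X) X \<Longrightarrow> \<bar>d m (x' - y)\<bar> \<le> B"
      using d_bound by blast
    have lim: "(\<lambda>m. d m z) \<longlonglongrightarrow> k2 z" for z
    proof -
      have "(\<lambda>m. k2 (z + t m *\<^sub>R b)) \<longlonglongrightarrow> k2 z" if "\<And>m. \<bar>t m\<bar> \<le> h m" for t
      proof -
        have "t \<longlonglongrightarrow> 0"
          by (rule Lim_null_comparison[OF _ h(1)]) (use that in auto)
        then have "(\<lambda>m. z + t m *\<^sub>R b) \<longlonglongrightarrow> z + 0 *\<^sub>R b"
          by (intro tendsto_intros)
        moreover have "isCont k2 z"
          using k2 by (simp add: continuous_on_eq_continuous_within)
        ultimately show ?thesis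
          using isCont_tendsto_compose[of z k2 "\<lambda>m. z + t m *\<^sub>R b"] by simp
      qed
      from this[of "\<lambda>m. r m z"] this[of "\<lambda>m. s m z"] rs(1,2)
      have "(\<lambda>m. (k2 (z + r m z *\<^sub>R b) + k2 (z + s m z *\<^sub>R b)) / 2) \<longlonglongrightarrow> (k2 z + k2 z) / 2"
        by (intro tendsto_intros) auto
      then show ?thesis
        by (simp add: rs(3))
    qed
    have "(\<lambda>m. D m x) \<longlonglongrightarrow> (\<integral>y. k2 (x - y) * u y \<partial>torus X)"
      unfolding D_eq
    proof (rule integral_dominated_convergence[where w = "\<lambda>y. B * \<bar>u y\<bar>"])
      show "AE y in torus X. (\<lambda>m. d m (x - y) * u y) \<longlonglongrightarrow> k2 (x - y) * u y"
        by (intro AE_I2 tendsto_intros lim)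
      show "AE y in torus X. norm (d m (x - y) * u y) \<le> B * \<bar>u y\<bar>" for m
        using B[OF order_refl] by (intro AE_I2) (auto simp: abs_mult intro!: mult_right_mono)
    qed (use u conv_integrable[OF cont_d u] conv_integrable[OF k2 u] in auto)
    also have "(\<integral>y. k2 (x - y) * u y \<partial>torus X) = conv X k v x"
    proof -
      have dk: "partial_deriv b k differentiable (at z)" for z
        by (intro smooth_differentiable smooth_partial_deriv k b)
      then have "(\<lambda>y. partial_deriv b k (x - y)) differentiable (at y)" for y
        by (intro smooth_differentiable smooth_reflect_shift smooth_partial_deriv k b)
      then have "partial_deriv b (\<lambda>y. - partial_deriv b k (x - y)) = (\<lambda>y. k2 (x - y))"
        unfolding k2_def using partial_deriv_reflect_shift[OF dk, of b x]
        by (simp add: partial_deriv_uminus)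
      then have "partial_deriv b (partial_deriv b (\<lambda>y. k (x - y))) = (\<lambda>y. k2 (x - y))"
        using partial_deriv_reflect_shift[of k b x] smooth_differentiable[OF k(1)] by simp
      then show ?thesis
        using weak[OF smooth_reflect_shift[OF k(1)] periodic_reflect_shift[OF k(2)], of x]
        by (simp add: conv_def mult.commute)
    qed
    finally show ?thesis .
  qed
qed

text \<open>Summation by parts: a shift by \<open>w\<close> in one of the two first differences leaves
  \<open>- \<integral> (p(x + w) - p x) (g(p(x + w)) - g(p x))\<close>.\<close>

lemma second_difference_monotone_test:
  fixes X :: "'a::euclidean_space"
  assumes X: "\<And>b. b \<in> Basis \<Longrightarrow> 0 < X \<bullet> b"
    and p: "continuous_on UNIV p" "periodic X p"
    and g: "mono g" "continuous_on UNIV g"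
  shows "(\<integral>x. (p (x + w) - 2 * p x + p (x - w)) * g (p x) \<partial>torus X) \<le> 0"
proof -
  have c: "continuous_on UNIV (\<lambda>x. p (x + v))" for v
    by (auto intro!: continuous_on_compose2[OF p(1)] continuous_intros)
  have cg: "continuous_on UNIV (\<lambda>x. g (p (x + v)))" for v
    by (auto intro!: continuous_on_compose2[OF g(2) c])
  define F where "F x = (p x - p (x + w)) * g (p (x + w))" for x
  have cF: "continuous_on UNIV F"
    unfolding F_def by (intro continuous_intros c cg p)
  have pF: "periodic X F"
    using periodicD[OF p(2)] periodicD[OF periodic_shift[OF p(2), of w]]
    by (simp add: periodic_def F_def)
  have cG: "continuous_on UNIV (\<lambda>x. (p (x + w) - p x) * g (p x))"
    using cg[of 0] by (auto intro!: continuous_intros c p(1))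
  have cF': "continuous_on UNIV (\<lambda>x. F (x + - w))"
    by (auto intro!: continuous_on_compose2[OF cF] continuous_intros)
  have "(p (x + w) - 2 * p x + p (x - w)) * g (p x) = (p (x + w) - p x) * g (p x) + F (x + - w)" for x
    by (simp add: F_def algebra_simps)
  then have "(\<integral>x. (p (x + w) - 2 * p x + p (x - w)) * g (p x) \<partial>torus X) =
      (\<integral>x. (p (x + w) - p x) * g (p x) \<partial>torus X) + (\<integral>x. F (x + - w) \<partial>torus X)"
    using torus_integral_continuous(1)[OF cG] torus_integral_continuous(1)[OF cF'] by simp
  also have "(\<integral>x. F (x + - w) \<partial>torus X) = (\<integral>x. F x \<partial>torus X)"
    by (rule torus_integral_shift[OF X cF pF])
  also have "(\<integral>x. (p (x + w) - p x) * g (p x) \<partial>torus X) + (\<integral>x. F x \<partial>torus X) =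
      (\<integral>x. - ((p (x + w) - p x) * (g (p (x + w)) - g (p x))) \<partial>torus X)"
    using torus_integral_continuous(1)[OF cG] torus_integral_continuous(1)[OF cF]
    by (subst Bochner_Integration.integral_add[symmetric])
      (auto simp: F_def algebra_simps intro!: Bochner_Integration.integral_cong)
  also have "\<dots> \<le> 0"
  proof -
    have "0 \<le> (p (x + w) - p x) * (g (p (x + w)) - g (p x))" for x
      using monoD[OF g(1), of "p (x + w)" "p x"] monoD[OF g(1), of "p x" "p (x + w)"]
      by (cases "p x \<le> p (x + w)") (auto intro: mult_nonneg_nonneg mult_nonpos_nonpos)
    then show ?thesis
      by (simp add: integral_nonneg_AE)
  qed
  finally show ?thesis .
qed

lemma mollified_dissipation:
  fixes X :: "'a::euclidean_space"
  assumes X: "\<And>b. b \<in> Basis \<Longrightarrow> 0 < X \<bullet> b"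
    and k: "smooth k" "periodic X k" and b: "b \<in> Basis"
    and u: "integrable (torus X) u"
    and v: "integrable (torus X) v"
    and weak: "\<And>\<eta>. smooth \<eta> \<Longrightarrow> periodic X \<eta> \<Longrightarrow>
      (\<integral>x. u x * partial_deriv b (partial_deriv b \<eta>) x \<partial>torus X) = (\<integral>x. v x * \<eta> x \<partial>torus X)"
    and g: "mono g" "continuous_on UNIV g"
  shows "(\<integral>x. conv X k v x * g (conv X k u x) \<partial>torus X) \<le> 0"
proof -
  interpret finite_measure "torus X" by (rule finite_measure_torus)
  define p where "p = conv X k u"
  define h where "h m = 1 / real (Suc m)" for m
  have h: "h \<longlonglongrightarrow> 0" "0 < h m" "h m \<le> 1" for m
    unfolding h_def by (rule LIMSEQ_Suc[OF lim_1_over_n]) simp_all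
  define D where "D m x = (p (x + h m *\<^sub>R b) - 2 * p x + p (x - h m *\<^sub>R b)) / (h m)\<^sup>2" for m x
  have p: "continuous_on UNIV p" "periodic X p"
    unfolding p_def by (rule conv_continuous[OF smooth_continuous[OF k(1)] u], rule conv_periodic[OF k(2)])
  have lim: "(\<lambda>m. D m x) \<longlonglongrightarrow> conv X k v x" for x
    unfolding D_def p_def by (rule conv_second_difference(1)[OF k b u weak h])
  obtain C where C: "\<And>m x. x \<in> cbox (-X) X \<Longrightarrow> \<bar>D m x\<bar> \<le> C"
    using conv_second_difference(2)[OF k b u weak h] unfolding D_def p_def by blast
  have gp: "continuous_on UNIV (\<lambda>x. g (p x))"
    by (auto intro!: continuous_on_compose2[OF g(2) p(1)])
  have cD: "continuous_on UNIV (D m)" for m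
    unfolding D_def using h(2)[of m]
    by (auto intro!: continuous_intros continuous_on_compose2[OF p(1)])
  have "(\<lambda>m. \<integral>x. D m x * g (p x) \<partial>torus X) \<longlonglongrightarrow> (\<integral>x. conv X k v x * g (p x) \<partial>torus X)"
  proof (rule integral_dominated_convergence[where w = "\<lambda>x. C * \<bar>g (p x)\<bar>"])
    show "AE x in torus X. (\<lambda>m. D m x * g (p x)) \<longlonglongrightarrow> conv X k v x * g (p x)"
      by (intro AE_I2 tendsto_intros lim)
    show "AE x in torus X. norm (D m x * g (p x)) \<le> C * \<bar>g (p x)\<bar>" for m
      using C by (intro AE_I2) (auto simp: abs_mult intro!: mult_right_mono)
    show "(\<lambda>x. D m x * g (p x)) \<in> borel_measurable (torus X)" for m
      by (intro measurable_torus_continuous continuous_intros cD gp)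
    show "(\<lambda>x. conv X k v x * g (p x)) \<in> borel_measurable (torus X)"
      by (intro measurable_torus_continuous continuous_intros gp
          conv_continuous[OF smooth_continuous[OF k(1)] v])
    show "integrable (torus X) (\<lambda>x. C * \<bar>g (p x)\<bar>)"
      by (intro torus_integral_continuous continuous_intros gp)
  qed
  moreover have "(\<integral>x. D m x * g (p x) \<partial>torus X) \<le> 0" for m
  proof -
    have "(\<integral>x. D m x * g (p x) \<partial>torus X) =
        (\<integral>x. (1 / (h m)\<^sup>2) * ((p (x + h m *\<^sub>R b) - 2 * p x + p (x - h m *\<^sub>R b)) * g (p x)) \<partial>torus X)"
      by (simp add: D_def)
    also have "\<dots> = (1 / (h m)\<^sup>2) *
        (\<integral>x. (p (x + h m *\<^sub>R b) - 2 * p x + p (x - h m *\<^sub>R b)) * g (p x) \<partial>torus X)"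
      by (rule integral_mult_right_zero)
    also have "\<dots> \<le> 0"
      using second_difference_monotone_test[OF X p g, of "h m *\<^sub>R b"]
      by (intro mult_nonneg_nonpos) auto
    finally show ?thesis .
  qed
  ultimately show ?thesis
    unfolding p_def by (intro LIMSEQ_le_const2) auto
qed

text \<open>Formally this is \<open>- \<integral> g'(u) (\<partial>\<^sub>b u)\<^sup>2 \<le> 0\<close>. It is obtained from the mollified
  inequality by strong convergence, without a chain rule for Sobolev functions.\<close>

proposition weak_dissipation:
  fixes X :: "'a::euclidean_space"
  assumes X: "\<And>b. b \<in> Basis \<Longrightarrow> 0 < X \<bullet> b" and b: "b \<in> Basis"
    and u: "sq_integrable (torus X) u" and v: "sq_integrable (torus X) v"
    and weak: "\<And>\<eta>. smooth \<eta> \<Longrightarrow> periodic X \<eta> \<Longrightarrow>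
      (\<integral>x. u x * partial_deriv b (partial_deriv b \<eta>) x \<partial>torus X) = (\<integral>x. v x * \<eta> x \<partial>torus X)"
    and g: "mono g" "\<And>a b. \<bar>g a - g b\<bar> \<le> \<bar>a - b\<bar>" "g 0 = 0"
  shows "(\<integral>x. v x * g (u x) \<partial>torus X) \<le> 0"
proof -
  have ui: "integrable (torus X) u" and vi: "integrable (torus X) v"
    using sq_integrable_imp_integrable[OF finite_measure_torus] u v by blast+
  have gc: "continuous_on UNIV g"
    by (rule lipschitz_on_continuous_on[of 1]) (use g(2) in \<open>auto simp: lipschitz_on_def dist_real_def\<close>)
  have [measurable]: "g \<in> borel_measurable borel"
    using gc by (rule borel_measurable_continuous_onI)
  have g0: "\<bar>g a\<bar> \<le> \<bar>a\<bar>" for a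
    using g(2)[of a 0] g(3) by simp
  let ?K = "\<lambda>n. peak_kernel X n"
  note K = smooth_continuous[OF smooth_peak_kernel[OF X]] periodic_peak_kernel[OF X]
    peak_kernel_nonneg[OF X] peak_kernel_mass[OF X]
  define e where "e w n = (\<integral>x. (conv X (?K n) w x - w x)\<^sup>2 \<partial>torus X)" for w n
  define U V where "U = (\<integral>x. (u x)\<^sup>2 \<partial>torus X)" and "V = (\<integral>x. (v x)\<^sup>2 \<partial>torus X)"
  have "(\<integral>x. v x * g (u x) \<partial>torus X) \<le> sqrt (e v n) * sqrt U + sqrt V * sqrt (e u n)" for n
  proof -
    define un vn where "un = conv X (?K n) u" and "vn = conv X (?K n) v"
    have un: "sq_integrable (torus X) un" and vn: "sq_integrable (torus X) vn"
      and unU: "(\<integral>x. (un x)\<^sup>2 \<partial>torus X) \<le> U"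
      using conv_contraction[OF X K u] conv_contraction[OF X K v] by (auto simp: un_def vn_def U_def)
    have [measurable]: "un \<in> borel_measurable (torus X)" "u \<in> borel_measurable (torus X)"
      using un u by (auto simp: sq_integrable_def)
    have sg: "sq_integrable (torus X) (\<lambda>x. g (un x))" "sq_integrable (torus X) (\<lambda>x. g (u x))"
      by (rule sq_integrable_dominated[OF un] sq_integrable_dominated[OF u]; use g0 in simp)+
    have sd: "sq_integrable (torus X) (\<lambda>x. vn x - v x)" "sq_integrable (torus X) (\<lambda>x. un x - u x)"
      "sq_integrable (torus X) (\<lambda>x. g (un x) - g (u x))"
      using sq_integrable_diff un u vn v sg by blast+
    have neg: "(\<integral>x. vn x * g (un x) \<partial>torus X) \<le> 0"
      unfolding un_def vn_def
      by (rule mollified_dissipation[OF X smooth_peak_kernel[OF X] periodic_peak_kernel[OF X] b ui vi weak g(1) gc])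
    have 1: "\<bar>\<integral>x. (vn x - v x) * g (un x) \<partial>torus X\<bar> \<le> sqrt (e v n) * sqrt U"
    proof -
      have "(\<integral>x. (g (un x))\<^sup>2 \<partial>torus X) \<le> (\<integral>x. (un x)\<^sup>2 \<partial>torus X)"
        using sg un g0 by (intro integral_mono) (auto simp: sq_integrable_def abs_le_square_iff)
      then have "sqrt (\<integral>x. (g (un x))\<^sup>2 \<partial>torus X) \<le> sqrt U"
        using unU by simp
      then have "sqrt (e v n) * sqrt (\<integral>x. (g (un x))\<^sup>2 \<partial>torus X) \<le> sqrt (e v n) * sqrt U"
        by (intro mult_left_mono) (simp_all add: e_def)
      then show ?thesis
        using Cauchy_Schwarz_integral[OF sd(1) sg(1)] by (simp add: e_def vn_def)
    qed
    have 2: "\<bar>\<integral>x. v x * (g (un x) - g (u x)) \<partial>torus X\<bar> \<le> sqrt V * sqrt (e u n)"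
    proof -
      have "(\<integral>x. (g (un x) - g (u x))\<^sup>2 \<partial>torus X) \<le> e u n"
        unfolding e_def un_def[symmetric]
        using sd g(2) by (intro integral_mono) (auto simp: sq_integrable_def abs_le_square_iff)
      then have "sqrt V * sqrt (\<integral>x. (g (un x) - g (u x))\<^sup>2 \<partial>torus X) \<le> sqrt V * sqrt (e u n)"
        by (intro mult_left_mono) (simp_all add: V_def)
      then show ?thesis
        using Cauchy_Schwarz_integral[OF v sd(3)] by (simp add: V_def)
    qed
    have i: "integrable (torus X) (\<lambda>x. vn x * g (un x))" "integrable (torus X) (\<lambda>x. v x * g (u x))"
      "integrable (torus X) (\<lambda>x. v x * g (un x))"
      using sq_integrable_mult vn v sg by blast+
    have "(\<integral>x. (vn x - v x) * g (un x) \<partial>torus X) =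
        (\<integral>x. vn x * g (un x) \<partial>torus X) - (\<integral>x. v x * g (un x) \<partial>torus X)"
      "(\<integral>x. v x * (g (un x) - g (u x)) \<partial>torus X) =
        (\<integral>x. v x * g (un x) \<partial>torus X) - (\<integral>x. v x * g (u x) \<partial>torus X)"
      using i by (simp_all add: left_diff_distrib right_diff_distrib)
    then show ?thesis
      using neg 1 2 by linarith
  qed
  moreover have "(\<lambda>n. sqrt (e v n) * sqrt U + sqrt V * sqrt (e u n)) \<longlonglongrightarrow>
      sqrt 0 * sqrt U + sqrt V * sqrt 0"
    unfolding e_def by (intro tendsto_intros conv_peak_kernel_L2[OF X] u v)
  ultimately show ?thesis
    by (intro LIMSEQ_le_const[where X = "\<lambda>n. sqrt (e v n) * sqrt U + sqrt V * sqrt (e u n)"]) auto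
qed

section \<open>A smooth step function\<close>

text \<open>The functions \<open>p(1/x) exp(-1/x)\<close> for \<open>x > 0\<close>, extended by zero; the class is closed under
  differentiation.\<close>

definition flat :: "real poly \<Rightarrow> real \<Rightarrow> real" where
  "flat p x = (if x \<le> 0 then 0 else poly p (1 / x) * exp (- 1 / x))"

lemma poly_div_exp_tendsto_0: "((\<lambda>y. poly p y / exp y) \<longlongrightarrow> (0::real)) at_top"
proof -
  have "((\<lambda>y. \<Sum>i\<le>degree p. coeff p i * (y ^ i / exp y)) \<longlongrightarrow> (\<Sum>i\<le>degree p. coeff p i * 0)) at_top"
    by (intro tendsto_intros tendsto_power_div_exp_0)
  then show ?thesis
    by (simp add: poly_altdef sum_divide_distrib)
qed

lemma flat_tendsto_0: "(flat p \<longlongrightarrow> 0) (at_right 0)"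
proof -
  have "((\<lambda>x. poly p (inverse x) / exp (inverse x)) \<longlongrightarrow> 0) (at_right 0)"
    by (rule filterlim_compose[OF poly_div_exp_tendsto_0 filterlim_inverse_at_top_right])
  then show ?thesis
    by (rule Lim_transform_eventually)
      (auto simp: eventually_at_right_field flat_def exp_minus divide_inverse intro!: exI[of _ 1])
qed

lemma DERIV_locally_eq:
  fixes g :: "real \<Rightarrow> real"
  assumes "\<forall>\<^sub>F y in nhds x. h y = g y" "DERIV g x :> D"
  shows "DERIV h x :> D"
  using DERIV_cong_ev[OF refl assms(1) refl] assms(2) by blast

lemma DERIV_flat: "DERIV (flat p) x :> flat ([:0, 0, 1:] * (p - pderiv p)) x"
proof -
  consider "x < 0" | "x = 0" | "x > 0" by linarith
  then show ?thesis
  proof cases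
    case 1
    have "\<forall>\<^sub>F y in nhds x. flat p y = 0"
      using eventually_nhds_in_open[of "{..<0}" x] 1 by (auto simp: flat_def elim!: eventually_mono)
    then have "DERIV (flat p) x :> 0"
      by (rule DERIV_locally_eq) simp
    then show ?thesis
      using 1 by (simp add: flat_def)
  next
    case 2
    have "((\<lambda>h. (flat p h - flat p 0) / (h - 0)) \<longlongrightarrow> 0) (at 0)"
      unfolding filterlim_at_split
    proof
      show "((\<lambda>h. (flat p h - flat p 0) / (h - 0)) \<longlongrightarrow> 0) (at_left 0)"
        by (rule tendsto_eventually) (auto simp: eventually_at_left_field flat_def intro!: exI[of _ "-1"])
      have "flat ([:0, 1:] * p) h = (flat p h - flat p 0) / (h - 0)" if "h > 0" for h
        using that by (simp add: flat_def)
      then show "((\<lambda>h. (flat p h - flat p 0) / (h - 0)) \<longlongrightarrow> 0) (at_right 0)"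
        using flat_tendsto_0[of "[:0, 1:] * p"]
        by (elim Lim_transform_eventually) (auto simp: eventually_at_right_field intro!: exI[of _ 1])
    qed
    then show ?thesis
      using 2 by (simp add: has_field_derivative_iff flat_def)
  next
    case 3
    have "DERIV (\<lambda>x. poly p (1 / x) * exp (- 1 / x)) x :>
        poly (pderiv p) (1 / x) * (- 1 / x\<^sup>2) * exp (- 1 / x) +
        poly p (1 / x) * (exp (- 1 / x) * (1 / x\<^sup>2))"
      using 3 by (auto intro!: derivative_eq_intros DERIV_chain2[OF poly_DERIV] simp: power2_eq_square)
    moreover have "\<forall>\<^sub>F y in nhds x. flat p y = poly p (1 / y) * exp (- 1 / y)"
      using eventually_nhds_in_open[of "{0<..}" x] 3 by (auto simp: flat_def elim!: eventually_mono)
    ultimately have "DERIV (flat p) x :> poly (pderiv p) (1 / x) * (- 1 / x\<^sup>2) * exp (- 1 / x) +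
        poly p (1 / x) * (exp (- 1 / x) * (1 / x\<^sup>2))"
      by (rule DERIV_locally_eq[rotated])
    moreover have "poly (pderiv p) (1 / x) * (- 1 / x\<^sup>2) * exp (- 1 / x) +
        poly p (1 / x) * (exp (- 1 / x) * (1 / x\<^sup>2)) = flat ([:0, 0, 1:] * (p - pderiv p)) x"
      using 3 by (simp add: flat_def field_simps power2_eq_square)
    ultimately show ?thesis by simp
  qed
qed

lemma DERIV_partial_deriv:
  fixes g :: "real \<Rightarrow> real"
  assumes "DERIV g x :> g'"
  shows "partial_deriv 1 g x = g'" "g differentiable (at x)"
  using partial_deriv_eq[OF assms[unfolded has_field_derivative_def]]
    differentiableI[OF assms[unfolded has_field_derivative_def]] by simp_all

lemma smooth_DERIV:
  fixes g :: "real \<Rightarrow> real"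
  assumes "smooth g"
  shows "DERIV g x :> partial_deriv 1 g x"
  using DERIV_along_direction[of g 0 x 1] smooth_differentiable[OF assms] by simp

lemma smooth_flat: "smooth (flat p)"
  unfolding smooth_def
proof
  fix k show "C_k k (flat p)"
  proof (induction k arbitrary: p)
    case 0
    show ?case
      using DERIV_isCont[OF DERIV_flat] by (simp add: continuous_on_eq_continuous_within)
  next
    case (Suc k)
    have "partial_deriv 1 (flat p) = flat ([:0, 0, 1:] * (p - pderiv p))"
      using DERIV_partial_deriv(1)[OF DERIV_flat] by auto
    then show ?case
      using Suc DERIV_partial_deriv(2)[OF DERIV_flat] by simp
  qed
qed

text \<open>A smooth transition from 0 on \<open>(-\<infinity>, 0]\<close> to 1 on \<open>[1, \<infinity>)\<close>, and its derivative.\<close>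

definition step :: "real \<Rightarrow> real" where
  "step x = flat 1 x / (flat 1 x + flat 1 (1 - x))"

lemma flat_1: "0 \<le> flat 1 x" "0 < x \<Longrightarrow> 0 < flat 1 x" "x \<le> 0 \<Longrightarrow> flat 1 x = 0"
  by (simp_all add: flat_def)

lemma step_denominator: "0 < flat 1 x + flat 1 (1 - x)"
  using flat_1(1)[of x] flat_1(1)[of "1 - x"] flat_1(2)[of x] flat_1(2)[of "1 - x"]
  by (cases "0 < x") linarith+

lemma smooth_step: "smooth step"
proof -
  have "smooth (\<lambda>x. flat 1 x / (flat 1 x + flat 1 (1 - x)))"
    using step_denominator
    by (intro smooth_divide smooth_add smooth_flat smooth_reflect_shift) (metis less_irrefl)
  then show ?thesis
    by (simp add: step_def[abs_def])
qed

lemma step_eq_0: "x \<le> 0 \<Longrightarrow> step x = 0"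
  and step_eq_1: "1 \<le> x \<Longrightarrow> step x = 1"
  and step_nonneg: "0 \<le> step x"
  and step_le_1: "step x \<le> 1"
  using flat_1(1)[of x] flat_1(1)[of "1 - x"] flat_1(3)[of x] flat_1(3)[of "1 - x"]
    flat_1(2)[of x] step_denominator[of x]
  by (auto simp: step_def)

definition step' :: "real \<Rightarrow> real" where
  "step' = partial_deriv 1 step"

lemma DERIV_step: "DERIV step x :> step' x"
  unfolding step'_def by (rule smooth_DERIV[OF smooth_step])

lemma DERIV_step_affine: "DERIV (\<lambda>\<tau>. step ((\<tau> - c) / d)) \<tau> :> step' ((\<tau> - c) / d) / d"
proof -
  have "DERIV (\<lambda>\<tau>. (\<tau> - c) / d) \<tau> :> 1 / d"
    by (auto intro!: derivative_eq_intros simp: divide_inverse)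
  from DERIV_chain2[OF DERIV_step this] show ?thesis
    by simp
qed

lemma continuous_step': "continuous_on UNIV step'"
  unfolding step'_def by (intro smooth_continuous smooth_partial_deriv smooth_step) simp

lemma step'_eq_0: "x < 0 \<or> 1 < x \<Longrightarrow> step' x = 0"
proof -
  assume x: "x < 0 \<or> 1 < x"
  define c :: real where "c = (if x < 0 then 0 else 1)"
  have "\<forall>\<^sub>F y in nhds x. step y = c"
    using x eventually_nhds_in_open[of "{..<0}" x] eventually_nhds_in_open[of "{1<..}" x]
    by (cases "x < 0") (auto simp: c_def step_eq_0 step_eq_1 elim!: eventually_mono)
  then have "DERIV step x :> 0"
    by (rule DERIV_locally_eq) simp
  then show ?thesis
    using DERIV_step DERIV_unique by blast
qed

lemma step'_bounded: obtains C where "0 \<le> C" "\<And>x. \<bar>step' x\<bar> \<le> C"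
proof -
  have "bounded (step' ` {0..1})"
    using continuous_step' by (intro compact_imp_bounded compact_continuous_image)
      (auto intro: continuous_on_subset)
  then obtain C where C: "\<And>x. x \<in> {0..1} \<Longrightarrow> \<bar>step' x\<bar> \<le> C"
    unfolding bounded_iff real_norm_def by blast
  have "\<bar>step' x\<bar> \<le> max C 0" for x
    using C[of x] step'_eq_0[of x] by (cases "0 \<le> x \<and> x \<le> 1") auto
  then show ?thesis
    using that[of "max C 0"] by simp
qed

section \<open>Integrating a distributional derivative\<close>

lemma lebesgue_on_support:
  fixes f :: "real \<Rightarrow> real"
  assumes "I \<subseteq> J" "I \<in> sets lebesgue" "J \<in> sets lebesgue" "\<And>x. x \<in> J - I \<Longrightarrow> f x = 0"
  shows "(\<integral>x. f x \<partial>lebesgue_on J) = (\<integral>x. f x \<partial>lebesgue_on I)"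
    and "integrable (lebesgue_on J) f \<longleftrightarrow> integrable (lebesgue_on I) f"
proof -
  have eq: "(\<lambda>x. indicator J x *\<^sub>R f x) = (\<lambda>x. indicator I x *\<^sub>R f x)"
    using assms(1,4) by (auto simp: fun_eq_iff indicator_def)
  show "(\<integral>x. f x \<partial>lebesgue_on J) = (\<integral>x. f x \<partial>lebesgue_on I)"
    using assms(2,3) eq by (simp add: integral_restrict_space)
  show "integrable (lebesgue_on J) f \<longleftrightarrow> integrable (lebesgue_on I) f"
    using assms(2,3) eq by (simp add: integrable_restrict_space)
qed

text \<open>The derivatives of steepening steps form an approximate identity from the right.\<close>

lemma step'_approximate_identity:
  fixes a :: "real \<Rightarrow> real"
  assumes s: "0 < s" and \<delta>0: "0 < \<delta>0" "s + \<delta>0 < T" and a: "continuous_on {0<..<T} a"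
    and \<delta>: "\<delta> \<longlonglongrightarrow> 0" "\<And>n. 0 < \<delta> n" "\<And>n. \<delta> n \<le> \<delta>0"
  shows "(\<lambda>n. \<integral>\<tau>. a \<tau> * (step' ((\<tau> - s) / \<delta> n) / \<delta> n) \<partial>lebesgue_on {0<..<T}) \<longlonglongrightarrow> a s"
    and "integrable (lebesgue_on {0<..<T}) (\<lambda>\<tau>. a \<tau> * (step' ((\<tau> - s) / \<delta> n) / \<delta> n))"
proof -
  obtain C where C: "0 \<le> C" "\<And>x. \<bar>step' x\<bar> \<le> C"
    using step'_bounded by blast
  define k where "k n \<tau> = step' ((\<tau> - s) / \<delta> n) / \<delta> n" for n \<tau>
  have k0: "k n \<tau> = 0" if "\<tau> \<notin> {s..s + \<delta> n}" for n \<tau>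
    using that \<delta>(2)[of n] step'_eq_0[of "(\<tau> - s) / \<delta> n"] by (auto simp: k_def field_simps)
  have kc: "continuous_on UNIV (k n)" for n
    unfolding k_def using \<delta>(2)[of n]
    by (auto intro!: continuous_intros continuous_on_compose2[OF continuous_step'])
  have kb: "\<bar>k n \<tau>\<bar> \<le> C / \<delta> n" for n \<tau>
    using C(2)[of "(\<tau> - s) / \<delta> n"] \<delta>(2)[of n] by (simp add: k_def abs_div divide_right_mono)
  have sub: "{s..s + \<delta> n} \<subseteq> {0<..<T}" for n
    using s \<delta>0 \<delta>(3)[of n] by auto
  have ac: "continuous_on {s..s + \<delta> n} a" for n
    using a sub continuous_on_subset by blast
  have i: "integrable (lebesgue_on {s..s + \<delta> n}) (\<lambda>\<tau>. a \<tau> * k n \<tau>)"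
    "integrable (lebesgue_on {s..s + \<delta> n}) (k n)" for n
    by (intro continuous_imp_integrable_real continuous_intros ac continuous_on_subset[OF kc]; simp)+
  have eq: "(\<integral>\<tau>. a \<tau> * k n \<tau> \<partial>lebesgue_on {0<..<T}) = (\<integral>\<tau>. a \<tau> * k n \<tau> \<partial>lebesgue_on {s..s + \<delta> n})"
    "integrable (lebesgue_on {0<..<T}) (\<lambda>\<tau>. a \<tau> * k n \<tau>)" for n
    using lebesgue_on_support[OF sub[of n], of "\<lambda>\<tau>. a \<tau> * k n \<tau>"] k0[of _ n] i(1)[of n] by auto
  from eq(2)[of n] show "integrable (lebesgue_on {0<..<T}) (\<lambda>\<tau>. a \<tau> * (step' ((\<tau> - s) / \<delta> n) / \<delta> n))"
    by (simp add: k_def)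
  have mass: "(\<integral>\<tau>. k n \<tau> \<partial>lebesgue_on {s..s + \<delta> n}) = 1" for n
  proof -
    have "((k n) has_integral (step ((s + \<delta> n - s) / \<delta> n) - step ((s - s) / \<delta> n))) {s..s + \<delta> n}"
    proof (rule fundamental_theorem_of_calculus)
      fix \<tau>
      have "((\<lambda>\<tau>. step ((\<tau> - s) / \<delta> n)) has_real_derivative k n \<tau>) (at \<tau> within {s..s + \<delta> n})"
        unfolding k_def by (rule has_field_derivative_at_within[OF DERIV_step_affine])
      then show "((\<lambda>\<tau>. step ((\<tau> - s) / \<delta> n)) has_vector_derivative k n \<tau>) (at \<tau> within {s..s + \<delta> n})"
        by (simp add: has_real_derivative_iff_has_vector_derivative)
    qed (use \<delta>(2)[of n] in simp)
    then have "integral {s..s + \<delta> n} (k n) = 1"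
      using \<delta>(2)[of n] by (simp add: step_eq_0 step_eq_1 integral_unique)
    then show ?thesis
      using i(2)[of n] by (simp add: lebesgue_integral_eq_integral)
  qed
  have "(\<lambda>n. \<integral>\<tau>. a \<tau> * k n \<tau> \<partial>lebesgue_on {s..s + \<delta> n}) \<longlonglongrightarrow> a s"
  proof (rule LIMSEQ_I)
    fix e :: real assume "0 < e"
    define e' where "e' = e / (C + 1)"
    have "0 < e'" using \<open>0 < e\<close> C(1) by (simp add: e'_def)
    have "isCont a s"
      using a s \<delta>0 by (auto simp: continuous_on_eq_continuous_at)
    then obtain d where d: "0 < d" "\<And>\<tau>. \<bar>\<tau> - s\<bar> < d \<Longrightarrow> \<bar>a \<tau> - a s\<bar> < e'"
      using \<open>0 < e'\<close> unfolding continuous_at_eps_delta dist_real_def by metis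
    have "\<forall>\<^sub>F n in sequentially. \<delta> n < d"
      using \<delta>(1) d(1) by (intro order_tendstoD)
    then obtain N where N: "\<And>n. N \<le> n \<Longrightarrow> \<delta> n < d"
      by (auto simp: eventually_sequentially)
    have "\<bar>(\<integral>\<tau>. a \<tau> * k n \<tau> \<partial>lebesgue_on {s..s + \<delta> n}) - a s\<bar> < e" if "N \<le> n" for n
    proof -
      have "(\<integral>\<tau>. a \<tau> * k n \<tau> \<partial>lebesgue_on {s..s + \<delta> n}) - a s =
          (\<integral>\<tau>. a \<tau> * k n \<tau> - a s * k n \<tau> \<partial>lebesgue_on {s..s + \<delta> n})"
        using i[of n] mass[of n] by simp
      then have "\<bar>(\<integral>\<tau>. a \<tau> * k n \<tau> \<partial>lebesgue_on {s..s + \<delta> n}) - a s\<bar> \<le> (\<integral>\<tau>. \<bar>a \<tau> * k n \<tau> - a s * k n \<tau>\<bar> \<partial>lebesgue_on {s..s + \<delta> n})"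
        by simp
      also have "\<dots> \<le> (\<integral>\<tau>. e' * (C / \<delta> n) \<partial>lebesgue_on {s..s + \<delta> n})"
      proof (rule integral_mono)
        show "integrable (lebesgue_on {s..s + \<delta> n}) (\<lambda>\<tau>. e' * (C / \<delta> n))"
          by (rule continuous_imp_integrable_real) simp
        fix \<tau> assume "\<tau> \<in> space (lebesgue_on {s..s + \<delta> n})"
        then have "\<bar>\<tau> - s\<bar> < d"
          using N[OF that] by auto
        then have "\<bar>a \<tau> - a s\<bar> * \<bar>k n \<tau>\<bar> \<le> e' * (C / \<delta> n)"
          using d(2) kb \<open>0 < e'\<close> by (intro mult_mono) (auto intro: less_imp_le)
        then show "\<bar>a \<tau> * k n \<tau> - a s * k n \<tau>\<bar> \<le> e' * (C / \<delta> n)"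
          by (simp add: abs_mult[symmetric] left_diff_distrib)
      qed (use i in auto)
      also have "\<dots> = e' * C"
        using \<delta>(2)[of n] by (simp add: measure_restrict_space)
      also have "\<dots> < e"
        using \<open>0 < e\<close> C(1) by (simp add: e'_def field_simps)
      finally show ?thesis .
    qed
    then show "\<exists>N. \<forall>n\<ge>N. norm ((\<integral>\<tau>. a \<tau> * k n \<tau> \<partial>lebesgue_on {s..s + \<delta> n}) - a s) < e"
      by auto
  qed
  then show "(\<lambda>n. \<integral>\<tau>. a \<tau> * (step' ((\<tau> - s) / \<delta> n) / \<delta> n) \<partial>lebesgue_on {0<..<T}) \<longlonglongrightarrow> a s"
    unfolding eq(1)[symmetric] by (simp add: k_def)
qed

text \<open>A continuous function with a locally integrable distributional derivative is an integral of
  it.\<close>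

proposition distr_deriv_integral:
  assumes D: "distr_deriv T a r" and a: "continuous_on {0<..<T} a"
    and st: "0 < s" "s < t" "t < T"
  shows "integrable (lebesgue_on {s..t}) r" "a t - a s = (\<integral>\<tau>. r \<tau> \<partial>lebesgue_on {s..t})"
proof -
  show ri: "integrable (lebesgue_on {s..t}) r"
    using D st by (auto simp: distr_deriv_def)
  define \<delta>0 where "\<delta>0 = (T - t) / 2"
  have \<delta>0: "0 < \<delta>0" "t + \<delta>0 < T" "s + \<delta>0 < T"
    using st by (simp_all add: \<delta>0_def field_simps)
  define \<delta> where "\<delta> n = \<delta>0 * (1 / real (Suc n))" for n
  have "\<delta> \<longlonglongrightarrow> \<delta>0 * 0"
    unfolding \<delta>_def by (intro tendsto_intros LIMSEQ_Suc[OF lim_1_over_n])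
  then have \<delta>: "\<delta> \<longlonglongrightarrow> 0" "0 < \<delta> n" "\<delta> n \<le> \<delta>0" for n
    using \<delta>0(1) by (simp_all add: \<delta>_def divide_le_eq)
  \<comment> \<open>smooth approximations of the indicator of \<open>[s, t]\<close>, supported in \<open>[s, t + \<delta>0]\<close>\<close>
  define \<eta> where "\<eta> n \<tau> = step ((\<tau> - s) / \<delta> n) - step ((\<tau> - t) / \<delta> n)" for n \<tau>
  let ?I = "{s..t + \<delta>0}"
  have sub: "?I \<subseteq> {0<..<T}" and ri': "integrable (lebesgue_on ?I) r"
  proof -
    show "?I \<subseteq> {0<..<T}"
      using st \<delta>0 by auto
    show "integrable (lebesgue_on ?I) r"
      using D st \<delta>0 by (auto simp: distr_deriv_def)
  qed
  have smooth: "smooth (\<eta> n)" for n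
  proof -
    have "smooth (\<lambda>\<tau>. step (- s / \<delta> n + (1 / \<delta> n) *\<^sub>R \<tau>) - step (- t / \<delta> n + (1 / \<delta> n) *\<^sub>R \<tau>))"
      by (intro smooth_diff smooth_affine smooth_step)
    then show ?thesis
      by (simp add: \<eta>_def[abs_def] diff_divide_distrib)
  qed
  have supp: "\<eta> n \<tau> = 0" if "\<tau> \<notin> ?I" for n \<tau>
  proof (cases "\<tau> < s")
    case True
    then show ?thesis
      using \<delta>(2)[of n] st by (simp add: \<eta>_def step_eq_0 divide_nonpos_pos)
  next
    case False
    then have "\<delta> n \<le> \<tau> - t" "\<delta> n \<le> \<tau> - s"
      using that \<delta>(3)[of n] st by auto
    then show ?thesis
      using \<delta>(2)[of n] by (simp add: \<eta>_def step_eq_1 le_divide_eq)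
  qed
  have "closure {\<tau>. \<eta> n \<tau> \<noteq> 0} \<subseteq> {0<..<T}" for n
    using closure_minimal[of "{\<tau>. \<eta> n \<tau> \<noteq> 0}" ?I] supp sub by blast
  then have weak: "(\<integral>\<tau>. a \<tau> * deriv (\<eta> n) \<tau> \<partial>lebesgue_on {0<..<T}) =
      - (\<integral>\<tau>. r \<tau> * \<eta> n \<tau> \<partial>lebesgue_on {0<..<T})" for n
    using D smooth by (auto simp: distr_deriv_def)
  have "DERIV (\<eta> n) \<tau> :> step' ((\<tau> - s) / \<delta> n) / \<delta> n - step' ((\<tau> - t) / \<delta> n) / \<delta> n" for n \<tau>
    unfolding \<eta>_def by (intro derivative_intros DERIV_step_affine)
  then have deriv: "deriv (\<eta> n) \<tau> = step' ((\<tau> - s) / \<delta> n) / \<delta> n - step' ((\<tau> - t) / \<delta> n) / \<delta> n" for n \<tau>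
    by (rule DERIV_imp_deriv)
  note As = step'_approximate_identity[OF st(1) \<delta>0(1,3) a \<delta>]
  note At = step'_approximate_identity[OF less_trans[OF st(1,2)] \<delta>0(1,2) a \<delta>]
  have "(\<integral>\<tau>. a \<tau> * deriv (\<eta> n) \<tau> \<partial>lebesgue_on {0<..<T}) =
      (\<integral>\<tau>. a \<tau> * (step' ((\<tau> - s) / \<delta> n) / \<delta> n) \<partial>lebesgue_on {0<..<T}) -
      (\<integral>\<tau>. a \<tau> * (step' ((\<tau> - t) / \<delta> n) / \<delta> n) \<partial>lebesgue_on {0<..<T})" for n
    unfolding deriv right_diff_distrib by (rule Bochner_Integration.integral_diff[OF As(2) At(2)])
  then have L1: "(\<lambda>n. \<integral>\<tau>. a \<tau> * deriv (\<eta> n) \<tau> \<partial>lebesgue_on {0<..<T}) \<longlonglongrightarrow> a s - a t"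
    using tendsto_diff[OF As(1) At(1)] by simp
  have R: "(\<integral>\<tau>. r \<tau> * \<eta> n \<tau> \<partial>lebesgue_on {0<..<T}) = (\<integral>\<tau>. r \<tau> * \<eta> n \<tau> \<partial>lebesgue_on ?I)" for n
    using supp by (intro lebesgue_on_support[OF sub]) auto
  have ind: "(\<lambda>\<tau>. indicator {s..t} \<tau> :: real) \<in> borel_measurable (lebesgue_on ?I)"
    by (intro measurable_restrict_space1 borel_measurable_indicator) simp
  have \<eta>m: "\<eta> n \<in> borel_measurable (lebesgue_on ?I)" for n
    using continuous_imp_integrable_real[OF continuous_on_subset[OF smooth_continuous[OF smooth[of n]]], of s "t + \<delta>0"]
    by auto
  have rm: "r \<in> borel_measurable (lebesgue_on ?I)"
    using ri' by auto
  have L2: "(\<lambda>n. \<integral>\<tau>. r \<tau> * \<eta> n \<tau> \<partial>lebesgue_on ?I) \<longlonglongrightarrow> (\<integral>\<tau>. r \<tau> * indicator {s..t} \<tau> \<partial>lebesgue_on ?I)"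
  proof (rule integral_dominated_convergence[where w = "\<lambda>\<tau>. \<bar>r \<tau>\<bar>"])
    show "AE \<tau> in lebesgue_on ?I. (\<lambda>n. r \<tau> * \<eta> n \<tau>) \<longlonglongrightarrow> r \<tau> * indicator {s..t} \<tau>"
    proof (rule AE_mp[OF _ AE_I2[OF impI]])
      have "{s} \<in> null_sets (lebesgue_on ?I)"
        using st \<delta>0 by (simp add: null_sets_restrict_space)
      then show "AE \<tau> in lebesgue_on ?I. \<tau> \<noteq> s"
        by (rule AE_I') auto
    next
      fix \<tau> assume "\<tau> \<noteq> s"
      have ev: "\<forall>\<^sub>F n in sequentially. step ((\<tau> - c) / \<delta> n) = indicator {c<..} \<tau>" for c
      proof (cases "c < \<tau>")
        case True
        then have "\<forall>\<^sub>F n in sequentially. \<delta> n < \<tau> - c"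
          using \<delta>(1) by (intro order_tendstoD) auto
        then show ?thesis
        proof eventually_elim
          case (elim n)
          then show ?case
            using \<delta>(2)[of n] True by (simp add: step_eq_1 le_divide_eq)
        qed
      next
        case False
        then show ?thesis
          using \<delta>(2) by (intro always_eventually) (simp add: step_eq_0 divide_nonpos_pos)
      qed
      have "\<forall>\<^sub>F n in sequentially. \<eta> n \<tau> = indicator {s..t} \<tau>"
        using ev[of s] ev[of t]
        by eventually_elim (use st \<open>\<tau> \<noteq> s\<close> in \<open>auto simp: \<eta>_def indicator_def\<close>)
      then have "(\<lambda>n. \<eta> n \<tau>) \<longlonglongrightarrow> indicator {s..t} \<tau>"
        by (rule tendsto_eventually)
      then show "(\<lambda>n. r \<tau> * \<eta> n \<tau>) \<longlonglongrightarrow> r \<tau> * indicator {s..t} \<tau>"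
        by (rule tendsto_mult[OF tendsto_const])
    qed
    show "AE \<tau> in lebesgue_on ?I. norm (r \<tau> * \<eta> n \<tau>) \<le> \<bar>r \<tau>\<bar>" for n
    proof (rule AE_I2)
      fix \<tau>
      have "\<bar>\<eta> n \<tau>\<bar> \<le> 1"
        using step_nonneg[of "(\<tau> - s) / \<delta> n"] step_le_1[of "(\<tau> - s) / \<delta> n"]
          step_nonneg[of "(\<tau> - t) / \<delta> n"] step_le_1[of "(\<tau> - t) / \<delta> n"]
        by (simp add: \<eta>_def abs_le_iff)
      then show "norm (r \<tau> * \<eta> n \<tau>) \<le> \<bar>r \<tau>\<bar>"
        using mult_left_mono[of "\<bar>\<eta> n \<tau>\<bar>" 1 "\<bar>r \<tau>\<bar>"] by (simp add: abs_mult)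
    qed
    show "integrable (lebesgue_on ?I) (\<lambda>\<tau>. \<bar>r \<tau>\<bar>)"
      using ri' by simp
  qed (use rm ind \<eta>m in auto)
  have "(\<integral>\<tau>. r \<tau> * indicator {s..t} \<tau> \<partial>lebesgue_on ?I) = (\<integral>\<tau>. r \<tau> * indicator {s..t} \<tau> \<partial>lebesgue_on {s..t})"
    using \<delta>0 by (intro lebesgue_on_support) (auto simp: indicator_def)
  also have "\<dots> = (\<integral>\<tau>. r \<tau> \<partial>lebesgue_on {s..t})"
    by (intro Bochner_Integration.integral_cong) auto
  finally have R': "(\<integral>\<tau>. r \<tau> * indicator {s..t} \<tau> \<partial>lebesgue_on ?I) = (\<integral>\<tau>. r \<tau> \<partial>lebesgue_on {s..t})" .
  have "(\<lambda>n. - (\<integral>\<tau>. r \<tau> * \<eta> n \<tau> \<partial>lebesgue_on ?I)) \<longlonglongrightarrow> - (\<integral>\<tau>. r \<tau> \<partial>lebesgue_on {s..t})"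
    using tendsto_minus[OF L2] unfolding R' .
  with L1 have "a s - a t = - (\<integral>\<tau>. r \<tau> \<partial>lebesgue_on {s..t})"
    unfolding weak R by (rule LIMSEQ_unique)
  then show "a t - a s = (\<integral>\<tau>. r \<tau> \<partial>lebesgue_on {s..t})"
    by simp
qed

section \<open>The nonlinearities\<close>

lemma DERIV_zero_of_quadratic_bound:
  fixes h :: "real \<Rightarrow> real"
  assumes "\<And>s. \<bar>h s\<bar> \<le> c * s\<^sup>2"
  shows "DERIV h 0 :> 0"
proof -
  have h0: "h 0 = 0"
    using assms[of 0] by simp
  have "((\<lambda>s. (h s - h 0) / (s - 0)) \<longlongrightarrow> 0) (at 0)"
  proof (rule Lim_null_comparison)
    have "norm ((h s - h 0) / (s - 0)) \<le> c * \<bar>s\<bar>" if "s \<noteq> 0" for s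
      using that assms[of s]
      by (simp add: h0 abs_div divide_le_eq power2_eq_square abs_mult[symmetric] mult.assoc)
    then show "\<forall>\<^sub>F s in at 0. norm ((h s - h 0) / (s - 0)) \<le> c * \<bar>s\<bar>"
      by (simp add: eventually_at_filter)
    have "((\<lambda>s. c * \<bar>s\<bar>) \<longlongrightarrow> c * \<bar>0\<bar>) (at 0)"
      by (intro tendsto_intros)
    then show "((\<lambda>s. c * \<bar>s\<bar>) \<longlongrightarrow> 0) (at 0)" by simp
  qed
  then show ?thesis
    by (simp add: has_field_derivative_iff)
qed

lemma f_reflect: "f (1 - s) = 1 - f s"
  by (auto simp: f_def power2_eq_square power3_eq_cube algebra_simps)

lemma f_bounds: "0 \<le> f s" "f s \<le> 1"
proof -
  have nn: "0 \<le> f s" for s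
  proof (cases "0 \<le> s \<and> s \<le> 1")
    case True
    have "f s = s\<^sup>2 * (3 - 2 * s)"
      using True by (auto simp: f_def power2_eq_square power3_eq_cube algebra_simps)
    then show ?thesis using True by simp
  qed (auto simp: f_def)
  show "0 \<le> f s" "f s \<le> 1"
    using nn[of s] nn[of "1 - s"] f_reflect[of s] by auto
qed

lemma DERIV_f: "DERIV f s :> (if 0 < s \<and> s < 1 then 6 * s * (1 - s) else 0)"
proof -
  have zero: "DERIV f 0 :> 0"
  proof (rule DERIV_zero_of_quadratic_bound)
    fix s :: real
    show "\<bar>f s\<bar> \<le> 3 * s\<^sup>2"
    proof (cases "s \<le> 1")
      case True
      then show ?thesis
        using f_bounds(1)[of s] by (simp add: f_def)
    next
      case False
      then have "1 \<le> s\<^sup>2" by (simp add: one_le_power)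
      then show ?thesis
        using f_bounds[of s] by simp
    qed
  qed
  consider "s < 0" | "s = 0" | "0 < s" "s < 1" | "s = 1" | "1 < s" by linarith
  then show ?thesis
  proof cases
    case 1
    then have "\<forall>\<^sub>F y in nhds s. f y = 0"
      using eventually_nhds_in_open[of "{..<0}" s] by (auto simp: f_def elim!: eventually_mono)
    then have "DERIV f s :> 0"
      by (rule DERIV_locally_eq) simp
    then show ?thesis
      using 1 by simp
  next
    case 2
    then show ?thesis using zero by simp
  next
    case 3
    then have "\<forall>\<^sub>F y in nhds s. f y = 3 * y\<^sup>2 - 2 * y ^ 3"
      using eventually_nhds_in_open[of "{0<..<1}" s] by (auto simp: f_def elim!: eventually_mono)
    moreover have "DERIV (\<lambda>y. 3 * y\<^sup>2 - 2 * y ^ 3) s :> 6 * s * (1 - s)"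
      by (auto intro!: derivative_eq_intros simp: power2_eq_square algebra_simps)
    ultimately have "DERIV f s :> 6 * s * (1 - s)"
      by (rule DERIV_locally_eq)
    then show ?thesis
      using 3 by simp
  next
    case 4
    have "DERIV (\<lambda>y. f (1 - y)) 1 :> 0 * (- 1)"
      by (rule DERIV_chain2[of f]) (use zero in \<open>auto intro!: derivative_eq_intros\<close>)
    then have "DERIV (\<lambda>y. 1 - f (1 - y)) 1 :> 0"
      by (auto intro!: derivative_eq_intros)
    then show ?thesis
      using 4 by (simp add: f_reflect)
  next
    case 5
    then have "\<forall>\<^sub>F y in nhds s. f y = 1"
      using eventually_nhds_in_open[of "{1<..}" s] by (auto simp: f_def elim!: eventually_mono)
    then have "DERIV f s :> 0"
      by (rule DERIV_locally_eq) simp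
    then show ?thesis
      using 5 by simp
  qed
qed

lemma measurable_f: "f \<in> borel_measurable borel"
  using DERIV_isCont[OF DERIV_f]
  by (intro borel_measurable_continuous_onI) (simp add: continuous_on_eq_continuous_within)

lemma deriv_f: "deriv f s = (if 0 < s \<and> s < 1 then 6 * s * (1 - s) else 0)"
  by (rule DERIV_imp_deriv[OF DERIV_f])

lemma deriv_W: "deriv W s = 36 * (s\<^sup>2 - s) * (2 * s - 1)"
proof (rule DERIV_imp_deriv)
  show "DERIV W s :> 36 * (s\<^sup>2 - s) * (2 * s - 1)"
    unfolding W_def by (auto intro!: derivative_eq_intros simp: algebra_simps)
qed

lemma deriv_f_reflect: "deriv f (1 - s) = deriv f s"
  by (simp add: deriv_f)

lemma deriv_W_reflect: "deriv W (1 - s) = - deriv W s"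
  by (simp add: deriv_W power2_eq_square algebra_simps)

text \<open>If \<open>b < 0\<close>, the left-hand sides are nonpositive or zero for \<open>a \<le> 0\<close>, while for \<open>a > 0\<close> both
  \<open>a\<close> and \<open>- b\<close> are at most \<open>a - b\<close> and \<open>W'\<close> and \<open>f'\<close> vanish at 0.\<close>

lemma min_reaction_bounds:
  fixes a b :: real
  shows "- (deriv W a * min b 0) \<le> 72 * ((a - b)\<^sup>2 + (a - b) ^ 4)"
    and "\<bar>deriv f a * min b 0\<bar> \<le> 72 * (a - b)\<^sup>2"
proof -
  define D where "D = a - b"
  show "- (deriv W a * min b 0) \<le> 72 * ((a - b)\<^sup>2 + (a - b) ^ 4)"
  proof (cases "b < 0")
    case b: True
    show ?thesis
    proof (cases "a \<le> 0")
      case True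
      have "0 \<le> a\<^sup>2 - a"
        using True by (simp add: order_trans[of a 0])
      then have "deriv W a \<le> 0"
        using True unfolding deriv_W by (intro mult_nonneg_nonpos) auto
      then have "- (deriv W a * min b 0) \<le> 0"
        using b by (simp add: mult_nonpos_nonpos)
      also have "0 \<le> 72 * ((a - b)\<^sup>2 + (a - b) ^ 4)"
        by simp
      finally show ?thesis .
    next
      case False
      then have D: "a \<le> D" "- b \<le> D" "0 < D"
        using b by (simp_all add: D_def)
      have "(a - 1) * (2 * a - 1) \<le> 2 * D\<^sup>2 + 1"
      proof -
        have "a\<^sup>2 \<le> D\<^sup>2"
          using D False by (intro power_mono) auto
        then show ?thesis
          using False by (simp add: power2_eq_square algebra_simps)
      qed
      then have "a * ((a - 1) * (2 * a - 1)) * (- b) \<le> D * (2 * D\<^sup>2 + 1) * D"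
        using D False b
        by (smt (verit) mult_left_mono mult_mono mult_nonneg_nonneg mult_right_mono zero_le_power2)
      moreover have "- (deriv W a * b) = 36 * (a * ((a - 1) * (2 * a - 1)) * (- b))"
        by (simp add: deriv_W power2_eq_square algebra_simps)
      ultimately have "- (deriv W a * b) \<le> 36 * (D * (2 * D\<^sup>2 + 1) * D)"
        by linarith
      also have "\<dots> \<le> 72 * (D\<^sup>2 + D ^ 4)"
        by (simp add: power2_eq_square power4_eq_xxxx algebra_simps)
      finally show ?thesis
        using b by (simp add: D_def)
    qed
  qed simp
  show "\<bar>deriv f a * min b 0\<bar> \<le> 72 * (a - b)\<^sup>2"
  proof (cases "b < 0 \<and> 0 < a \<and> a < 1")
    case True
    have "a * (1 - a) * (- b) \<le> D * 1 * D"
      using True by (intro mult_mono) (auto simp: D_def)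
    then have "a * (1 - a) * (- b) \<le> D\<^sup>2"
      by (simp only: mult_1_right power2_eq_square)
    moreover have "\<bar>deriv f a * min b 0\<bar> = 6 * (a * (1 - a) * (- b))"
      using True by (simp add: deriv_f abs_mult)
    ultimately have "\<bar>deriv f a * min b 0\<bar> \<le> 6 * D\<^sup>2"
      by linarith
    also have "\<dots> \<le> 72 * D\<^sup>2" by simp
    finally show ?thesis by (simp add: D_def)
  qed (auto simp: deriv_f)
qed

section \<open>The Laplacian and its inverse\<close>

text \<open>Solvability of the Poisson equation is not needed: the essential supremum of a function that
  is not measurable is \<open>\<infinity>\<close>, so a finite operator norm alone yields the bound.\<close>

lemma inv_laplacian_bounded:
  assumes "inv_laplacian_norm X < \<infinity>"
  obtains C where "0 \<le> C" "\<And>g. g \<in> borel_measurable (torus X) \<Longrightarrow>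
    (\<And>x. \<bar>g x\<bar> \<le> 1) \<Longrightarrow> AE x in torus X. \<bar>inv_laplacian X g x\<bar> \<le> C"
proof -
  obtain C :: ereal where C: "0 \<le> C" "C < \<infinity>" "\<And>g. in_Linf (torus X) g \<Longrightarrow>
      Linf_norm (torus X) (inv_laplacian X g) \<le> C * Linf_norm (torus X) g"
    using assms unfolding inv_laplacian_norm_def Inf_less_iff by blast
  then obtain c where c: "C = ereal c" "0 \<le> c"
    by (cases C) auto
  show ?thesis
  proof (rule that[OF c(2)])
    fix g :: "'a \<Rightarrow> real" assume g: "g \<in> borel_measurable (torus X)" "\<And>x. \<bar>g x\<bar> \<le> 1"
    have L: "Linf_norm (torus X) g \<le> 1"
      unfolding Linf_norm_def using g by (intro esssup_I) (auto simp: one_ereal_def)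
    then have "in_Linf (torus X) g"
      using g(1) by (auto simp: in_Linf_def)
    from C(3)[OF this] have "Linf_norm (torus X) (inv_laplacian X g) \<le> C * Linf_norm (torus X) g" .
    also have "\<dots> \<le> C * 1"
      using L C(1) by (rule ereal_mult_left_mono)
    finally have "Linf_norm (torus X) (inv_laplacian X g) \<le> ereal c"
      using c by simp
    moreover have "AE x in torus X. ereal \<bar>inv_laplacian X g x\<bar> \<le> Linf_norm (torus X) (inv_laplacian X g)"
      unfolding Linf_norm_def by (rule esssup_AE)
    ultimately show "AE x in torus X. \<bar>inv_laplacian X g x\<bar> \<le> c"
      by (auto elim!: eventually_mono dest: order_trans)
  qed
qed

lemma Lp_norm_2: "(Lp_norm 2 M u)\<^sup>2 = (\<integral>x. (u x)\<^sup>2 \<partial>M)"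
  by (simp add: Lp_norm_def powr_half_sqrt)

lemma Lp_norm_4: "Lp_norm 4 M u ^ 4 = (\<integral>x. u x ^ 4 \<partial>M)"
proof -
  have "Lp_norm 4 M u ^ 4 = Lp_norm 4 M u powr 4"
    by (simp add: Lp_norm_def)
  then show ?thesis
    by (simp add: Lp_norm_def powr_powr)
qed

lemma in_H1_weak_partial:
  assumes "in_H1 X u" "b \<in> Basis"
  shows "sq_integrable (torus X) (weak_partial X b u)" "is_weak_partial X b u (weak_partial X b u)"
proof -
  have "\<exists>v. in_Lp 2 (torus X) v \<and> is_weak_partial X b u v"
    using assms by (auto simp: in_H1_def)
  from someI_ex[OF this] show "sq_integrable (torus X) (weak_partial X b u)"
    "is_weak_partial X b u (weak_partial X b u)"
    by (auto simp: weak_partial_def in_Lp_2_iff)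
qed

lemma in_H2_second_partial:
  assumes u: "in_H2 X u" and b: "b \<in> Basis"
  shows "sq_integrable (torus X) (weak_partial X b (weak_partial X b u))"
    and "\<And>\<eta>. smooth \<eta> \<Longrightarrow> periodic X \<eta> \<Longrightarrow>
      (\<integral>x. u x * partial_deriv b (partial_deriv b \<eta>) x \<partial>torus X) =
      (\<integral>x. weak_partial X b (weak_partial X b u) x * \<eta> x \<partial>torus X)"
proof -
  have 1: "is_weak_partial X b u (weak_partial X b u)"
    using in_H1_weak_partial[OF _ b] u by (simp add: in_H2_def)
  have H: "in_H1 X (weak_partial X b u)"
    using u b by (simp add: in_H2_def)
  show "sq_integrable (torus X) (weak_partial X b (weak_partial X b u))"
    by (rule in_H1_weak_partial[OF H b])
  fix \<eta> :: "'a \<Rightarrow> real" assume \<eta>: "smooth \<eta>" "periodic X \<eta>"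
  have "smooth (partial_deriv b \<eta>)" "periodic X (partial_deriv b \<eta>)"
    using \<eta> b smooth_partial_deriv periodic_partial_deriv smooth_differentiable by blast+
  then show "(\<integral>x. u x * partial_deriv b (partial_deriv b \<eta>) x \<partial>torus X) =
      (\<integral>x. weak_partial X b (weak_partial X b u) x * \<eta> x \<partial>torus X)"
    using 1 in_H1_weak_partial(2)[OF H b] \<eta> by (simp add: is_weak_partial_def)
qed

lemma laplacian_dissipation:
  fixes X :: "'a::euclidean_space"
  assumes X: "\<And>b. b \<in> Basis \<Longrightarrow> 0 < X \<bullet> b" and u: "in_H2 X u"
    and g: "mono g" "\<And>a b. \<bar>g a - g b\<bar> \<le> \<bar>a - b\<bar>" "g 0 = 0"
  shows "(\<integral>x. laplacian X u x * g (u x) \<partial>torus X) \<le> 0"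
proof -
  have su: "sq_integrable (torus X) u"
    using u by (simp add: in_H2_def in_H1_def in_Lp_2_iff)
  have "continuous_on UNIV g"
    by (rule lipschitz_on_continuous_on[of 1]) (use g(2) in \<open>auto simp: lipschitz_on_def dist_real_def\<close>)
  then have [measurable]: "g \<in> borel_measurable borel"
    by (rule borel_measurable_continuous_onI)
  have [measurable]: "u \<in> borel_measurable (torus X)"
    by (rule sq_integrable_measurable[OF su])
  have sg: "sq_integrable (torus X) (\<lambda>x. g (u x))"
    by (rule sq_integrable_dominated[OF su]) (use g(2)[of _ 0] g(3) in auto)
  have "(\<integral>x. laplacian X u x * g (u x) \<partial>torus X) =
      (\<Sum>b\<in>Basis. \<integral>x. weak_partial X b (weak_partial X b u) x * g (u x) \<partial>torus X)"
    unfolding laplacian_def sum_distrib_right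
    by (rule Bochner_Integration.integral_sum)
      (intro sq_integrable_mult sg in_H2_second_partial(1)[OF u])
  also have "\<dots> \<le> 0"
  proof (rule sum_nonpos)
    fix b :: 'a assume b: "b \<in> Basis"
    show "(\<integral>x. weak_partial X b (weak_partial X b u) x * g (u x) \<partial>torus X) \<le> 0"
      by (rule weak_dissipation[OF X b su in_H2_second_partial[OF u b] g])
  qed
  finally show ?thesis .
qed

lemma laplacian_L2_bound:
  fixes X :: "'a::euclidean_space"
  assumes u: "in_H2 X u"
  shows "sq_integrable (torus X) (laplacian X u)"
    and "(\<integral>x. (laplacian X u x)\<^sup>2 \<partial>torus X) \<le> real DIM('a) * (H2_norm X u)\<^sup>2"
proof -
  let ?v = "\<lambda>b. weak_partial X b (weak_partial X b u)"
  note sv = in_H2_second_partial(1)[OF u]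
  show s: "sq_integrable (torus X) (laplacian X u)"
    unfolding laplacian_def[abs_def] by (intro sq_integrable_sum sv)
  have "(\<integral>x. (laplacian X u x)\<^sup>2 \<partial>torus X) \<le>
      (\<integral>x. real DIM('a) * (\<Sum>b\<in>Basis. (?v b x)\<^sup>2) \<partial>torus X)"
  proof (rule integral_mono)
    show "(laplacian X u x)\<^sup>2 \<le> real DIM('a) * (\<Sum>b\<in>Basis. (?v b x)\<^sup>2)" for x
      using Cauchy_Schwarz_ineq_sum[of "\<lambda>_. 1" "\<lambda>b. ?v b x" Basis] by (simp add: laplacian_def)
  qed (use s sv in \<open>auto simp: sq_integrable_def\<close>)
  also have "\<dots> = real DIM('a) * (\<Sum>b\<in>Basis. (Lp_norm 2 (torus X) (?v b))\<^sup>2)"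
    using sv by (simp add: Lp_norm_2 sq_integrable_def Bochner_Integration.integral_sum)
  also have "(\<Sum>b\<in>Basis. (Lp_norm 2 (torus X) (?v b))\<^sup>2) \<le> (H2_norm X u)\<^sup>2"
  proof -
    have "(Lp_norm 2 (torus X) (?v b))\<^sup>2 \<le>
        (\<Sum>c\<in>Basis. (Lp_norm 2 (torus X) (weak_partial X c (weak_partial X b u)))\<^sup>2)" if "b \<in> Basis" for b
      using that by (intro member_le_sum) auto
    then have "(\<Sum>b\<in>Basis. (Lp_norm 2 (torus X) (?v b))\<^sup>2) \<le>
        (\<Sum>b\<in>Basis. \<Sum>c\<in>Basis. (Lp_norm 2 (torus X) (weak_partial X c (weak_partial X b u)))\<^sup>2)"
      by (rule sum_mono)
    also have "\<dots> \<le> (H2_norm X u)\<^sup>2"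
      by (simp add: H2_norm_def sum_nonneg)
    finally show ?thesis .
  qed
  finally show "(\<integral>x. (laplacian X u x)\<^sup>2 \<partial>torus X) \<le> real DIM('a) * (H2_norm X u)\<^sup>2"
    by (simp add: mult_left_mono)
qed

section \<open>Continuity of the solution in time\<close>

lemma power4_diff_le: "(a - b) ^ 4 \<le> 8 * a ^ 4 + 8 * (b::real) ^ 4"
proof -
  have sq: "(x - y)\<^sup>2 \<le> 2 * x\<^sup>2 + 2 * y\<^sup>2" for x y :: real
    using zero_le_power2[of "x + y"] by (simp add: power2_sum power2_diff)
  have "(a - b) ^ 4 = ((a - b)\<^sup>2)\<^sup>2"
    by (simp add: power2_eq_square power4_eq_xxxx)
  also have "\<dots> \<le> (2 * a\<^sup>2 - (- (2 * b\<^sup>2)))\<^sup>2"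
    using sq[of a b] by (intro power_mono) auto
  also have "\<dots> \<le> 2 * (2 * a\<^sup>2)\<^sup>2 + 2 * (- (2 * b\<^sup>2))\<^sup>2"
    by (rule sq)
  also have "\<dots> = 8 * a ^ 4 + 8 * b ^ 4"
    by (simp add: power2_eq_square power4_eq_xxxx)
  finally show ?thesis .
qed

lemma power4_minus_commute: "(a - b) ^ 4 = (b - (a::real)) ^ 4"
  by (simp add: power4_eq_xxxx algebra_simps)

lemma integrable_lebesgue_on_subset:
  fixes h :: "real \<Rightarrow> real"
  assumes "integrable (lebesgue_on {0<..<T}) h" "{a..b} \<subseteq> {0<..<T}"
  shows "integrable (lebesgue_on {a..b}) h"
proof -
  have "set_integrable lebesgue {0<..<T} h"
    using assms(1) by (simp add: set_integrable_def integrable_restrict_space)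
  then have "set_integrable lebesgue {a..b} h"
    by (rule set_integrable_subset) (use assms(2) in auto)
  then show ?thesis
    by (simp add: set_integrable_def integrable_restrict_space)
qed

lemma AE_lebesgue_on_subset:
  assumes "A \<subseteq> S" "A \<in> sets lebesgue" "S \<in> sets lebesgue" "AE x in lebesgue_on S. P x"
  shows "AE x in lebesgue_on A. P x"
  using assms by (auto simp: AE_restrict_space_iff elim!: eventually_mono)

lemma in_C_L2_L4:
  assumes c2: "in_C_Lp 2 T X \<phi>" and c4: "in_C_Lp 4 T X \<phi>" and s: "s \<in> {0..T}" and t: "t \<in> {0..T}"
  shows "sq_integrable (torus X) (\<phi> t)"
    and "integrable (torus X) (\<lambda>x. (\<phi> t x - \<phi> s x) ^ 4)"
    and "0 < e \<Longrightarrow> \<exists>d>0. \<forall>\<tau>\<in>{0..T}. \<bar>\<tau> - s\<bar> < d \<longrightarrow>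
      (\<integral>x. (\<phi> \<tau> x - \<phi> s x)\<^sup>2 \<partial>torus X) < e \<and> (\<integral>x. (\<phi> \<tau> x - \<phi> s x) ^ 4 \<partial>torus X) < e"
proof -
  have 2: "sq_integrable (torus X) (\<phi> \<tau>)" and 4: "integrable (torus X) (\<lambda>x. \<phi> \<tau> x ^ 4)"
    if "\<tau> \<in> {0..T}" for \<tau>
  proof -
    show "sq_integrable (torus X) (\<phi> \<tau>)"
      using c2 that by (simp add: in_C_Lp_def in_Lp_2_iff)
    show "integrable (torus X) (\<lambda>x. \<phi> \<tau> x ^ 4)"
      using c4 that by (simp add: in_C_Lp_def in_Lp_def)
  qed
  show "sq_integrable (torus X) (\<phi> t)"
    by (rule 2[OF t])
  show "integrable (torus X) (\<lambda>x. (\<phi> t x - \<phi> s x) ^ 4)"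
  proof (rule Bochner_Integration.integrable_bound)
    show "integrable (torus X) (\<lambda>x. 8 * \<phi> t x ^ 4 + 8 * \<phi> s x ^ 4)"
      using 4[OF t] 4[OF s] by simp
    show "(\<lambda>x. (\<phi> t x - \<phi> s x) ^ 4) \<in> borel_measurable (torus X)"
      using 2[OF t] 2[OF s] by (auto simp: sq_integrable_def)
    show "AE x in torus X. norm ((\<phi> t x - \<phi> s x) ^ 4) \<le> norm (8 * \<phi> t x ^ 4 + 8 * \<phi> s x ^ 4)"
      using power4_diff_le by (intro AE_I2) (simp add: abs_of_nonneg)
  qed
  assume e: "0 < e"
  define N where "N p \<tau> = Lp_norm p (torus X) (\<lambda>x. \<phi> \<tau> x - \<phi> s x)" for p \<tau>
  have N: "(N 2 \<longlongrightarrow> 0) (at s within {0..T})" "(N 4 \<longlongrightarrow> 0) (at s within {0..T})"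
    using c2 c4 s by (auto simp: in_C_Lp_def N_def[abs_def])
  have "\<forall>\<^sub>F \<tau> in at s within {0..T}. (N 2 \<tau>)\<^sup>2 < e" "\<forall>\<^sub>F \<tau> in at s within {0..T}. N 4 \<tau> ^ 4 < e"
    using order_tendstoD(2)[OF tendsto_power[OF N(1), of 2], of e]
      order_tendstoD(2)[OF tendsto_power[OF N(2), of 4], of e] e by auto
  then have "\<forall>\<^sub>F \<tau> in at s within {0..T}. (N 2 \<tau>)\<^sup>2 < e \<and> N 4 \<tau> ^ 4 < e"
    by (rule eventually_conj)
  then obtain d where d: "0 < d" "\<And>\<tau>. \<tau> \<in> {0..T} \<Longrightarrow> \<tau> \<noteq> s \<Longrightarrow> \<bar>\<tau> - s\<bar> < d \<Longrightarrow> (N 2 \<tau>)\<^sup>2 < e \<and> N 4 \<tau> ^ 4 < e"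
    unfolding eventually_at dist_real_def by blast
  have "(\<integral>x. (\<phi> \<tau> x - \<phi> s x)\<^sup>2 \<partial>torus X) < e \<and> (\<integral>x. (\<phi> \<tau> x - \<phi> s x) ^ 4 \<partial>torus X) < e"
    if "\<tau> \<in> {0..T}" "\<bar>\<tau> - s\<bar> < d" for \<tau>
    using d(2)[of \<tau>] that e by (cases "\<tau> = s") (simp_all add: N_def Lp_norm_2 Lp_norm_4)
  then show "\<exists>d>0. \<forall>\<tau>\<in>{0..T}. \<bar>\<tau> - s\<bar> < d \<longrightarrow>
      (\<integral>x. (\<phi> \<tau> x - \<phi> s x)\<^sup>2 \<partial>torus X) < e \<and> (\<integral>x. (\<phi> \<tau> x - \<phi> s x) ^ 4 \<partial>torus X) < e"
    using d(1) by blast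
qed

lemma weak_solution_regularity:
  assumes "global_weak_solution X \<epsilon> \<gamma> M \<omega> \<phi>0 \<phi>"
  shows "0 \<le> t \<Longrightarrow> sq_integrable (torus X) (\<phi> t)"
    and "0 \<le> t \<Longrightarrow> 0 \<le> s \<Longrightarrow> integrable (torus X) (\<lambda>x. (\<phi> t x - \<phi> s x) ^ 4)"
    and "0 \<le> s \<Longrightarrow> 0 < e \<Longrightarrow> \<exists>d>0. \<forall>\<tau>\<ge>0. \<bar>\<tau> - s\<bar> < d \<longrightarrow>
      (\<integral>x. (\<phi> \<tau> x - \<phi> s x)\<^sup>2 \<partial>torus X) < e \<and> (\<integral>x. (\<phi> \<tau> x - \<phi> s x) ^ 4 \<partial>torus X) < e"
proof -
  have C: "in_C_Lp 2 T X \<phi>" "in_C_Lp 4 T X \<phi>" if "0 < T" for T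
    using assms that by (auto simp: global_weak_solution_def)
  show "sq_integrable (torus X) (\<phi> t)" if "0 \<le> t"
    using in_C_L2_L4(1)[OF C, of "t + 1" t t] that by auto
  show "integrable (torus X) (\<lambda>x. (\<phi> t x - \<phi> s x) ^ 4)" if "0 \<le> t" "0 \<le> s"
    using in_C_L2_L4(2)[OF C, of "t + s + 1" s t] that by auto
  assume s: "0 \<le> s" and e: "0 < e"
  obtain d where d: "0 < d" "\<And>\<tau>. \<tau> \<in> {0..s + 1} \<Longrightarrow> \<bar>\<tau> - s\<bar> < d \<Longrightarrow>
      (\<integral>x. (\<phi> \<tau> x - \<phi> s x)\<^sup>2 \<partial>torus X) < e \<and> (\<integral>x. (\<phi> \<tau> x - \<phi> s x) ^ 4 \<partial>torus X) < e"
    using in_C_L2_L4(3)[OF C, of "s + 1" s s e] s e by auto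
  show "\<exists>d>0. \<forall>\<tau>\<ge>0. \<bar>\<tau> - s\<bar> < d \<longrightarrow>
      (\<integral>x. (\<phi> \<tau> x - \<phi> s x)\<^sup>2 \<partial>torus X) < e \<and> (\<integral>x. (\<phi> \<tau> x - \<phi> s x) ^ 4 \<partial>torus X) < e"
  proof (intro exI[of _ "min d 1"] conjI allI impI)
    fix \<tau> :: real assume "0 \<le> \<tau>" "\<bar>\<tau> - s\<bar> < min d 1"
    then have "\<tau> \<in> {0..s + 1}" "\<bar>\<tau> - s\<bar> < d" by auto
    from d(2)[OF this] show "(\<integral>x. (\<phi> \<tau> x - \<phi> s x)\<^sup>2 \<partial>torus X) < e"
      "(\<integral>x. (\<phi> \<tau> x - \<phi> s x) ^ 4 \<partial>torus X) < e" by auto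
  qed (use d(1) in simp)
qed

section \<open>The energy estimate\<close>

text \<open>A monotone 1-Lipschitz function vanishing on \<open>[0, 1]\<close> that detects the part of a function
  lying on one side of \<open>[0, 1]\<close>. The condition \<open>convex\<close> entails that \<open>g\<^sup>2 / 2\<close> lies above its tangents,
  with derivative \<open>g\<close>. The last two conditions bound the reaction terms evaluated at
  \<open>a\<close> and tested with the cutoff at a nearby value \<open>b\<close>; at \<open>a = b\<close> they say that
  these terms have the favourable sign, respectively vanish.\<close>

locale cutoff =
  fixes g :: "real \<Rightarrow> real"
  assumes mono: "mono g"
    and lipschitz: "\<bar>g a - g b\<bar> \<le> \<bar>a - b\<bar>"
    and vanishes: "0 \<le> a \<Longrightarrow> a \<le> 1 \<Longrightarrow> g a = 0"
    and convex: "g b * (g b - g a) \<le> g b * (b - a)"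
    and W_bound: "- (deriv W a * g b) \<le> 72 * ((a - b)\<^sup>2 + (a - b) ^ 4)"
    and f_bound: "\<bar>deriv f a * g b\<bar> \<le> 72 * (a - b)\<^sup>2"
begin

lemma g0: "g 0 = 0" "\<bar>g a\<bar> \<le> \<bar>a\<bar>"
  using vanishes[of 0] lipschitz[of a 0] by auto

lemma continuous: "continuous_on UNIV g"
  by (rule lipschitz_on_continuous_on[of 1]) (use lipschitz in \<open>auto simp: lipschitz_on_def dist_real_def\<close>)

lemma measurable[measurable]: "g \<in> borel_measurable borel"
  by (rule borel_measurable_continuous_onI[OF continuous])

lemma sq_integrable_cutoff:
  assumes "sq_integrable M u"
  shows "sq_integrable M (\<lambda>x. g (u x))"
proof (rule sq_integrable_dominated[OF assms])
  show "(\<lambda>x. g (u x)) \<in> borel_measurable M"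
    by (rule measurable_compose[OF sq_integrable_measurable[OF assms] measurable])
qed (use g0 in auto)

text \<open>The right-hand side at one time tested with the cutoff at another. The gap between the two
  only enters through the distance of the solutions; \<open>\<kappa>\<close> is the weight in Young's inequality for the
  diffusion term.\<close>

lemma rhs_tested_le:
  fixes X :: "'a::euclidean_space"
  assumes X: "\<And>b. b \<in> Basis \<Longrightarrow> 0 < X \<bullet> b"
    and pos: "0 < \<epsilon>" "0 < \<gamma>" "0 < M" and \<omega>: "0 < \<omega>" "\<omega> < 1"
    and u: "in_H2 X u" and v: "sq_integrable (torus X) v"
    and q4: "integrable (torus X) (\<lambda>x. (u x - v x) ^ 4)"
    and Cinv: "0 \<le> Cinv" "AE x in torus X. \<bar>inv_laplacian X (\<lambda>y. f (u y) - \<omega>) x\<bar> \<le> Cinv"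
    and rhs: "integrable (torus X) (\<lambda>x. pACOK_rhs X \<epsilon> \<gamma> M \<omega> u x * g (v x))"
    and \<kappa>: "0 < \<kappa>"
  shows "(\<integral>x. pACOK_rhs X \<epsilon> \<gamma> M \<omega> u x * g (v x) \<partial>torus X) \<le>
    \<epsilon> / 2 * (\<kappa> * (\<integral>x. (laplacian X u x)\<^sup>2 \<partial>torus X) + (\<integral>x. (u x - v x)\<^sup>2 \<partial>torus X) / \<kappa>) +
    72 * (1 / \<epsilon> + \<gamma> * Cinv + M * measure (torus X) (cbox (-X) X)) *
      ((\<integral>x. (u x - v x)\<^sup>2 \<partial>torus X) + (\<integral>x. (u x - v x) ^ 4 \<partial>torus X))"
proof -
  interpret finite_measure "torus X" by (rule finite_measure_torus)
  define L where "L = laplacian X u"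
  define w where "w x = g (v x)" for x
  define I where "I = (\<integral>y. (f (u y) - \<omega>) \<partial>torus X)"
  define V where "V = measure (torus X) (cbox (-X) X)"
  define U where "U = inv_laplacian X (\<lambda>y. f (u y) - \<omega>)"
  define K where "K = 72 * (1 / \<epsilon> + \<gamma> * Cinv + M * V)"
  define rest where "rest x = pACOK_rhs X \<epsilon> \<gamma> M \<omega> u x - \<epsilon> * L x" for x
  have su: "sq_integrable (torus X) u"
    using u by (simp add: in_H2_def in_H1_def in_Lp_2_iff)
  have sL: "sq_integrable (torus X) L"
    unfolding L_def by (rule laplacian_L2_bound(1)[OF u])
  have sw: "sq_integrable (torus X) w" and sgu: "sq_integrable (torus X) (\<lambda>x. g (u x))"
    unfolding w_def[abs_def] using sq_integrable_cutoff su v by blast+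
  have sd: "sq_integrable (torus X) (\<lambda>x. u x - v x)"
    by (rule sq_integrable_diff[OF su v])
  have sdw: "sq_integrable (torus X) (\<lambda>x. w x - g (u x))"
    by (rule sq_integrable_diff[OF sw sgu])
  have I: "\<bar>I\<bar> \<le> V"
  proof -
    have [measurable]: "u \<in> borel_measurable (torus X)" "f \<in> borel_measurable borel"
      using sq_integrable_measurable[OF su] measurable_f by auto
    have b: "\<bar>f s - \<omega>\<bar> \<le> 1" for s
      using f_bounds[of s] \<omega> by (simp add: abs_le_iff)
    then have "sq_integrable (torus X) (\<lambda>y. f (u y) - \<omega>)"
      by (intro sq_integrable_bounded[OF finite_measure_torus, where B = 1]) auto
    then have i: "integrable (torus X) (\<lambda>y. f (u y) - \<omega>)"
      by (rule sq_integrable_imp_integrable[OF finite_measure_torus])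
    have "\<bar>I\<bar> \<le> (\<integral>y. \<bar>f (u y) - \<omega>\<bar> \<partial>torus X)"
      by (simp add: I_def)
    also have "\<dots> \<le> (\<integral>y. 1 \<partial>torus X)"
      using i b by (intro integral_mono) auto
    finally have "\<bar>I\<bar> \<le> measure (torus X) (space (torus X))"
      by simp
    then show ?thesis by (simp add: V_def)
  qed
  \<comment> \<open>tested with \<open>g(u)\<close> itself the diffusion term is dissipative; the rest is estimated by Young's
    inequality\<close>
  have diffusion: "(\<integral>x. L x * w x \<partial>torus X) \<le>
      1 / 2 * (\<kappa> * (\<integral>x. (L x)\<^sup>2 \<partial>torus X) + (\<integral>x. (u x - v x)\<^sup>2 \<partial>torus X) / \<kappa>)"
  proof -
    have "(\<integral>x. L x * w x \<partial>torus X) =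
        (\<integral>x. L x * g (u x) \<partial>torus X) + (\<integral>x. L x * (w x - g (u x)) \<partial>torus X)"
      using sq_integrable_mult[OF sL sw] sq_integrable_mult[OF sL sgu]
      by (simp add: right_diff_distrib)
    also have "\<dots> \<le> (\<integral>x. L x * (w x - g (u x)) \<partial>torus X)"
      using laplacian_dissipation[OF X u mono lipschitz g0(1)] by (simp add: L_def)
    also have "\<dots> \<le> (\<integral>x. \<kappa> / 2 * (L x)\<^sup>2 + 1 / (2 * \<kappa>) * (u x - v x)\<^sup>2 \<partial>torus X)"
    proof (rule integral_mono)
      fix x
      have "2 * (\<kappa> * L x) * (w x - g (u x)) \<le> (\<kappa> * L x)\<^sup>2 + (w x - g (u x))\<^sup>2"
        by (rule sum_squares_bound)
      also have "(w x - g (u x))\<^sup>2 \<le> (u x - v x)\<^sup>2"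
        using lipschitz[of "v x" "u x"] by (simp add: w_def abs_le_square_iff power2_commute)
      finally show "L x * (w x - g (u x)) \<le> \<kappa> / 2 * (L x)\<^sup>2 + 1 / (2 * \<kappa>) * (u x - v x)\<^sup>2"
        using \<kappa> by (simp add: field_simps power2_eq_square)
    qed (use sq_integrable_mult[OF sL sdw] sL sd in \<open>auto simp: sq_integrable_def\<close>)
    also have "\<dots> = 1 / 2 * (\<kappa> * (\<integral>x. (L x)\<^sup>2 \<partial>torus X) + (\<integral>x. (u x - v x)\<^sup>2 \<partial>torus X) / \<kappa>)"
      using sL sd by (simp add: sq_integrable_def field_simps)
    finally show ?thesis .
  qed
  have iLw: "integrable (torus X) (\<lambda>x. L x * w x)"
    by (rule sq_integrable_mult[OF sL sw])
  have rest_eq: "rest x * w x = pACOK_rhs X \<epsilon> \<gamma> M \<omega> u x * g (v x) - \<epsilon> * (L x * w x)" for x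
    by (simp add: rest_def w_def algebra_simps)
  have irest: "integrable (torus X) (\<lambda>x. rest x * w x)"
    unfolding rest_eq using rhs iLw by simp
  have "(\<integral>x. rest x * w x \<partial>torus X) \<le> (\<integral>x. K * ((u x - v x)\<^sup>2 + (u x - v x) ^ 4) \<partial>torus X)"
  proof (rule integral_mono_AE[OF irest])
    show "AE x in torus X. rest x * w x \<le> K * ((u x - v x)\<^sup>2 + (u x - v x) ^ 4)"
      using Cinv(2)
    proof eventually_elim
      case (elim x)
      define D where "D = (u x - v x)\<^sup>2 + (u x - v x) ^ 4"
      have "(u x - v x)\<^sup>2 \<le> D" by (simp add: D_def)
      then have fw: "\<bar>deriv f (u x) * w x\<bar> \<le> 72 * D"
        using f_bound[of "u x" "v x"] by (simp add: w_def)
      have "1 / \<epsilon> * (- (deriv W (u x) * w x)) \<le> 1 / \<epsilon> * (72 * D)"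
        using W_bound[of "u x" "v x"] pos by (intro mult_left_mono) (auto simp: w_def D_def)
      moreover have "- (\<gamma> * U x * (deriv f (u x) * w x)) \<le> \<gamma> * Cinv * (72 * D)"
      proof -
        have "- (\<gamma> * U x * (deriv f (u x) * w x)) \<le> \<bar>\<gamma> * U x * (deriv f (u x) * w x)\<bar>"
          by simp
        also have "\<dots> = \<gamma> * \<bar>U x\<bar> * \<bar>deriv f (u x) * w x\<bar>"
          using pos by (simp add: abs_mult)
        also have "\<dots> \<le> \<gamma> * Cinv * (72 * D)"
          using pos elim fw Cinv(1) by (intro mult_mono) (auto simp: U_def)
        finally show ?thesis .
      qed
      moreover have "- (M * I * (deriv f (u x) * w x)) \<le> M * V * (72 * D)"
      proof -
        have "- (M * I * (deriv f (u x) * w x)) \<le> \<bar>M * I * (deriv f (u x) * w x)\<bar>"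
          by simp
        also have "\<dots> = M * \<bar>I\<bar> * \<bar>deriv f (u x) * w x\<bar>"
          using pos by (simp add: abs_mult)
        also have "\<dots> \<le> M * V * (72 * D)"
          using pos I fw by (intro mult_mono) auto
        finally show ?thesis .
      qed
      moreover have "rest x * w x = 1 / \<epsilon> * (- (deriv W (u x) * w x)) +
          (- (\<gamma> * U x * (deriv f (u x) * w x))) + (- (M * I * (deriv f (u x) * w x)))"
        by (simp add: rest_def pACOK_rhs_def L_def U_def I_def algebra_simps)
      moreover have "K * D = 1 / \<epsilon> * (72 * D) + \<gamma> * Cinv * (72 * D) + M * V * (72 * D)"
        by (simp add: K_def algebra_simps)
      ultimately show ?case
        unfolding D_def[symmetric] by linarith
    qed
  qed (use sd q4 in \<open>auto simp: sq_integrable_def\<close>)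
  also have "\<dots> = K * ((\<integral>x. (u x - v x)\<^sup>2 \<partial>torus X) + (\<integral>x. (u x - v x) ^ 4 \<partial>torus X))"
    using sd q4 by (simp add: sq_integrable_def)
  finally have reaction: "(\<integral>x. rest x * w x \<partial>torus X) \<le>
      K * ((\<integral>x. (u x - v x)\<^sup>2 \<partial>torus X) + (\<integral>x. (u x - v x) ^ 4 \<partial>torus X))" .
  have "(\<integral>x. pACOK_rhs X \<epsilon> \<gamma> M \<omega> u x * g (v x) \<partial>torus X) =
      \<epsilon> * (\<integral>x. L x * w x \<partial>torus X) + (\<integral>x. rest x * w x \<partial>torus X)"
    unfolding rest_eq using rhs iLw by simp
  moreover have "\<epsilon> * (\<integral>x. L x * w x \<partial>torus X) \<le>
      \<epsilon> / 2 * (\<kappa> * (\<integral>x. (L x)\<^sup>2 \<partial>torus X) + (\<integral>x. (u x - v x)\<^sup>2 \<partial>torus X) / \<kappa>)"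
    using mult_left_mono[OF diffusion less_imp_le[OF pos(1)]] by simp
  ultimately show ?thesis
    using reaction unfolding L_def K_def V_def by linarith
qed

text \<open>A function obeying the cutoff at time zero keeps obeying it: the squared norm of the cutoff
  is nonincreasing. Its increment over \<open>[s, t]\<close> is, by convexity, at most the increment of the
  solution tested with the cutoff at time \<open>t\<close>, a fixed function, so that the weak formulation
  applies. On sufficiently short intervals the result is at most an arbitrarily small multiple \<open>\<kappa>\<close> of
  the integral of the fixed function \<open>B\<close>, and this bound is additive in the interval.\<close>

proposition cutoff_of_solution_eq_0:
  fixes X :: "'a::euclidean_space"
  assumes X: "\<And>b. b \<in> Basis \<Longrightarrow> 0 < X \<bullet> b"
    and pos: "0 < \<epsilon>" "0 < \<gamma>" "0 < M" and \<omega>: "0 < \<omega>" "\<omega> < 1"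
    and sol: "global_weak_solution X \<epsilon> \<gamma> M \<omega> \<phi>0 \<phi>"
    and fin: "inv_laplacian_norm X < \<infinity>"
    and init: "AE x in torus X. 0 \<le> \<phi>0 x \<and> \<phi>0 x \<le> 1"
    and t: "0 < t"
  shows "AE x in torus X. g (\<phi> t x) = 0"
proof -
  interpret finite_measure "torus X" by (rule finite_measure_torus)
  note reg = weak_solution_regularity[OF sol]
  define Q2 Q4 where "Q2 s t = (\<integral>x. (\<phi> s x - \<phi> t x)\<^sup>2 \<partial>torus X)"
    and "Q4 s t = (\<integral>x. (\<phi> s x - \<phi> t x) ^ 4 \<partial>torus X)" for s t
  define \<Phi> where "\<Phi> t = (\<integral>x. (g (\<phi> t x))\<^sup>2 / 2 \<partial>torus X)" for t
  define T where "T = t + 1"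
  have T: "0 < T" "t < T"
    using t by (simp_all add: T_def)
  obtain Cinv where Cinv: "0 \<le> Cinv" "\<And>h. h \<in> borel_measurable (torus X) \<Longrightarrow>
      (\<And>x. \<bar>h x\<bar> \<le> 1) \<Longrightarrow> AE x in torus X. \<bar>inv_laplacian X h x\<bar> \<le> Cinv"
    using inv_laplacian_bounded[OF fin] by blast
  define K where "K = 72 * (1 / \<epsilon> + \<gamma> * Cinv + M * measure (torus X) (cbox (-X) X))"
  have K: "0 \<le> K"
    using pos Cinv by (simp add: K_def)
  define B where "B \<tau> = \<epsilon> / 2 * (real DIM('a) * (H2_norm X (\<phi> \<tau>))\<^sup>2 + 1) + 2 * K" for \<tau>
  have H2: "AE \<tau> in lebesgue_on {0<..<T}. in_H2 X (\<phi> \<tau>)"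
    "integrable (lebesgue_on {0<..<T}) (\<lambda>\<tau>. (H2_norm X (\<phi> \<tau>))\<^sup>2)"
    using sol T by (auto simp: global_weak_solution_def in_L2_H2_def in_Lp_2_iff sq_integrable_def)
  have B: "integrable (lebesgue_on {a..b}) B" if "0 < a" "b < T" for a b
  proof -
    have "{a..b} \<subseteq> {0<..<T}" using that by auto
    then have "integrable (lebesgue_on {a..b}) (\<lambda>\<tau>. (H2_norm X (\<phi> \<tau>))\<^sup>2)"
      using H2(2) integrable_lebesgue_on_subset by blast
    moreover have "integrable (lebesgue_on {a..b}) (\<lambda>\<tau>. c)" for c :: real
      by (rule continuous_imp_integrable_real) simp
    ultimately show ?thesis
      unfolding B_def by (intro Bochner_Integration.integrable_add integrable_mult_right) auto
  qed
  have B0: "0 \<le> B \<tau>" for \<tau>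
    using pos K by (simp add: B_def)
  have sg: "sq_integrable (torus X) (\<lambda>x. g (\<phi> \<tau> x))" if "0 \<le> \<tau>" for \<tau>
    using sq_integrable_cutoff reg(1) that by blast
  have rhs_le: "AE \<tau> in lebesgue_on {0<..<T}. Q2 \<tau> b \<le> \<kappa>\<^sup>2 \<longrightarrow> Q4 \<tau> b \<le> \<kappa> \<longrightarrow>
      (\<integral>x. pACOK_rhs X \<epsilon> \<gamma> M \<omega> (\<phi> \<tau>) x * g (\<phi> b x) \<partial>torus X) \<le> \<kappa> * B \<tau>"
    if b: "0 \<le> b" and \<kappa>: "0 < \<kappa>" "\<kappa> \<le> 1" for b \<kappa>
  proof -
    have "AE \<tau> in lebesgue_on {0<..<T}.
        integrable (torus X) (\<lambda>x. pACOK_rhs X \<epsilon> \<gamma> M \<omega> (\<phi> \<tau>) x * g (\<phi> b x))"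
      using sol T sg[OF b] by (auto simp: global_weak_solution_def in_Lp_2_iff)
    moreover have "AE \<tau> in lebesgue_on {0<..<T}. 0 < \<tau>"
      by (rule AE_I2) simp
    ultimately show ?thesis
      using H2(1)
    proof (eventually_elim, intro impI)
      case (elim \<tau>)
      assume Q: "Q2 \<tau> b \<le> \<kappa>\<^sup>2" "Q4 \<tau> b \<le> \<kappa>"
      have "(\<lambda>y. f (\<phi> \<tau> y) - \<omega>) \<in> borel_measurable (torus X)"
        using measurable_compose[OF sq_integrable_measurable[OF reg(1)] measurable_f, of \<tau>] elim by simp
      moreover have "\<bar>f (\<phi> \<tau> y) - \<omega>\<bar> \<le> 1" for y
        using f_bounds[of "\<phi> \<tau> y"] \<omega> by (simp add: abs_le_iff)
      ultimately have inv: "AE x in torus X. \<bar>inv_laplacian X (\<lambda>y. f (\<phi> \<tau> y) - \<omega>) x\<bar> \<le> Cinv"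
        by (rule Cinv(2))
      have "(\<integral>x. pACOK_rhs X \<epsilon> \<gamma> M \<omega> (\<phi> \<tau>) x * g (\<phi> b x) \<partial>torus X) \<le>
          \<epsilon> / 2 * (\<kappa> * (\<integral>x. (laplacian X (\<phi> \<tau>) x)\<^sup>2 \<partial>torus X) + Q2 \<tau> b / \<kappa>) + K * (Q2 \<tau> b + Q4 \<tau> b)"
        unfolding Q2_def Q4_def K_def using elim b
        by (intro rhs_tested_le[OF X pos \<omega> _ reg(1) reg(2) Cinv(1) inv _ \<kappa>(1)]) auto
      also have "\<dots> \<le> \<epsilon> / 2 * (\<kappa> * (real DIM('a) * (H2_norm X (\<phi> \<tau>))\<^sup>2) + \<kappa>) + K * (\<kappa> + \<kappa>)"
      proof (intro add_mono mult_left_mono laplacian_L2_bound(2))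
        show "Q2 \<tau> b / \<kappa> \<le> \<kappa>"
          using Q(1) \<kappa> by (simp add: divide_le_eq power2_eq_square)
        have "\<kappa>\<^sup>2 \<le> \<kappa>"
          using \<kappa> by (simp add: power2_eq_square mult_le_cancel_left1)
        then show "Q2 \<tau> b \<le> \<kappa>"
          using Q(1) by linarith
      qed (use Q \<kappa> pos K elim in auto)
      also have "\<dots> = \<kappa> * B \<tau>"
        by (simp add: B_def algebra_simps)
      finally show "(\<integral>x. pACOK_rhs X \<epsilon> \<gamma> M \<omega> (\<phi> \<tau>) x * g (\<phi> b x) \<partial>torus X) \<le> \<kappa> * B \<tau>" .
    qed
  qed
  have increment: "\<Phi> b - \<Phi> a \<le> \<kappa> * integral {a..b} B"
    if ab: "0 < a" "a < b" "b < T" and \<kappa>: "0 < \<kappa>" "\<kappa> \<le> 1"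
      and Q: "\<And>\<tau>. a \<le> \<tau> \<Longrightarrow> \<tau> \<le> b \<Longrightarrow> Q2 \<tau> b \<le> \<kappa>\<^sup>2 \<and> Q4 \<tau> b \<le> \<kappa>" for a b \<kappa>
  proof -
    define w where "w x = g (\<phi> b x)" for x
    have sw: "sq_integrable (torus X) w"
      unfolding w_def using sg ab by simp
    define A where "A \<tau> = (\<integral>x. \<phi> \<tau> x * w x \<partial>torus X)" for \<tau>
    define R where "R \<tau> = (\<integral>x. pACOK_rhs X \<epsilon> \<gamma> M \<omega> (\<phi> \<tau>) x * w x \<partial>torus X)" for \<tau>
    have A_diff: "A \<tau> - A \<sigma> = (\<integral>x. (\<phi> \<tau> x - \<phi> \<sigma> x) * w x \<partial>torus X)" if "0 \<le> \<tau>" "0 \<le> \<sigma>" for \<tau> \<sigma>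
      using sq_integrable_mult[OF reg(1) sw] that by (simp add: A_def left_diff_distrib)
    have "continuous_on {0<..<T} A"
    proof (rule continuous_onI)
      fix s e :: real assume s: "s \<in> {0<..<T}" and "0 < e"
      define W where "W = sqrt (\<integral>x. (w x)\<^sup>2 \<partial>torus X) + 1"
      have W: "0 < W" by (simp add: W_def add_nonneg_pos)
      obtain d where d: "0 < d" "\<And>\<tau>. 0 \<le> \<tau> \<Longrightarrow> \<bar>\<tau> - s\<bar> < d \<Longrightarrow> Q2 \<tau> s < (e / W)\<^sup>2"
        using reg(3)[of s "(e / W)\<^sup>2"] s \<open>0 < e\<close> W unfolding Q2_def by auto
      have "dist (A \<tau>) (A s) \<le> e" if "\<tau> \<in> {0<..<T}" "dist \<tau> s < d" for \<tau>
      proof -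
        have \<tau>: "0 \<le> \<tau>" "0 \<le> s" using that s by auto
        have "\<bar>A \<tau> - A s\<bar> \<le> sqrt (Q2 \<tau> s) * sqrt (\<integral>x. (w x)\<^sup>2 \<partial>torus X)"
          unfolding A_diff[OF \<tau>] Q2_def
          by (intro Cauchy_Schwarz_integral sq_integrable_diff reg(1) \<tau> sw)
        also have "\<dots> \<le> (e / W) * W"
        proof (rule mult_mono)
          have "Q2 \<tau> s < (e / W)\<^sup>2"
            using d(2)[of \<tau>] that \<tau> by (simp add: dist_real_def)
          then show "sqrt (Q2 \<tau> s) \<le> e / W"
            using \<open>0 < e\<close> W by (intro real_le_lsqrt) (auto simp: less_imp_le)
        qed (use \<open>0 < e\<close> W in \<open>auto simp: W_def\<close>)
        also have "\<dots> = e" using W by simp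
        finally show ?thesis by (simp add: dist_real_def)
      qed
      then show "\<exists>d>0. \<forall>\<tau>\<in>{0<..<T}. dist \<tau> s < d \<longrightarrow> dist (A \<tau>) (A s) \<le> e"
        using d(1) by blast
    qed
    moreover have "distr_deriv T A R"
      using sol T sw unfolding A_def R_def by (auto simp: global_weak_solution_def in_Lp_2_iff)
    ultimately have AR: "integrable (lebesgue_on {a..b}) R"
      "A b - A a = (\<integral>\<tau>. R \<tau> \<partial>lebesgue_on {a..b})"
      using distr_deriv_integral ab by blast+
    have "\<Phi> b - \<Phi> a = (\<integral>x. (g (\<phi> b x))\<^sup>2 / 2 - (g (\<phi> a x))\<^sup>2 / 2 \<partial>torus X)"
      using sg[of a] sg[of b] ab by (simp add: \<Phi>_def sq_integrable_def)
    also have "\<dots> \<le> (\<integral>x. (\<phi> b x - \<phi> a x) * w x \<partial>torus X)"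
    proof (rule integral_mono)
      fix x
      have "0 \<le> (g (\<phi> b x) - g (\<phi> a x))\<^sup>2" by simp
      then show "(g (\<phi> b x))\<^sup>2 / 2 - (g (\<phi> a x))\<^sup>2 / 2 \<le> (\<phi> b x - \<phi> a x) * w x"
        using convex[of "\<phi> b x" "\<phi> a x"] by (simp add: w_def power2_eq_square algebra_simps)
    next
      show "integrable (torus X) (\<lambda>x. (\<phi> b x - \<phi> a x) * w x)"
        using ab by (intro sq_integrable_mult sq_integrable_diff reg(1) sw) auto
    qed (use sg[of a] sg[of b] ab in \<open>auto simp: sq_integrable_def\<close>)
    also have "\<dots> = (\<integral>\<tau>. R \<tau> \<partial>lebesgue_on {a..b})"
      using A_diff[of b a] AR(2) ab by simp
    also have "\<dots> \<le> (\<integral>\<tau>. \<kappa> * B \<tau> \<partial>lebesgue_on {a..b})"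
    proof (rule integral_mono_AE[OF AR(1)])
      have "AE \<tau> in lebesgue_on {a..b}. Q2 \<tau> b \<le> \<kappa>\<^sup>2 \<longrightarrow> Q4 \<tau> b \<le> \<kappa> \<longrightarrow> R \<tau> \<le> \<kappa> * B \<tau>"
        using rhs_le[of b \<kappa>] ab \<kappa> unfolding R_def w_def by (intro AE_lebesgue_on_subset[of "{a..b}" "{0<..<T}"]) auto
      moreover have "AE \<tau> in lebesgue_on {a..b}. Q2 \<tau> b \<le> \<kappa>\<^sup>2 \<and> Q4 \<tau> b \<le> \<kappa>"
        using Q by (intro AE_I2) auto
      ultimately show "AE \<tau> in lebesgue_on {a..b}. R \<tau> \<le> \<kappa> * B \<tau>"
        by eventually_elim blast
    qed (use B ab in auto)
    also have "\<dots> = \<kappa> * integral {a..b} B"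
      using B[of a b] ab by (simp add: lebesgue_integral_eq_integral)
    finally show ?thesis .
  qed
  have B_int: "B integrable_on {a..b}" if "0 < a" "b < T" for a b
    using B[OF that] by (rule integrable_on_lebesgue_on) simp
  have monotone: "\<Phi> t - \<Phi> s \<le> \<kappa> * integral {s..t} B" if s: "0 < s" "s \<le> t" and \<kappa>: "0 < \<kappa>" "\<kappa> \<le> 1" for s \<kappa>
  proof -
    have "0 < s \<and> t < T \<longrightarrow> \<Phi> t - \<Phi> s \<le> \<kappa> * integral {s..t} B"
      using s(2)
    proof (induction rule: Bolzano)
      case (trans a b c)
      show ?case
      proof (intro impI, elim conjE)
        assume "0 < a" "c < T"
        then have "\<Phi> b - \<Phi> a \<le> \<kappa> * integral {a..b} B" "\<Phi> c - \<Phi> b \<le> \<kappa> * integral {b..c} B"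
          using trans by auto
        moreover have "integral {a..b} B + integral {b..c} B = integral {a..c} B"
          using trans B_int[of a c] \<open>0 < a\<close> \<open>c < T\<close> by (intro Henstock_Kurzweil_Integration.integral_combine) auto
        then have "\<kappa> * integral {a..b} B + \<kappa> * integral {b..c} B = \<kappa> * integral {a..c} B"
          by (metis distrib_left)
        ultimately show "\<Phi> c - \<Phi> a \<le> \<kappa> * integral {a..c} B"
          by linarith
      qed
    next
      case (local x)
      \<comment> \<open>small enough to absorb the factors 2 and 8 lost in passing through \<open>x\<close>\<close>
      define e where "e = \<kappa>\<^sup>2 / 16"
      have e: "0 < e" using \<kappa> by (simp add: e_def)
      obtain d where d: "0 < d" "\<And>\<tau>. 0 \<le> \<tau> \<Longrightarrow> \<bar>\<tau> - x\<bar> < d \<Longrightarrow> Q2 \<tau> x < e \<and> Q4 \<tau> x < e"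
        using reg(3)[of x e] local s e unfolding Q2_def Q4_def by auto
      have "\<Phi> b - \<Phi> a \<le> \<kappa> * integral {a..b} B"
        if ab: "a \<le> x" "x \<le> b" "b - a < d" "0 < a" "b < T" for a b
      proof (cases "a = b")
        case False
        have "Q2 \<tau> b \<le> \<kappa>\<^sup>2 \<and> Q4 \<tau> b \<le> \<kappa>" if "a \<le> \<tau>" "\<tau> \<le> b" for \<tau>
        proof -
          have nn: "0 \<le> \<tau>" "0 \<le> b" "0 \<le> x"
            using ab that by auto
          have "\<bar>\<tau> - x\<bar> < d" "\<bar>b - x\<bar> < d"
            using ab that by auto
          then have lt: "Q2 \<tau> x < e" "Q4 \<tau> x < e" "Q2 b x < e" "Q4 b x < e"
            using d(2) nn by auto
          have "Q2 \<tau> b \<le> 2 * Q2 \<tau> x + 2 * Q2 b x"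
            using integral_sq_add_le[OF sq_integrable_diff[OF reg(1)[OF nn(1)] reg(1)[OF nn(3)]]
                sq_integrable_diff[OF reg(1)[OF nn(3)] reg(1)[OF nn(2)]]]
            by (simp add: Q2_def power2_commute[of "\<phi> x _" "\<phi> b _"])
          moreover have "Q4 \<tau> b \<le> 8 * Q4 \<tau> x + 8 * Q4 b x"
          proof -
            have "Q4 \<tau> b \<le> (\<integral>y. 8 * (\<phi> \<tau> y - \<phi> x y) ^ 4 + 8 * (\<phi> b y - \<phi> x y) ^ 4 \<partial>torus X)"
              unfolding Q4_def
            proof (rule integral_mono)
              show "(\<phi> \<tau> y - \<phi> b y) ^ 4 \<le> 8 * (\<phi> \<tau> y - \<phi> x y) ^ 4 + 8 * (\<phi> b y - \<phi> x y) ^ 4" for y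
                using power4_diff_le[of "\<phi> \<tau> y - \<phi> x y" "\<phi> b y - \<phi> x y"] by simp
            qed (use reg(2) nn in auto)
            also have "\<dots> = 8 * Q4 \<tau> x + 8 * Q4 b x"
              using reg(2) nn by (simp add: Q4_def)
            finally show ?thesis .
          qed
          moreover have "\<kappa>\<^sup>2 \<le> \<kappa>"
            using \<kappa> by (simp add: power2_eq_square mult_le_cancel_left1)
          ultimately show ?thesis
            using lt zero_le_power2[of \<kappa>] unfolding e_def by linarith
        qed
        then show ?thesis
          using ab False \<kappa> by (intro increment) auto
      qed simp
      then show ?case
        using d(1) by blast
    qed
    then show ?thesis
      using s T by simp
  qed
  have decr: "\<Phi> t \<le> \<Phi> s" if s: "0 < s" "s \<le> t" for s
  proof (rule field_le_epsilon)
    fix e :: real assume "0 < e"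
    define J where "J = integral {s..t} B"
    have J: "0 \<le> J"
      unfolding J_def using B_int[of s t] s T B0 by (intro integral_nonneg) auto
    define \<kappa> where "\<kappa> = min 1 (e / (J + 1))"
    have \<kappa>: "0 < \<kappa>" "\<kappa> \<le> 1"
      using \<open>0 < e\<close> J by (auto simp: \<kappa>_def)
    have "\<kappa> * J \<le> e / (J + 1) * J"
      using J by (intro mult_right_mono) (auto simp: \<kappa>_def)
    also have "\<dots> \<le> e"
      using J \<open>0 < e\<close> by (simp add: field_simps)
    finally show "\<Phi> t \<le> \<Phi> s + e"
      using monotone[OF s \<kappa>] by (simp add: J_def)
  qed
  have "\<Phi> t \<le> 0"
  proof (rule field_le_epsilon)
    fix e :: real assume "0 < e"
    obtain d where d: "0 < d" "\<And>\<tau>. 0 \<le> \<tau> \<Longrightarrow> \<bar>\<tau> - 0\<bar> < d \<Longrightarrow> Q2 \<tau> 0 < e"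
      using reg(3)[of 0 e] \<open>0 < e\<close> unfolding Q2_def by auto
    define s where "s = min t (d / 2)"
    have s: "0 < s" "s \<le> t" "Q2 s 0 < e"
      using t d(1) d(2)[of "min t (d / 2)"] by (auto simp: s_def)
    have zero: "AE x in torus X. g (\<phi> 0 x) = 0"
    proof -
      have "AE x in torus X. \<phi> 0 x = \<phi>0 x"
        using sol by (simp add: global_weak_solution_def)
      then show ?thesis
        using init by eventually_elim (simp add: vanishes)
    qed
    have "\<Phi> s \<le> Q2 s 0"
      unfolding \<Phi>_def Q2_def
    proof (rule integral_mono_AE)
      show "AE x in torus X. (g (\<phi> s x))\<^sup>2 / 2 \<le> (\<phi> s x - \<phi> 0 x)\<^sup>2"
        using zero
      proof eventually_elim
        case (elim x)
        then have "(g (\<phi> s x))\<^sup>2 \<le> (\<phi> s x - \<phi> 0 x)\<^sup>2"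
          using lipschitz[of "\<phi> s x" "\<phi> 0 x"] by (simp add: abs_le_square_iff)
        moreover have "0 \<le> (g (\<phi> s x))\<^sup>2" by simp
        ultimately show ?case by linarith
      qed
    qed (use sg[of s] sq_integrable_diff[OF reg(1)[of s] reg(1)[of 0]] s in \<open>auto simp: sq_integrable_def\<close>)
    then show "\<Phi> t \<le> 0 + e"
      using decr[OF s(1,2)] s(3) by simp
  qed
  moreover have "0 \<le> (\<integral>x. (g (\<phi> t x))\<^sup>2 \<partial>torus X)"
    by simp
  ultimately have "(\<integral>x. (g (\<phi> t x))\<^sup>2 \<partial>torus X) = 0"
    by (simp add: \<Phi>_def)
  moreover have "integrable (torus X) (\<lambda>x. (g (\<phi> t x))\<^sup>2)"
    using sg[of t] t by (simp add: sq_integrable_def)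
  ultimately show ?thesis
    using integral_nonneg_eq_0_iff_AE[of "torus X" "\<lambda>x. (g (\<phi> t x))\<^sup>2"] by simp
qed

end

section \<open>The maximum principle\<close>

text \<open>Since \<open>W'\<close> is odd and \<open>f'\<close> is even about \<open>1/2\<close>, the reflection \<open>s \<mapsto> 1 - s\<close> turns a cutoff for
  the lower bound into one for the upper bound.\<close>

lemma reflect_cutoff:
  assumes "cutoff g"
  shows "cutoff (\<lambda>s. - g (1 - s))"
proof -
  interpret cutoff g by fact
  show ?thesis
  proof
    show "mono (\<lambda>s. - g (1 - s))"
      by (auto simp: mono_def intro: monoD[OF mono])
  next
    fix a b :: real
    show "\<bar>- g (1 - a) - - g (1 - b)\<bar> \<le> \<bar>a - b\<bar>"
      using lipschitz[of "1 - b" "1 - a"] by simp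
    show "- g (1 - b) * (- g (1 - b) - - g (1 - a)) \<le> - g (1 - b) * (b - a)"
      using convex[of "1 - b" "1 - a"] by (simp add: algebra_simps)
    show "- (deriv W a * - g (1 - b)) \<le> 72 * ((a - b)\<^sup>2 + (a - b) ^ 4)"
      using W_bound[of "1 - a" "1 - b"]
      by (simp add: deriv_W_reflect power2_commute[of b] power4_minus_commute[of b])
    show "\<bar>deriv f a * - g (1 - b)\<bar> \<le> 72 * (a - b)\<^sup>2"
      using f_bound[of "1 - a" "1 - b"] by (simp add: deriv_f_reflect power2_commute[of b] abs_mult)
  next
    fix a :: real assume "0 \<le> a" "a \<le> 1"
    then show "- g (1 - a) = 0"
      using vanishes[of "1 - a"] by simp
  qed
qed

lemma min_cutoff: "cutoff (\<lambda>s. min s 0)"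
proof
  show "mono (\<lambda>s::real. min s 0)"
    by (auto simp: mono_def)
  fix a b :: real
  show "min b 0 * (min b 0 - min a 0) \<le> min b 0 * (b - a)"
    by (cases "b < 0") (auto intro!: mult_left_mono_neg)
qed (use min_reaction_bounds in auto)

theorem theorem2p1:
  fixes X :: "real ^ 'd" and \<epsilon> \<gamma> M \<omega> :: real
    and \<phi>0 :: "real ^ 'd \<Rightarrow> real" and \<phi> :: "real \<Rightarrow> real ^ 'd \<Rightarrow> real"
  assumes "CARD('d) \<in> {2, 3}"
    and "\<And>i. 0 < X $ i"
    and "0 < \<epsilon>" and "0 < \<gamma>" and "0 < M" and "0 < \<omega>" and "\<omega> < 1"
    and "in_H1 X \<phi>0"
    and "global_weak_solution X \<epsilon> \<gamma> M \<omega> \<phi>0 \<phi>"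
    and "ereal (\<epsilon> * max \<omega> (1 - \<omega>) / 6) *
           (ereal \<gamma> * inv_laplacian_norm X + ereal (M * torus_vol X)) \<le> 1"
    and "AE x in torus X. 0 \<le> \<phi>0 x \<and> \<phi>0 x \<le> 1"
  shows "\<forall>t>0. AE x in torus X. 0 \<le> \<phi> t x \<and> \<phi> t x \<le> 1"
proof (intro allI impI)
  fix t :: real assume t: "0 < t"
  have X: "0 < X \<bullet> b" if "b \<in> Basis" for b
    using that assms(2) by (auto simp: Basis_vec_def inner_axis)
  \<comment> \<open>the smallness condition would have an infinite left-hand side\<close>
  have fin: "inv_laplacian_norm X < \<infinity>"
  proof (rule ccontr)
    assume "\<not> inv_laplacian_norm X < \<infinity>"
    then have "inv_laplacian_norm X = \<infinity>" by simp
    moreover define c where "c = \<epsilon> * max \<omega> (1 - \<omega>) / 6"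
    moreover have "0 < c"
      using assms(3,6) by (simp add: c_def less_max_iff_disj)
    ultimately show False
      using assms(4,10)[folded c_def] by simp
  qed
  interpret lower: cutoff "\<lambda>s. min s 0"
    by (rule min_cutoff)
  interpret upper: cutoff "\<lambda>s. - min (1 - s) 0"
    by (rule reflect_cutoff[OF min_cutoff])
  have "AE x in torus X. min (\<phi> t x) 0 = 0" "AE x in torus X. - min (1 - \<phi> t x) 0 = 0"
    using lower.cutoff_of_solution_eq_0[OF X assms(3-7,9) fin assms(11) t]
      upper.cutoff_of_solution_eq_0[OF X assms(3-7,9) fin assms(11) t] by auto
  then show "AE x in torus X. 0 \<le> \<phi> t x \<and> \<phi> t x \<le> 1"
    by eventually_elim linarith
qed

end
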